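(* a) For any $w\in M$ and $\mathbf{a}\in\mathcal{C}$, the standard parabolic subalgebras associated to $\mathbf{a}$ and to $w(\mathbf{a})$ have the same index, i.e. $\mathrm{ind}(\mathfrak{p}_{\mathbf{a}})=\mathrm{ind}(\mathfrak{p}_{w(\mathbf{a})})$. b) The monoid $M$ is free in the alphabet $A$.
   Context: $\Bbbk$ is an algebraically closed field of characteristic zero; $\mathbb{N}=\{0,1,2,\dots\}$, $\mathbb{N}^*=\mathbb{N}\setminus\{0\}$. For $n\in\mathbb{N}^*$, $\mathcal{C}_n$ is the set of compositions of $n$ (finite sequences $(a_1,\dots,a_r)$, $r\ge1$, of positive integers with sum $n$), and $\mathcal{C}=\bigcup_{n\in\mathbb{N}^*}\mathcal{C}_n$. For $\mathbf{a}\in\mathcal{C}_n$, $\mathfrak{p}_{\mathbf{a}}$ is the standard parabolic subalgebra of $\mathrm{sl}_n(\Bbbk)$ consisting of trace-zero block upper triangular matrices with diagonal block sizes $a_1,\dots,a_r$. The index of a Lie algebra $\mathfrak{g}$ is $\mathrm{ind}(\mathfrak{g})=\min_{f\in\mathfrak{g}^*}\dim\{x\in\mathfrak{g}: f([x,y])=0\ \forall y\in\mathfrak{g}\}$. Operators on $\mathcal{C}$: for $m\in\mathbb{N}$ and $\mathbf{a}=(a_1,\dots,a_r)\in\mathcal{C}$, - $\theta(\mathbf{a})=(a_r,\dots,a_1)$; - $\sigma_m(\mathbf{a})=((m+2)a_1,a_2,\dots,a_r,(m+1)a_1)$; - $\tau_m(\mathbf{a})=((m+1)a_1+(m+2)a_2,a_3,\dots,a_r,ma_1+(m+1)a_2)$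 if $r>1$, and $\tau_m(\mathbf{a})=\mathbf{a}$ if $r=1$; - $\widetilde{\sigma}_m=\theta\sigma_m$, $\widetilde{\tau}_m=\theta\tau_m$. Let $A=\{\sigma_m,\widetilde{\sigma}_m,\tau_m,\widetilde{\tau}_m : m\in\mathbb{N}\}$ and let $M$ be the submonoid generated by $A$ in the monoid (under composition) of maps $\mathcal{C}\to\mathcal{C}$. "Free in the alphabet $A$" means that every element of $M$ is uniquely a finite (possibly empty) product of elements of $A$. *)

theory Defs
  imports
    "HOL-Library.Function_Algebras"
    "HOL-Computational_Algebra.Polynomial"
begin

section \<open>Index of a Lie algebra\<close>

definition linear_form_on ::
  "('k::field \<Rightarrow> 'v::ab_group_add \<Rightarrow> 'v) \<Rightarrow> 'v set \<Rightarrow> ('v \<Rightarrow> 'k) \<Rightarrow> bool" where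
  "linear_form_on scale g f \<longleftrightarrow>
     (\<forall>x\<in>g. \<forall>y\<in>g. f (x + y) = f x + f y) \<and>
     (\<forall>c. \<forall>x\<in>g. f (scale c x) = c * f x)"

definition form_stabilizer ::
  "('v \<Rightarrow> 'v \<Rightarrow> 'v) \<Rightarrow> 'v set \<Rightarrow> ('v \<Rightarrow> 'k::zero) \<Rightarrow> 'v set" where
  "form_stabilizer bracket g f = {x \<in> g. \<forall>y\<in>g. f (bracket x y) = 0}"

text \<open>
  The Lie algebra is a subspace \<open>g\<close> of an ambient vector space, closed under \<open>bracket\<close>.
  Its dual is represented by the functions on the ambient type that are linear on \<open>g\<close>;
  values outside \<open>g\<close> are irrelevant. The zero form shows that the set of dimensions is
  nonempty, so \<open>LEAST\<close> is its minimum. The definition is meant for finite-dimensional \<open>g\<close>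
  only, since \<open>dim\<close> is \<open>0\<close> on infinite-dimensional spaces.
\<close>
definition lie_index ::
  "('k::field \<Rightarrow> 'v::ab_group_add \<Rightarrow> 'v) \<Rightarrow> ('v \<Rightarrow> 'v \<Rightarrow> 'v) \<Rightarrow> 'v set \<Rightarrow> nat" where
  "lie_index scale bracket g =
     (LEAST d. \<exists>f. linear_form_on scale g f \<and>
        d = vector_space.dim scale (form_stabilizer bracket g f))"


section \<open>Square matrices of variable size\<close>

text \<open>
  An \<open>n \<times> n\<close> matrix is a function \<open>nat \<Rightarrow> nat \<Rightarrow> 'k\<close> that vanishes outside
  \<open>{..<n} \<times> {..<n}\<close>; rows and columns are numbered from \<open>0\<close>. Addition is the pointwise one of
  \<open>Function_Algebras\<close>. Its pointwise multiplication is not used on matrices.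
\<close>
type_synonym 'k matrix = "nat \<Rightarrow> nat \<Rightarrow> 'k"

definition square_matrices :: "nat \<Rightarrow> ('k::zero) matrix set" where
  "square_matrices n = {x. \<forall>i j. \<not> (i < n \<and> j < n) \<longrightarrow> x i j = 0}"

definition matrix_scale :: "'k::times \<Rightarrow> 'k matrix \<Rightarrow> 'k matrix" where
  "matrix_scale c x = (\<lambda>i j. c * x i j)"

definition matrix_mult :: "nat \<Rightarrow> ('k::comm_ring_1) matrix \<Rightarrow> 'k matrix \<Rightarrow> 'k matrix" where
  "matrix_mult n x y = (\<lambda>i j. \<Sum>l<n. x i l * y l j)"

definition commutator :: "nat \<Rightarrow> ('k::comm_ring_1) matrix \<Rightarrow> 'k matrix \<Rightarrow> 'k matrix" where
  "commutator n x y = matrix_mult n x y - matrix_mult n y x"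

definition matrix_trace :: "nat \<Rightarrow> ('k::comm_ring_1) matrix \<Rightarrow> 'k" where
  "matrix_trace n x = (\<Sum>i<n. x i i)"

lemma vector_space_matrix_scale: "vector_space (matrix_scale :: 'k::field \<Rightarrow> _)"
  by unfold_locales (auto simp: matrix_scale_def fun_eq_iff algebra_simps)


section \<open>Compositions and standard parabolic subalgebras\<close>

text \<open>Compositions of all positive integers; the number composed is the sum of the list.\<close>
typedef composition = "{a :: nat list. a \<noteq> [] \<and> (\<forall>x\<in>set a. 0 < x)}"
  morphisms parts Composition
  by (intro exI[of _ "[1]"]) simp

setup_lifting type_definition_composition

definition comp_size :: "composition \<Rightarrow> nat" where
  "comp_size a = sum_list (parts a)"

text \<open>The number, counted from \<open>0\<close>, of the diagonal block that contains the index \<open>i\<close>.\<close>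
definition block_of :: "composition \<Rightarrow> nat \<Rightarrow> nat" where
  "block_of a i = (LEAST k. i < sum_list (take (Suc k) (parts a)))"

definition parabolic :: "composition \<Rightarrow> ('k::comm_ring_1) matrix set" where
  "parabolic a =
     {x \<in> square_matrices (comp_size a).
        matrix_trace (comp_size a) x = 0 \<and>
        (\<forall>i<comp_size a. \<forall>j<comp_size a. block_of a j < block_of a i \<longrightarrow> x i j = 0)}"

lemma subspace_parabolic:
  "module.subspace matrix_scale (parabolic a :: 'k::field matrix set)"
proof -
  interpret vector_space "matrix_scale :: 'k \<Rightarrow> _" by (rule vector_space_matrix_scale)
  show ?thesis
    by (rule subspaceI)
      (auto simp: parabolic_def square_matrices_def matrix_trace_def matrix_scale_def
        sum.distrib simp flip: sum_distrib_left)
qed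

lemma commutator_in_parabolic:
  fixes x y :: "'k::field matrix"
  assumes x: "x \<in> parabolic a" and y: "y \<in> parabolic a"
  shows "commutator (comp_size a) x y \<in> parabolic a"
proof -
  let ?n = "comp_size a"
  have zero: "matrix_mult ?n u v i j = 0"
    if "u \<in> parabolic a" "v \<in> parabolic a" "i < ?n" "j < ?n" "block_of a j < block_of a i"
    for u v :: "'k matrix" and i j
    unfolding matrix_mult_def
  proof (rule sum.neutral, rule ballI)
    fix l assume "l \<in> {..<?n}"
    then show "u i l * v l j = 0"
      using that by (cases "block_of a l < block_of a i") (auto simp: parabolic_def)
  qed
  have "(\<Sum>i<?n. \<Sum>l<?n. x i l * y l i) = (\<Sum>i<?n. \<Sum>l<?n. y i l * x l i)"
    by (subst sum.swap) (simp add: mult.commute)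
  then have "matrix_trace ?n (commutator ?n x y) = 0"
    by (simp add: matrix_trace_def commutator_def matrix_mult_def sum_subtractf)
  moreover have "commutator ?n x y \<in> square_matrices ?n"
    using x y
    by (auto simp: parabolic_def square_matrices_def commutator_def matrix_mult_def)
  ultimately show ?thesis
    using zero[OF x y] zero[OF y x] by (auto simp: parabolic_def commutator_def)
qed

definition parabolic_index :: "'k::field itself \<Rightarrow> composition \<Rightarrow> nat" where
  "parabolic_index _ a =
     lie_index matrix_scale (commutator (comp_size a)) (parabolic a :: 'k matrix set)"


section \<open>Operators on compositions\<close>

lift_definition theta :: "composition \<Rightarrow> composition" is rev
  by simp

fun sigma_list :: "nat \<Rightarrow> nat list \<Rightarrow> nat list" where
  "sigma_list m [] = []"
| "sigma_list m (a # as) = (m + 2) * a # as @ [(m + 1) * a]"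

fun tau_list :: "nat \<Rightarrow> nat list \<Rightarrow> nat list" where
  "tau_list m (a # b # as) = ((m + 1) * a + (m + 2) * b) # as @ [m * a + (m + 1) * b]"
| "tau_list m a = a"

lift_definition sigma :: "nat \<Rightarrow> composition \<Rightarrow> composition" is sigma_list
proof -
  fix m :: nat and a :: "nat list"
  assume "a \<noteq> [] \<and> (\<forall>x\<in>set a. 0 < x)"
  then show "sigma_list m a \<noteq> [] \<and> (\<forall>x\<in>set (sigma_list m a). 0 < x)"
    by (cases a) auto
qed

lift_definition tau :: "nat \<Rightarrow> composition \<Rightarrow> composition" is tau_list
proof -
  fix m :: nat and a :: "nat list"
  assume "a \<noteq> [] \<and> (\<forall>x\<in>set a. 0 < x)"
  then show "tau_list m a \<noteq> [] \<and> (\<forall>x\<in>set (tau_list m a). 0 < x)"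
    by (cases "(m, a)" rule: tau_list.cases) auto
qed

definition sigma_rev :: "nat \<Rightarrow> composition \<Rightarrow> composition" where
  "sigma_rev m = theta \<circ> sigma m"

definition tau_rev :: "nat \<Rightarrow> composition \<Rightarrow> composition" where
  "tau_rev m = theta \<circ> tau m"

definition alphabet :: "(composition \<Rightarrow> composition) set" where
  "alphabet = range sigma \<union> range sigma_rev \<union> range tau \<union> range tau_rev"


section \<open>Monoids of maps\<close>

inductive_set generated_submonoid :: "('a \<Rightarrow> 'a) set \<Rightarrow> ('a \<Rightarrow> 'a) set"
  for S :: "('a \<Rightarrow> 'a) set" where
  one: "id \<in> generated_submonoid S"
| incl: "g \<in> S \<Longrightarrow> g \<in> generated_submonoid S"
| mult: "v \<in> generated_submonoid S \<Longrightarrow> w \<in> generated_submonoid S \<Longrightarrow>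
    v \<circ> w \<in> generated_submonoid S"

text \<open>The word \<open>[g\<^sub>1, \<dots>, g\<^sub>p]\<close> stands for the product \<open>g\<^sub>1 \<circ> \<dots> \<circ> g\<^sub>p\<close>.\<close>
definition word_product :: "('a \<Rightarrow> 'a) list \<Rightarrow> 'a \<Rightarrow> 'a" where
  "word_product gs = foldr (\<circ>) gs id"

definition free_in_alphabet :: "('a \<Rightarrow> 'a) set \<Rightarrow> ('a \<Rightarrow> 'a) set \<Rightarrow> bool" where
  "free_in_alphabet S N \<longleftrightarrow> (\<forall>w\<in>N. \<exists>!gs. gs \<in> lists S \<and> word_product gs = w)"

end

theory Submission
  imports Defs "Jordan_Normal_Form.Char_Poly" "HOL-Library.Nat_Bijection"
begin

text \<open>
  Freeness. Let \<open>p\<close> and \<open>q\<close> be the first and the last part of a composition that a letter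
  produces from a composition with at least two parts. If \<open>p > q\<close>, the letter is some \<open>sigma m\<close>
  or \<open>tau m\<close>, and dividing \<open>q\<close> by \<open>p - q\<close> reveals which one: \<open>sigma m\<close> gives \<open>p - q = a\<^sub>1\<close> and
  \<open>q = (m + 1) a\<^sub>1\<close>, with remainder \<open>0\<close>, whereas \<open>tau m\<close> gives \<open>p - q = a\<^sub>1 + a\<^sub>2\<close> and
  \<open>q = m (a\<^sub>1 + a\<^sub>2) + a\<^sub>2\<close>, whose remainder \<open>a\<^sub>2\<close> is strictly between \<open>0\<close> and \<open>p - q\<close>. If
  \<open>p < q\<close>, the composition has to be reversed first. So the letter and its argument are
  determined (\<open>letter_inject\<close>). Since letters also enlarge the number that is composed, two
  words that agree at \<open>(1, 1)\<close> are equal (\<open>word_inject\<close>).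
  
  Index. Adding the scalar matrices raises the index by one and turns the parabolic subalgebra
  into the incidence algebra of a preorder \<open>R\<close>: the matrices \<open>x\<close> with \<open>x i j = 0\<close> unless
  \<open>(i, j) \<in> R\<close>. The main tool is a reduction in the style of Rais and Panyushev
  (\<open>incidence_index_reduction\<close>). Say that \<open>i\<close> lies above \<open>j\<close> if \<open>(i, j) \<in> R\<close>, let \<open>I\<close> be an
  equivalence class with nothing else below it and \<open>J\<close> the set of the other points above it.
  The matrices supported on \<open>J \<times> I\<close> form an abelian ideal \<open>V\<close>, and a linear form \<open>f\<close> restricts
  to \<open>V\<close> as an \<open>I \<times> J\<close> matrix \<open>\<xi>\<close>. If every linear form on \<open>V\<close> is \<open>f([x, -])\<close> for some \<open>x\<close>,
  then symplectic reduction (\<open>dim_radical_reduction\<close>) shows that the stabilizer of \<open>f\<close> has the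
  same dimension as a stabilizer in the smaller algebra that fixes \<open>\<xi>\<close>. For a partial
  permutation matrix \<open>\<xi>\<close> the latter is again the incidence algebra of a preorder, with fewer
  points. The radical of an alternating form grows only at finitely many parameters of a pencil
  (\<open>finite_radical_jumps\<close>), and an invertible block of \<open>\<xi>\<close> can be normalised by conjugation
  with units; hence some form with the smallest stabilizer has a partial permutation matrix as
  its \<open>\<xi>\<close>, and both algebras have the same index.
  
  For block sizes \<open>(p + d, mid, p)\<close> the reduction removes the last class; the first class falls
  apart into \<open>d\<close> points on top and a branch of \<open>p\<close> points below them, next to the chain \<open>mid\<close>.
  Further reductions shorten the branch by \<open>d\<close> at a time. If \<open>p\<close> is a multiple of \<open>d\<close>, the branch
  disappears and \<open>(d, mid)\<close> is left; a branch of at most \<open>d\<close> points can be merged into the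
  chain, which gives \<open>(d - p, p, mid)\<close>. The operator \<open>sigma m\<close> is the case \<open>d = a\<^sub>1\<close>,
  \<open>p = (m + 1) a\<^sub>1\<close>, and \<open>tau m\<close> is the case \<open>d = a\<^sub>1 + a\<^sub>2\<close>, \<open>p = a\<^sub>2 + m (a\<^sub>1 + a\<^sub>2)\<close>.
  Reversing a composition passes to the converse preorder, and the negative transpose is an
  isomorphism between the two algebras.
\<close>

section \<open>Singular matrices in a pencil\<close>

lemma nonzero_det_imp_inverse:
  fixes G :: "'a \<Rightarrow> 'a \<Rightarrow> 'k::field"
  assumes h: "bij_betw h {..<n} S"
    and det: "det (mat n n (\<lambda>(a, b). G (h a) (h b))) \<noteq> 0"
  shows "\<exists>Z. \<forall>i\<in>S. \<forall>j\<in>S. (\<Sum>k\<in>S. Z i k * G k j) = of_bool (i = j) \<and>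
           (\<Sum>k\<in>S. G i k * Z k j) = of_bool (i = j)"
proof -
  define A where "A = mat n n (\<lambda>(a, b). G (h a) (h b))"
  define hi where "hi = inv_into {..<n} h"
  have hi: "hi i < n" "h (hi i) = i" if "i \<in> S" for i
    using that h unfolding hi_def bij_betw_def by (metis inv_into_into lessThan_iff, metis f_inv_into_f)
  have A: "A \<in> carrier_mat n n" by (simp add: A_def)
  obtain B where B: "B \<in> carrier_mat n n" "B * A = 1\<^sub>m n" "A * B = 1\<^sub>m n"
    using det_non_zero_imp_unit[OF A, of "TYPE('k)"] det unfolding A_def[symmetric]
    by (auto simp: Units_def ring_mat_def)
  define Z where "Z i j = B $$ (hi i, hi j)" for i j
  have eqd: "hi i = hi j \<longleftrightarrow> i = j" if "i \<in> S" "j \<in> S" for i j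
    using hi that by metis
  have hb: "hi (h k) = k" if "k < n" for k
    using h that unfolding hi_def bij_betw_def by (simp add: inv_into_f_f)
  have 1: "(\<Sum>k\<in>S. Z i k * G k j) = of_bool (i = j)" if "i \<in> S" "j \<in> S" for i j
  proof -
    have "(\<Sum>k\<in>S. Z i k * G k j) = (\<Sum>k<n. Z i (h k) * G (h k) j)"
      using sum.reindex_bij_betw[OF h, of "\<lambda>k. Z i k * G k j"] by simp
    also have "\<dots> = (\<Sum>k<n. B $$ (hi i, k) * A $$ (k, hi j))"
      by (rule sum.cong) (auto simp: Z_def A_def hb hi that)
    also have "\<dots> = (B * A) $$ (hi i, hi j)"
      using A B(1) hi that by (simp add: scalar_prod_def atLeast0LessThan)
    also have "\<dots> = of_bool (i = j)" using hi that eqd by (simp add: B)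
    finally show ?thesis .
  qed
  have 2: "(\<Sum>k\<in>S. G i k * Z k j) = of_bool (i = j)" if "i \<in> S" "j \<in> S" for i j
  proof -
    have "(\<Sum>k\<in>S. G i k * Z k j) = (\<Sum>k<n. G i (h k) * Z (h k) j)"
      using sum.reindex_bij_betw[OF h, of "\<lambda>k. G i k * Z k j"] by simp
    also have "\<dots> = (\<Sum>k<n. A $$ (hi i, k) * B $$ (k, hi j))"
      by (rule sum.cong) (auto simp: Z_def A_def hb hi that)
    also have "\<dots> = (A * B) $$ (hi i, hi j)"
      using A B(1) hi that by (simp add: scalar_prod_def atLeast0LessThan)
    also have "\<dots> = of_bool (i = j)" using hi that eqd by (simp add: B)
    finally show ?thesis .
  qed
  show ?thesis using 1 2 by blast
qed

text \<open>
  The exceptions are among the roots of the characteristic polynomial of \<open>- Y\<close>.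
\<close>
lemma finite_singular_shifts:
  fixes Y :: "'a \<Rightarrow> 'a \<Rightarrow> 'k::field"
  assumes "finite S"
  shows "finite {t. \<nexists>Z. \<forall>i\<in>S. \<forall>j\<in>S.
      (\<Sum>k\<in>S. Z i k * (Y k j + t * of_bool (k = j))) = of_bool (i = j) \<and>
      (\<Sum>k\<in>S. (Y i k + t * of_bool (i = k)) * Z k j) = of_bool (i = j)}"
proof -
  obtain h where h: "bij_betw h {..<card S} S"
    using assms ex_bij_betw_nat_finite[of S] by (auto simp: atLeast0LessThan)
  let ?n = "card S"
  define A where "A = mat ?n ?n (\<lambda>(a, b). - Y (h a) (h b))"
  have A: "A \<in> carrier_mat ?n ?n" by (simp add: A_def)
  have p: "char_poly A \<noteq> 0" using degree_monic_char_poly[OF A] by auto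
  have "{t. \<nexists>Z. \<forall>i\<in>S. \<forall>j\<in>S.
      (\<Sum>k\<in>S. Z i k * (Y k j + t * of_bool (k = j))) = of_bool (i = j) \<and>
      (\<Sum>k\<in>S. (Y i k + t * of_bool (i = k)) * Z k j) = of_bool (i = j)} \<subseteq> {t. poly (char_poly A) t = 0}"
  proof (intro subsetI, simp only: mem_Collect_eq, erule contrapos_np)
    fix t assume t: "poly (char_poly A) t \<noteq> 0"
    have inj: "h a = h b \<longleftrightarrow> a = b" if "a < ?n" "b < ?n" for a b
      using h that by (auto simp: bij_betw_def inj_on_def)
    have "det (char_matrix A t) \<noteq> 0"
      using t eigenvalue_det[OF A] eigenvalue_root_char_poly[OF A] by simp
    moreover have "- char_matrix A t = mat ?n ?n (\<lambda>(a, b). Y (h a) (h b) + t * of_bool (h a = h b))"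
      by (rule eq_matI) (auto simp: char_matrix_def A_def inj)
    ultimately have "det (mat ?n ?n (\<lambda>(a, b). Y (h a) (h b) + t * of_bool (h a = h b))) \<noteq> 0"
      using det_0_negate[of "char_matrix A t" ?n] A by (metis char_matrix_closed)
    from nonzero_det_imp_inverse[OF h, of "\<lambda>a b. Y a b + t * of_bool (a = b)"] this
    show "\<exists>Z. \<forall>i\<in>S. \<forall>j\<in>S.
      (\<Sum>k\<in>S. Z i k * (Y k j + t * of_bool (k = j))) = of_bool (i = j) \<and>
      (\<Sum>k\<in>S. (Y i k + t * of_bool (i = k)) * Z k j) = of_bool (i = j)" by simp
  qed
  then show ?thesis using poly_roots_finite[OF p] finite_subset by blast
qed

text \<open>
  The determinant of \<open>G + t H\<close> is a polynomial in \<open>t\<close> that does not vanish at \<open>t = 0\<close>.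
\<close>
lemma finite_singular_pencil:
  fixes G H :: "'a \<Rightarrow> 'a \<Rightarrow> 'k::field"
  assumes fin: "finite S"
    and G: "\<And>v. (\<forall>l\<in>S. (\<Sum>k\<in>S. G l k * v k) = 0) \<Longrightarrow> \<forall>k\<in>S. v k = 0"
  shows "finite {t. \<exists>v. (\<forall>l\<in>S. (\<Sum>k\<in>S. (G l k + t * H l k) * v k) = 0) \<and> (\<exists>k\<in>S. v k \<noteq> 0)}"
proof -
  obtain h where h: "bij_betw h {..<card S} S"
    using assms ex_bij_betw_nat_finite[of S] by (auto simp: atLeast0LessThan)
  let ?n = "card S"
  define P where "P = mat ?n ?n (\<lambda>(a, b). [:G (h a) (h b), H (h a) (h b):])"
  define M where "M t = mat ?n ?n (\<lambda>(a, b). G (h a) (h b) + t * H (h a) (h b))" for t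
  have M: "M t \<in> carrier_mat ?n ?n" for t by (simp add: M_def)
  have ev: "poly (det P) t = det (M t)" for t
  proof -
    have "comm_ring_hom (\<lambda>p :: 'k poly. poly p t)" by unfold_locales auto
    moreover have "map_mat (\<lambda>p. poly p t) P = M t" by (rule eq_matI) (auto simp: P_def M_def)
    ultimately show ?thesis using comm_ring_hom.hom_det[of "\<lambda>p. poly p t" P] by simp
  qed
  have ker: "det (M t) = 0 \<longleftrightarrow> (\<exists>v. (\<forall>l\<in>S. (\<Sum>k\<in>S. (G l k + t * H l k) * v k) = 0) \<and> (\<exists>k\<in>S. v k \<noteq> 0))" for t
  proof -
    have re: "(\<Sum>k\<in>S. F k) = (\<Sum>k<?n. F (h k))" for F :: "'a \<Rightarrow> 'k"
      using sum.reindex_bij_betw[OF h, of F] by simp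
    have im: "h a \<in> S" if "a < ?n" for a using h that by (auto simp: bij_betw_def)
    have mv: "(M t *\<^sub>v w) $ a = (\<Sum>k<?n. (G (h a) (h k) + t * H (h a) (h k)) * w $ k)" 
      if "a < ?n" "dim_vec w = ?n" for a w
      using that by (simp add: M_def scalar_prod_def atLeast0LessThan)
    show ?thesis unfolding det_0_iff_vec_prod_zero[OF M]
    proof
      assume "\<exists>v. v \<in> carrier_vec ?n \<and> v \<noteq> 0\<^sub>v ?n \<and> M t *\<^sub>v v = 0\<^sub>v ?n"
      then obtain w where w: "w \<in> carrier_vec ?n" "w \<noteq> 0\<^sub>v ?n" "M t *\<^sub>v w = 0\<^sub>v ?n" by auto
      define v where "v = (\<lambda>k. w $ (inv_into {..<?n} h k))"
      have v: "v (h k) = w $ k" if "k < ?n" for k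
        using h that by (simp add: v_def bij_betw_def inv_into_f_f)
      obtain k where k: "k < ?n" "w $ k \<noteq> 0" using w(1,2) by (metis eq_vecI carrier_vecD index_zero_vec)
      have "(\<Sum>k\<in>S. (G l k + t * H l k) * v k) = 0" if l: "l \<in> S" for l
      proof -
        obtain a where a: "a < ?n" "l = h a" using l h by (auto simp: bij_betw_def)
        have "(\<Sum>k\<in>S. (G l k + t * H l k) * v k) = (M t *\<^sub>v w) $ a"
          unfolding mv[OF a(1) carrier_vecD[OF w(1)]] re a(2) by (simp add: v)
        then show ?thesis using w a by simp
      qed
      then show "\<exists>v. (\<forall>l\<in>S. (\<Sum>k\<in>S. (G l k + t * H l k) * v k) = 0) \<and> (\<exists>k\<in>S. v k \<noteq> 0)"
        using k v im by (intro exI[of _ v]) (metis (no_types, lifting))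
    next
      assume "\<exists>v. (\<forall>l\<in>S. (\<Sum>k\<in>S. (G l k + t * H l k) * v k) = 0) \<and> (\<exists>k\<in>S. v k \<noteq> 0)"
      then obtain v k where v: "\<forall>l\<in>S. (\<Sum>k\<in>S. (G l k + t * H l k) * v k) = 0" "k \<in> S" "v k \<noteq> 0" by auto
      define w where "w = vec ?n (\<lambda>a. v (h a))"
      obtain a where a: "a < ?n" "k = h a" using v(2) h by (auto simp: bij_betw_def)
      have "w \<noteq> 0\<^sub>v ?n" using a v by (metis index_vec index_zero_vec(1) w_def)
      moreover have "M t *\<^sub>v w = 0\<^sub>v ?n"
      proof (rule eq_vecI)
        fix a assume "a < dim_vec (0\<^sub>v ?n :: 'k vec)"
        then have a: "a < ?n" by simp
        have "(M t *\<^sub>v w) $ a = (\<Sum>k<?n. (G (h a) (h k) + t * H (h a) (h k)) * w $ k)"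
          by (rule mv) (use a in \<open>simp_all add: w_def\<close>)
        also have "\<dots> = (\<Sum>k\<in>S. (G (h a) k + t * H (h a) k) * v k)"
          by (simp add: re w_def)
        finally have "(M t *\<^sub>v w) $ a = (\<Sum>k\<in>S. (G (h a) k + t * H (h a) k) * v k)" .
        then show "(M t *\<^sub>v w) $ a = 0\<^sub>v ?n $ a" using v im a by simp
      qed (simp add: M_def)
      ultimately show "\<exists>v. v \<in> carrier_vec ?n \<and> v \<noteq> 0\<^sub>v ?n \<and> M t *\<^sub>v v = 0\<^sub>v ?n"
        by (intro exI[of _ w]) (simp add: w_def)
    qed
  qed
  have "det (M 0) \<noteq> 0" using ker[of 0] G by auto
  then have "det P \<noteq> 0" using ev[of 0] by auto
  then have "finite {t. poly (det P) t = 0}" by (rule poly_roots_finite)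
  then show ?thesis unfolding ev ker .
qed

section \<open>Radicals of alternating forms\<close>

definition radical :: "'v set \<Rightarrow> ('v \<Rightarrow> 'v \<Rightarrow> 'k::zero) \<Rightarrow> 'v set" where
  "radical g B = {x \<in> g. \<forall>y\<in>g. B x y = 0}"

lemma form_stabilizer_eq_radical: "form_stabilizer br g f = radical g (\<lambda>x y. f (br x y))"
  by (simp add: form_stabilizer_def radical_def)

lemma linear_form_on_add: "linear_form_on s g f \<Longrightarrow> x \<in> g \<Longrightarrow> y \<in> g \<Longrightarrow> f (x + y) = f x + f y"
  by (simp add: linear_form_on_def)

lemma linear_form_on_scale: "linear_form_on s g f \<Longrightarrow> x \<in> g \<Longrightarrow> f (s c x) = c * f x"
  by (simp add: linear_form_on_def)

definition bilinear_form_on ::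
  "('k::field \<Rightarrow> 'v::ab_group_add \<Rightarrow> 'v) \<Rightarrow> 'v set \<Rightarrow> ('v \<Rightarrow> 'v \<Rightarrow> 'k) \<Rightarrow> bool" where
  "bilinear_form_on s g B \<longleftrightarrow>
     (\<forall>x\<in>g. linear_form_on s g (B x)) \<and> (\<forall>y\<in>g. linear_form_on s g (\<lambda>x. B x y))"

context vector_space
begin

lemma linear_form_on_0:
  assumes "linear_form_on scale g f" "subspace g"
  shows "f 0 = 0"
  using linear_form_on_scale[OF assms(1) subspace_0[OF assms(2)], of 0] by simp

lemma linear_form_on_sum_scale:
  assumes f: "linear_form_on scale g f" and g: "subspace g" and x: "\<And>i. i \<in> A \<Longrightarrow> x i \<in> g"
  shows "f (\<Sum>i\<in>A. scale (c i) (x i)) = (\<Sum>i\<in>A. c i * f (x i))"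
proof (cases "finite A")
  case True
  then show ?thesis using x
  proof (induction A)
    case (insert a A)
    then show ?case
      by (simp add: linear_form_on_add[OF f] linear_form_on_scale[OF f] subspace_scale[OF g] subspace_sum[OF g])
  qed (simp add: linear_form_on_0[OF f g])
qed (simp add: linear_form_on_0[OF f g])

lemma subspace_radical:
  assumes "bilinear_form_on scale g B" "subspace g"
  shows "subspace (radical g B)"
proof (rule subspaceI)
  show "0 \<in> radical g B"
    using assms linear_form_on_0[of g "\<lambda>x. B x y" for y]
    by (auto simp: radical_def bilinear_form_on_def subspace_0)
qed (use assms in \<open>auto simp: radical_def bilinear_form_on_def linear_form_on_def subspace_add subspace_scale\<close>)

lemma dim_linear_image_on:
  assumes S: "subspace S"
    and add: "\<And>x y. x \<in> S \<Longrightarrow> y \<in> S \<Longrightarrow> T (x + y) = T x + T y"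
    and scl: "\<And>c x. x \<in> S \<Longrightarrow> T (scale c x) = scale c (T x)"
    and inj: "\<And>x. x \<in> S \<Longrightarrow> T x = 0 \<Longrightarrow> x = 0"
  shows "dim (T ` S) = dim S"
proof -
  interpret vp: vector_space_pair scale scale by unfold_locales
  obtain B where B: "B \<subseteq> S" "independent B" "S \<subseteq> span B" "card B = dim S"
    using basis_exists by blast
  have SB: "span B = S" using B S span_minimal by blast
  obtain L where L: "Vector_Spaces.linear scale scale L" "\<And>x. x \<in> B \<Longrightarrow> L x = T x"
    using vp.linear_independent_extend[OF B(2), of T] by auto
  have eq: "L x = T x" if "x \<in> S" for x
  proof -
    have "x \<in> S \<and> L x = T x" if "x \<in> span B" using that
    proof (induction rule: span_induct_alt)
      case base
      have "T 0 = 0" using scl[OF subspace_0[OF S], of 0] by simp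
      then show ?case using vp.linear_0[OF L(1)] S subspace_0 by simp
    next
      case (step c x y)
      then show ?case using B(1) S L
        by (auto simp: add scl subspace_add subspace_scale vp.linear_add[OF L(1)] vp.linear_scale[OF L(1)])
    qed
    then show ?thesis using that SB by blast
  qed
  have im: "T ` S = L ` S" using eq by auto
  have "inj_on L S"
    unfolding vp.linear_inj_on_iff_eq_0[OF L(1) S] using eq inj by simp
  then have ind: "independent (L ` B)" 
    using vp.linear_independent_injective_image[OF L(1) B(2)] SB by simp
  have "span (L ` B) = L ` S" using vp.linear_span_image[OF L(1), of B] SB by simp
  then have "dim (L ` S) = card (L ` B)" using dim_span_eq_card_independent[OF ind] by simp
  also have "\<dots> = card B" by (rule card_image) (use \<open>inj_on L S\<close> B(1) in \<open>blast intro: inj_on_subset\<close>)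
  finally show ?thesis using B im by simp
qed

text \<open>
  Symplectic reduction. The span \<open>V\<close> of the \<open>E p\<close> is isotropic, and the \<open>e p\<close> in the complement
  \<open>q\<close> are dual to it, so \<open>V\<close> and the \<open>e p\<close> cancel and only the annihilator of \<open>V\<close> in \<open>q\<close>
  contributes to the radical. An element \<open>x\<close> of the small radical need not be orthogonal to the
  \<open>e p\<close>; adding the element of \<open>V\<close> with coefficients \<open>B x (e p)\<close> repairs this, and that is the
  isomorphism onto the large radical.
\<close>
lemma dim_radical_reduction:
  fixes E e :: "'p \<Rightarrow> 'b"
  assumes g: "subspace g" and q: "subspace q" "q \<subseteq> g" and P: "finite P"
    and E: "\<And>p. p \<in> P \<Longrightarrow> E p \<in> g" and e: "\<And>p. p \<in> P \<Longrightarrow> e p \<in> q"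
    and B: "bilinear_form_on scale g B" and alt: "\<And>x y. x \<in> g \<Longrightarrow> y \<in> g \<Longrightarrow> B x y = - B y x"
    and EE: "\<And>p p'. p \<in> P \<Longrightarrow> p' \<in> P \<Longrightarrow> B (E p) (E p') = 0"
    and eE: "\<And>p p'. p \<in> P \<Longrightarrow> p' \<in> P \<Longrightarrow> B (e p) (E p') = of_bool (p = p')"
    and dec: "\<And>x. x \<in> g \<Longrightarrow> \<exists>u\<in>q. \<exists>c. x = u + (\<Sum>p\<in>P. scale (c p) (E p))"
    and direct: "\<And>c. (\<Sum>p\<in>P. scale (c p) (E p)) \<in> q \<Longrightarrow> (\<Sum>p\<in>P. scale (c p) (E p)) = 0"
  shows "dim (radical g B) = dim (radical {x \<in> q. \<forall>p\<in>P. B x (E p) = 0} B)"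
proof -
  define q0 where "q0 = {x \<in> q. \<forall>p\<in>P. B x (E p) = 0}"
  have Bl: "linear_form_on scale g (B x)" if "x \<in> g" for x
    using B that by (simp add: bilinear_form_on_def)
  have Br: "linear_form_on scale g (\<lambda>x. B x y)" if "y \<in> g" for y
    using B that by (simp add: bilinear_form_on_def)
  have eg: "e p \<in> g" if "p \<in> P" for p using e q that by blast
  have q0q: "q0 \<subseteq> q" "q0 \<subseteq> g" using q by (auto simp: q0_def)
  have q0: "subspace q0"
  proof (rule subspaceI)
    show "0 \<in> q0" using linear_form_on_0[OF Br g] E by (auto simp: q0_def subspace_0 q)
    have "B (x + y) (E p) = B x (E p) + B y (E p)" if "x \<in> q" "y \<in> q" "p \<in> P" for x y p
      using that linear_form_on_add[OF Br[OF E[OF that(3)]], of x y] q(2) by blast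
    then show "x + y \<in> q0" if "x \<in> q0" "y \<in> q0" for x y
      using that q(1) by (simp add: q0_def subspace_add)
    have "B (scale c x) (E p) = c * B x (E p)" if "x \<in> q" "p \<in> P" for x c p
      using that linear_form_on_scale[OF Br[OF E[OF that(2)]], of x c] q(2) by blast
    then show "scale c x \<in> q0" if "x \<in> q0" for c x
      using that q(1) by (simp add: q0_def subspace_scale)
  qed
  define V where "V c = (\<Sum>p\<in>P. scale (c p) (E p))" for c
  have Vg: "V c \<in> g" for c unfolding V_def using E g by (intro subspace_sum subspace_scale)
  have BV: "B (V c) y = (\<Sum>p\<in>P. c p * B (E p) y)" if "y \<in> g" for c y
    unfolding V_def using linear_form_on_sum_scale[OF Br[OF that] g, of P E c] E by simp
  have VE: "B (V c) (E p) = 0" if "p \<in> P" for c p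
    using that by (simp add: BV E EE)
  have Ve: "B (V c) (e p) = - c p" if "p \<in> P" for c p
  proof -
    have "B (V c) (e p) = (\<Sum>p'\<in>P. - (c p' * of_bool (p = p')))"
      unfolding BV[OF eg[OF that]] using that
      by (intro sum.cong) (auto simp: alt[OF E eg] eE)
    also have "\<dots> = (\<Sum>p'\<in>P. if p = p' then - c p' else 0)" by (rule sum.cong) auto
    also have "\<dots> = - c p" using that P by simp
    finally show ?thesis .
  qed
  define T where "T x = x + V (\<lambda>p. B x (e p))" for x
  have R0: "subspace (radical q0 B)"
    by (rule subspace_radical[OF _ q0]) (use B q0q in \<open>auto simp: bilinear_form_on_def linear_form_on_def subset_iff\<close>)
  have R0q: "x \<in> q0" "x \<in> q" "x \<in> g" if "x \<in> radical q0 B" for x using that q0q by (auto simp: radical_def)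
  have "dim (T ` radical q0 B) = dim (radical q0 B)"
  proof (rule dim_linear_image_on[OF R0])
    fix x y assume "x \<in> radical q0 B" "y \<in> radical q0 B"
    then show "T (x + y) = T x + T y"
      using R0q by (simp add: T_def V_def linear_form_on_add[OF Br] eg scale_left_distrib sum.distrib)
  next
    fix c x assume "x \<in> radical q0 B"
    then show "T (scale c x) = scale c (T x)"
      using R0q by (simp add: T_def V_def linear_form_on_scale[OF Br] eg scale_right_distrib scale_sum_right)
  next
    fix x assume x: "x \<in> radical q0 B" "T x = 0"
    then have "V (\<lambda>p. B x (e p)) = - x" unfolding T_def by (metis add.commute eq_neg_iff_add_eq_0)
    moreover have "- x \<in> q" using R0q[OF x(1)] q by (simp add: subspace_neg)
    ultimately show "x = 0" using direct[of "\<lambda>p. B x (e p)"] unfolding V_def by simp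
  qed
  moreover have "T ` radical q0 B = radical g B"
  proof (intro equalityI subsetI)
    fix z assume "z \<in> T ` radical q0 B"
    then obtain x where x: "x \<in> radical q0 B" and z: "z = T x" by auto
    have xg: "x \<in> g" using R0q[OF x] by blast
    have Tg: "T x \<in> g" unfolding T_def using xg Vg g by (simp add: subspace_add)
    have TB: "B (T x) y = B x y + (\<Sum>p\<in>P. B x (e p) * B (E p) y)" if "y \<in> g" for y
      unfolding T_def using linear_form_on_add[OF Br[OF that] xg Vg] by (simp add: BV that)
    have TE: "B (T x) (E p) = 0" if "p \<in> P" for p
      using that R0q(1)[OF x] by (simp add: TB E EE) (simp add: q0_def)
    have Tq: "B (T x) y = 0" if y: "y \<in> q" for y
    proof -
      have yg: "y \<in> g" using y q by blast
      \<comment> \<open>the projection of \<open>y\<close> to the annihilator of \<open>V\<close> along the \<open>e p\<close>\<close>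
      define y' where "y' = y - (\<Sum>p\<in>P. scale (B y (E p)) (e p))"
      have s: "(\<Sum>p\<in>P. scale (B y (E p)) (e p)) \<in> q" using e q by (intro subspace_sum subspace_scale)
      have y': "y' \<in> q" unfolding y'_def by (rule subspace_diff[OF q(1) y s])
      have yy: "y = y' + (\<Sum>p\<in>P. scale (B y (E p)) (e p))" by (simp add: y'_def)
      have y'g: "y' \<in> g" and sg: "(\<Sum>p\<in>P. scale (B y (E p)) (e p)) \<in> g" using y' s q by auto
      have "B y' (E p) = 0" if p: "p \<in> P" for p
      proof -
        have "B y (E p) = B y' (E p) + B (\<Sum>p\<in>P. scale (B y (E p)) (e p)) (E p)"
          using linear_form_on_add[OF Br[OF E[OF p]] y'g sg] yy by metis
        also have "B (\<Sum>p\<in>P. scale (B y (E p)) (e p)) (E p) = (\<Sum>p'\<in>P. B y (E p') * B (e p') (E p))"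
          using linear_form_on_sum_scale[OF Br[OF E[OF p]] g, of P e "\<lambda>p. B y (E p)"] eg by simp
        also have "\<dots> = (\<Sum>p'\<in>P. if p = p' then B y (E p') else 0)"
          using p by (intro sum.cong) (auto simp: eE)
        also have "\<dots> = B y (E p)" using p P by simp
        finally show ?thesis by simp
      qed
      then have "B x y' = 0" using x y' by (simp add: radical_def q0_def)
      then have "B x y = B x (\<Sum>p\<in>P. scale (B y (E p)) (e p))"
        using linear_form_on_add[OF Bl[OF xg] y'g sg] yy by simp
      also have "\<dots> = (\<Sum>p\<in>P. B y (E p) * B x (e p))"
        using linear_form_on_sum_scale[OF Bl[OF xg] g, of P e "\<lambda>p. B y (E p)"] eg by simp
      also have "\<dots> = - (\<Sum>p\<in>P. B x (e p) * B (E p) y)"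
        unfolding sum_negf[symmetric] by (intro sum.cong) (auto simp: alt[OF E yg] mult.commute)
      finally show ?thesis using TB[OF yg] by simp
    qed
    have "B (T x) y = 0" if yg: "y \<in> g" for y
    proof -
      obtain u c where u: "u \<in> q" "y = u + V c" using dec[OF yg] unfolding V_def by blast
      have "B (T x) (V c) = (\<Sum>p\<in>P. c p * B (T x) (E p))"
        unfolding V_def using linear_form_on_sum_scale[OF Bl[OF Tg] g, of P E c] E by simp
      then show ?thesis
        using u q linear_form_on_add[OF Bl[OF Tg], of u "V c"] Vg Tq[OF u(1)] by (auto simp: TE)
    qed
    then show "z \<in> radical g B" using Tg z by (simp add: radical_def)
  next
    fix y assume y: "y \<in> radical g B"
    then have yg: "y \<in> g" and y0: "\<And>w. w \<in> g \<Longrightarrow> B y w = 0" by (auto simp: radical_def)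
    obtain u c where u: "u \<in> q" "y = u + V c" using dec[OF yg] unfolding V_def by blast
    have ug: "u \<in> g" using u q by blast
    have yB: "B y w = B u w + B (V c) w" if "w \<in> g" for w
      using linear_form_on_add[OF Br[OF that] ug Vg] u by simp
    have "u \<in> q0" using u yB[OF E] y0[OF E] VE by (auto simp: q0_def)
    have Vq0: "B (V c) w = 0" if "w \<in> q0" for w
    proof -
      have "B (V c) w = (\<Sum>p\<in>P. c p * (- B w (E p)))"
        using that q0q by (auto simp: BV alt[OF E] intro!: sum.cong)
      then show ?thesis using that by (simp add: q0_def)
    qed
    have "u \<in> radical q0 B" unfolding radical_def 
      using \<open>u \<in> q0\<close> yB y0 Vq0 q0q by force
    moreover have "T u = y"
    proof -
      have "B u (e p) = c p" if "p \<in> P" for p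
        using yB[OF eg[OF that]] y0[OF eg[OF that]] Ve[OF that] by simp
      then have "V (\<lambda>p. B u (e p)) = V c" unfolding V_def by (intro sum.cong) auto
      then show ?thesis by (simp add: T_def u)
    qed
    ultimately show "y \<in> T ` radical q0 B" by blast
  qed
  ultimately show ?thesis by (simp add: q0_def)
qed

text \<open>
  Let \<open>S\<close> be a basis of a complement of the radical of \<open>B\<close>. The Gram matrix of \<open>B\<close> on \<open>S\<close> is
  nonsingular, so that of \<open>B + t C\<close> is nonsingular for all but finitely many \<open>t\<close>. For these \<open>t\<close>
  the new radical meets the span of \<open>S\<close> trivially, hence it is not larger than the old one.
\<close>
lemma finite_radical_jumps:
  assumes g: "subspace g" "g \<subseteq> span W" "finite W"
    and B: "bilinear_form_on scale g B" and alt: "\<And>x y. x \<in> g \<Longrightarrow> y \<in> g \<Longrightarrow> B x y = - B y x"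
    and C: "bilinear_form_on scale g C"
  shows "finite {t. dim (radical g B) < dim (radical g (\<lambda>x y. B x y + t * C x y))}"
proof -
  let ?R = "radical g B"
  let ?Rt = "\<lambda>t. radical g (\<lambda>x y. B x y + t * C x y)"
  have R: "subspace ?R" by (rule subspace_radical[OF B g(1)])
  obtain D where D: "D \<subseteq> ?R" "independent D" "?R \<subseteq> span D" "card D = dim ?R"
    using basis_exists by blast
  have Dg: "D \<subseteq> g" using D by (auto simp: radical_def)
  obtain F where F: "D \<subseteq> F" "F \<subseteq> g" "independent F" "g \<subseteq> span F"
    using maximal_independent_subset_extend[OF Dg D(2)] by blast
  have finF: "finite F" "card F \<le> card W"
    using independent_span_bound[OF g(3) F(3)] F(2) g(2) by auto
  define S where "S = F - D"
  have "independent S" using independent_mono[OF F(3)] by (simp add: S_def)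
  then have S: "finite S" "S \<subseteq> g" "independent S" "card F = card S + card D"
    using finF F D finite_subset[OF F(1)] card_Diff_subset[of D F] card_mono[of F D]
    by (auto simp: S_def)
  have Bl: "linear_form_on scale g (B x)" if "x \<in> g" for x
    using B that by (simp add: bilinear_form_on_def)
  have Br: "linear_form_on scale g (\<lambda>x. B x y)" if "y \<in> g" for y
    using B that by (simp add: bilinear_form_on_def)
  have Cr: "linear_form_on scale g (\<lambda>x. C x y)" if "y \<in> g" for y
    using C that by (simp add: bilinear_form_on_def)
  have triv: "\<forall>k\<in>S. v k = 0" if v: "\<forall>l\<in>S. (\<Sum>k\<in>S. B k l * v k) = 0" for v
  proof -
    let ?x = "\<Sum>k\<in>S. scale (v k) k"
    have xg: "?x \<in> g" using S g by (intro subspace_sum subspace_scale) auto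
    have xl: "B ?x l = (\<Sum>k\<in>S. v k * B k l)" if "l \<in> g" for l
      using linear_form_on_sum_scale[OF Br[OF that] g(1), of S "\<lambda>k. k" v] S by auto
    have xF: "B ?x l = 0" if "l \<in> F" for l
    proof (cases "l \<in> D")
      case True
      then have "l \<in> radical g B" "l \<in> g" using D Dg by auto
      then have "B ?x l = - B l ?x" "B l ?x = 0" using alt[OF xg] xg by (blast, simp add: radical_def)
      then show ?thesis by simp
    next
      case False
      then show ?thesis using that v xl[of l] F by (auto simp: S_def mult.commute)
    qed
    have "B ?x y = 0" if y: "y \<in> g" for y
    proof -
      have "y \<in> span F" using y F by auto
      then obtain u where u: "y = (\<Sum>k\<in>F. scale (u k) k)" using span_finite[OF finF(1)] by auto
      show ?thesis unfolding u
        using linear_form_on_sum_scale[OF Bl[OF xg] g(1), of F "\<lambda>k. k" u] F xF by auto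
    qed
    then have "?x \<in> span D" using xg D by (auto simp: radical_def)
    then obtain u where u: "?x = (\<Sum>k\<in>D. scale (u k) k)"
      using span_finite[of D] finF F finite_subset by (metis (no_types, lifting) imageE)
    have "(\<Sum>k\<in>F. scale (if k \<in> D then - u k else v k) k) = 0"
    proof -
      have FU: "F = S \<union> D" "S \<inter> D = {}" using F by (auto simp: S_def)
      have "(\<Sum>k\<in>F. scale (if k \<in> D then - u k else v k) k) = ?x + (\<Sum>k\<in>D. scale (- u k) k)"
        unfolding FU(1) using S(1) finF F finite_subset FU(2)
        by (subst sum.union_disjoint) (auto intro!: sum.cong arg_cong2[where f="(+)"])
      also have "\<dots> = 0" unfolding u by (simp add: sum_negf)
      finally show ?thesis .
    qed
    from independentD[OF F(3) finF(1) subset_refl this]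
    show ?thesis by (metis DiffE S_def)
  qed
  have "finite {t. \<exists>v. (\<forall>l\<in>S. (\<Sum>k\<in>S. (B k l + t * C k l) * v k) = 0) \<and> (\<exists>k\<in>S. v k \<noteq> 0)}"
    by (rule finite_singular_pencil[OF S(1), of "\<lambda>l k. B k l" "\<lambda>l k. C k l"]) (rule triv)
  moreover have "{t. dim ?R < dim (?Rt t)} \<subseteq> {t. \<exists>v. (\<forall>l\<in>S. (\<Sum>k\<in>S. (B k l + t * C k l) * v k) = 0) \<and> (\<exists>k\<in>S. v k \<noteq> 0)}"
  proof (intro subsetI, simp only: mem_Collect_eq, rule ccontr)
    fix t assume t: "dim ?R < dim (?Rt t)"
      and no: "\<nexists>v. (\<forall>l\<in>S. (\<Sum>k\<in>S. (B k l + t * C k l) * v k) = 0) \<and> (\<exists>k\<in>S. v k \<noteq> 0)"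
    obtain G where G: "G \<subseteq> ?Rt t" "independent G" "?Rt t \<subseteq> span G" "card G = dim (?Rt t)"
      using basis_exists by blast
    have Gg: "G \<subseteq> g" using G by (auto simp: radical_def)
    have finG: "finite G" using independent_span_bound[OF finF(1) G(2)] Gg F by blast
    have disj: "\<forall>k\<in>S. v k = 0" if eq: "(\<Sum>k\<in>S. scale (v k) k) \<in> ?Rt t" for v
    proof -
      have "(\<Sum>k\<in>S. (B k l + t * C k l) * v k) = 0" if "l \<in> S" for l
      proof -
        have lg: "l \<in> g" using that S by auto
        have "0 = B (\<Sum>k\<in>S. scale (v k) k) l + t * C (\<Sum>k\<in>S. scale (v k) k) l"
          using eq lg by (auto simp: radical_def)
        also have "\<dots> = (\<Sum>k\<in>S. v k * B k l) + t * (\<Sum>k\<in>S. v k * C k l)"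
          using linear_form_on_sum_scale[OF Br[OF lg] g(1), of S "\<lambda>k. k" v, OF subsetD[OF S(2)]]
            linear_form_on_sum_scale[OF Cr[OF lg] g(1), of S "\<lambda>k. k" v, OF subsetD[OF S(2)]] by simp
        finally show ?thesis by (simp add: sum.distrib sum_distrib_left algebra_simps)
      qed
      then show ?thesis using no by blast
    qed
    have BC: "bilinear_form_on scale g (\<lambda>x y. B x y + t * C x y)"
      using B C by (auto simp: bilinear_form_on_def linear_form_on_def algebra_simps)
    have Rt: "subspace (?Rt t)" by (rule subspace_radical[OF BC g(1)])
    have GS: "G \<inter> S = {}"
    proof (rule ccontr)
      assume "G \<inter> S \<noteq> {}"
      then obtain x where x: "x \<in> G" "x \<in> S" by blast
      have "(\<Sum>k\<in>S. scale (of_bool (k = x)) k) = (\<Sum>k\<in>S. if k = x then x else 0)"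
        by (rule sum.cong) auto
      also have "\<dots> = x" using x S by simp
      finally have "(\<Sum>k\<in>S. scale (of_bool (k = x)) k) = x" .
      then have "\<forall>k\<in>S. (of_bool (k = x) :: 'a) = 0" using disj[of "\<lambda>k. of_bool (k = x)"] G x by auto
      then show False using x by auto
    qed
    have "independent (G \<union> S)"
    proof (rule independent_if_scalars_zero)
      show "finite (G \<union> S)" using finG S by simp
      fix v x assume z: "(\<Sum>k\<in>G \<union> S. scale (v k) k) = 0" and x: "x \<in> G \<union> S"
      have e: "(\<Sum>k\<in>G. scale (v k) k) + (\<Sum>k\<in>S. scale (v k) k) = 0"
        using z finG S GS by (simp add: sum.union_disjoint)
      then have "(\<Sum>k\<in>S. scale (v k) k) = - (\<Sum>k\<in>G. scale (v k) k)"
        by (metis add.commute eq_neg_iff_add_eq_0)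
      also have "\<dots> \<in> ?Rt t" using G(1) Rt by (intro subspace_neg subspace_sum subspace_scale) auto
      finally have "\<forall>k\<in>S. v k = 0" by (rule disj)
      moreover from this have "(\<Sum>k\<in>G. scale (v k) k) = 0" using e by simp
      then have "\<forall>k\<in>G. v k = 0" using independentD[OF G(2) finG subset_refl] by blast
      ultimately show "v x = 0" using x by blast
    qed
    then have "card (G \<union> S) \<le> card F"
      using independent_span_bound[OF finF(1)] Gg S F by blast
    then have "card G + card S \<le> card D + card S" using card_Un_disjoint[OF finG S(1) GS] S by simp
    then show False using t D G by simp
  qed
  ultimately show ?thesis using finite_subset by blast
qed

end

section \<open>Transport of the index of a Lie algebra\<close>

context vector_space
begin

lemma dim_radical_image:
  assumes g': "subspace g'" and B: "bilinear_form_on scale g' (\<lambda>x y. B (\<psi> x) (\<psi> y))"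
    and add: "\<And>x y. x \<in> g' \<Longrightarrow> y \<in> g' \<Longrightarrow> \<psi> (x + y) = \<psi> x + \<psi> y"
    and scl: "\<And>c x. x \<in> g' \<Longrightarrow> \<psi> (scale c x) = scale c (\<psi> x)"
    and inj: "\<And>x. x \<in> g' \<Longrightarrow> \<psi> x = 0 \<Longrightarrow> x = 0"
    and im: "\<psi> ` g' = g"
  shows "dim (radical g B) = dim (radical g' (\<lambda>x y. B (\<psi> x) (\<psi> y)))"
proof -
  let ?R = "radical g' (\<lambda>x y. B (\<psi> x) (\<psi> y))"
  have "dim (\<psi> ` ?R) = dim ?R"
    by (rule dim_linear_image_on[OF subspace_radical[OF B g']]) (auto simp: radical_def add scl inj)
  moreover have "\<psi> ` ?R = radical g B"
    unfolding radical_def im[symmetric] by auto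
  ultimately show ?thesis by simp
qed

lemma lie_index_le:
  "linear_form_on scale g f \<Longrightarrow> lie_index scale br g \<le> dim (form_stabilizer br g f)"
  unfolding lie_index_def by (rule Least_le) auto

lemma lie_index_attained:
  obtains f where "linear_form_on scale g f" "lie_index scale br g = dim (form_stabilizer br g f)"
proof -
  have "linear_form_on scale g (\<lambda>_. 0)" by (simp add: linear_form_on_def)
  then have "\<exists>d f. linear_form_on scale g f \<and> d = dim (form_stabilizer br g f)" by blast
  then have "\<exists>f. linear_form_on scale g f \<and> lie_index scale br g = dim (form_stabilizer br g f)"
    unfolding lie_index_def by (rule LeastI_ex)
  then show ?thesis using that by blast
qed

lemma dim_form_stabilizer_image:
  assumes g': "subspace g'"
    and br': "\<And>x y. x \<in> g' \<Longrightarrow> y \<in> g' \<Longrightarrow> br' x y \<in> g'"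
    and add: "\<And>x y. x \<in> g' \<Longrightarrow> y \<in> g' \<Longrightarrow> \<psi> (x + y) = \<psi> x + \<psi> y"
    and scl: "\<And>c x. x \<in> g' \<Longrightarrow> \<psi> (scale c x) = scale c (\<psi> x)"
    and inj: "\<And>x. x \<in> g' \<Longrightarrow> \<psi> x = 0 \<Longrightarrow> x = 0"
    and im: "\<psi> ` g' = g"
    and hom: "\<And>x y. x \<in> g' \<Longrightarrow> y \<in> g' \<Longrightarrow> \<psi> (br' x y) = br (\<psi> x) (\<psi> y)"
    and B: "bilinear_form_on scale g' (\<lambda>x y. f (br (\<psi> x) (\<psi> y)))"
  shows "dim (form_stabilizer br g f) = dim (form_stabilizer br' g' (f \<circ> \<psi>))"
proof -
  have eq: "form_stabilizer br' g' (f \<circ> \<psi>) = radical g' (\<lambda>x y. f (br (\<psi> x) (\<psi> y)))"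
    unfolding form_stabilizer_eq_radical radical_def using hom by auto
  show ?thesis
    unfolding eq form_stabilizer_eq_radical[of br g f]
    by (rule dim_radical_image[where B = "\<lambda>x y. f (br x y)" and \<psi> = \<psi>, OF g' B add scl inj im])
qed

text \<open>
  One inequality for an isomorphism \<open>\<psi>\<close>; the other one comes from its inverse.
\<close>
lemma lie_index_le_image:
  assumes g': "subspace g'"
    and br': "\<And>x y. x \<in> g' \<Longrightarrow> y \<in> g' \<Longrightarrow> br' x y \<in> g'"
    and add: "\<And>x y. x \<in> g' \<Longrightarrow> y \<in> g' \<Longrightarrow> \<psi> (x + y) = \<psi> x + \<psi> y"
    and scl: "\<And>c x. x \<in> g' \<Longrightarrow> \<psi> (scale c x) = scale c (\<psi> x)"
    and inj: "\<And>x. x \<in> g' \<Longrightarrow> \<psi> x = 0 \<Longrightarrow> x = 0"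
    and im: "\<psi> ` g' = g"
    and hom: "\<And>x y. x \<in> g' \<Longrightarrow> y \<in> g' \<Longrightarrow> \<psi> (br' x y) = br (\<psi> x) (\<psi> y)"
    and B: "\<And>f. linear_form_on scale g f \<Longrightarrow> bilinear_form_on scale g (\<lambda>x y. f (br x y))"
  shows "lie_index scale br' g' \<le> lie_index scale br g"
proof -
  obtain f where f: "linear_form_on scale g f" "lie_index scale br g = dim (form_stabilizer br g f)"
    by (rule lie_index_attained)
  have lin: "linear_form_on scale g' (f \<circ> \<psi>)"
    using f(1) add scl im unfolding linear_form_on_def by (metis comp_apply imageI)
  have "bilinear_form_on scale g' (\<lambda>x y. f (br (\<psi> x) (\<psi> y)))"
    using B[OF f(1)] add scl im unfolding bilinear_form_on_def linear_form_on_def by auto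
  note bil = this
  have "dim (form_stabilizer br g f) = dim (form_stabilizer br' g' (f \<circ> \<psi>))"
    by (rule dim_form_stabilizer_image) (fact g' br' add scl inj im hom bil)+
  then show ?thesis unfolding f(2) by (simp only: lie_index_le[OF lin, of br'])
qed

end

section \<open>Incidence algebras of preorders\<close>

interpretation mat: vector_space "matrix_scale :: 'k::field \<Rightarrow> 'k matrix \<Rightarrow> 'k matrix"
  by (rule vector_space_matrix_scale)

text \<open>
  For a preorder \<open>R\<close> on a finite set this is its incidence algebra. An equivalence class of \<open>R\<close>
  contributes a full matrix block.
\<close>
definition incidence :: "nat rel \<Rightarrow> 'k::zero matrix set" where
  "incidence R = {x. \<forall>i j. (i, j) \<notin> R \<longrightarrow> x i j = 0}"

definition unit_matrix :: "nat \<Rightarrow> nat \<Rightarrow> 'k::zero_neq_one matrix" where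
  "unit_matrix a b = (\<lambda>i j. of_bool (i = a \<and> j = b))"

text \<open>
  On \<open>incidence R\<close> the product is the same for every finite \<open>X\<close> that contains the field of \<open>R\<close>
  (\<open>mprod_superset\<close>). Keeping \<open>X\<close> as a parameter allows the algebras of a preorder and of its
  restrictions to be compared inside one product.
\<close>
definition mprod :: "nat set \<Rightarrow> 'k::comm_ring_1 matrix \<Rightarrow> 'k matrix \<Rightarrow> 'k matrix" where
  "mprod X x y = (\<lambda>i j. \<Sum>l\<in>X. x i l * y l j)"

definition bracket :: "nat set \<Rightarrow> 'k::comm_ring_1 matrix \<Rightarrow> 'k matrix \<Rightarrow> 'k matrix" where
  "bracket X x y = mprod X x y - mprod X y x"

definition incidence_index :: "'k::field itself \<Rightarrow> nat rel \<Rightarrow> nat" where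
  "incidence_index _ R = lie_index matrix_scale (bracket (Field R)) (incidence R :: 'k matrix set)"

lemma incidenceD: "x \<in> incidence R \<Longrightarrow> (i, j) \<notin> R \<Longrightarrow> x i j = 0"
  by (simp add: incidence_def)

lemma subspace_incidence: "mat.subspace (incidence R)"
  by (rule mat.subspaceI) (auto simp: incidence_def matrix_scale_def)

lemma unit_matrix_in_incidence: "(a, b) \<in> R \<Longrightarrow> unit_matrix a b \<in> incidence R"
  by (auto simp: unit_matrix_def incidence_def)

lemma sum_matrix_apply: "(\<Sum>a\<in>A. F a) i j = (\<Sum>a\<in>A. (F a :: 'k::comm_monoid_add matrix) i j)"
  by (induction A rule: infinite_finite_induct) auto

lemma incidence_expansion:
  fixes x :: "'k::field matrix"
  assumes "finite R" "x \<in> incidence R"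
  shows "x = (\<Sum>(a, b)\<in>R. matrix_scale (x a b) (unit_matrix a b))"
proof (intro ext)
  fix i j
  have "(\<Sum>(a, b)\<in>R. matrix_scale (x a b) (unit_matrix a b)) i j =
        (\<Sum>p\<in>R. if p = (i, j) then x i j else 0)"
    unfolding sum_matrix_apply
    by (intro sum.cong) (auto simp: matrix_scale_def unit_matrix_def split: prod.splits)
  also have "\<dots> = x i j" using assms incidenceD[of x R i j] by simp
  finally show "x i j = (\<Sum>(a, b)\<in>R. matrix_scale (x a b) (unit_matrix a b)) i j" by simp
qed

lemma incidence_subset_span:
  assumes "finite R"
  shows "incidence R \<subseteq> mat.span ((\<lambda>(a, b). unit_matrix a b) ` R)"
proof
  fix x :: "'a matrix" assume x: "x \<in> incidence R"
  show "x \<in> mat.span ((\<lambda>(a, b). unit_matrix a b) ` R)"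
    by (subst incidence_expansion[OF assms x])
      (rule mat.span_sum, auto intro!: mat.span_scale intro: mat.span_base)
qed

lemma mprod_in_incidence:
  assumes "trans R" "x \<in> incidence R" "y \<in> incidence R"
  shows "mprod X x y \<in> incidence R"
  unfolding incidence_def mprod_def
proof (intro CollectI allI impI sum.neutral ballI)
  fix i j l assume "(i, j) \<notin> R"
  then have "(i, l) \<notin> R \<or> (l, j) \<notin> R" using assms(1) by (meson transE)
  then show "x i l * y l j = 0" using incidenceD[OF assms(2)] incidenceD[OF assms(3)] by auto
qed

lemma bracket_in_incidence:
  fixes x :: "'k::field matrix"
  assumes "trans R" "x \<in> incidence R" "y \<in> incidence R"
  shows "bracket X x y \<in> incidence R"
  unfolding bracket_def using assms
  by (intro mat.subspace_diff[OF subspace_incidence] mprod_in_incidence)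

lemma mprod_superset:
  assumes "x \<in> incidence R" "Field R \<subseteq> X" "finite X"
  shows "mprod X x y = mprod (Field R) x y"
  unfolding mprod_def
proof (intro ext sum.mono_neutral_right)
  fix i j
  show "\<forall>l\<in>X - Field R. x i l * y l j = 0"
    using incidenceD[OF assms(1)] by (metis DiffE FieldI2 mult_zero_left)
qed (use assms in auto)

lemma bracket_superset:
  assumes "x \<in> incidence R" "y \<in> incidence R" "Field R \<subseteq> X" "finite X"
  shows "bracket X x y = bracket (Field R) x y"
  unfolding bracket_def using assms by (simp add: mprod_superset)

lemma incidence_index_superset:
  assumes "Field R \<subseteq> X" "finite X"
  shows "incidence_index TYPE('k::field) R =
    lie_index matrix_scale (bracket X) (incidence R :: 'k matrix set)"
proof -
  have "form_stabilizer (bracket (Field R)) (incidence R) f = form_stabilizer (bracket X) (incidence R) f"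
    for f :: "'k matrix \<Rightarrow> 'k"
    unfolding form_stabilizer_def by (auto simp: bracket_superset[OF _ _ assms])
  then show ?thesis by (simp add: incidence_index_def lie_index_def)
qed

lemma mprod_add_left: "mprod X (x + x') y = mprod X x y + mprod X x' y"
  by (simp add: mprod_def fun_eq_iff algebra_simps sum.distrib)

lemma mprod_add_right: "mprod X x (y + y') = mprod X x y + mprod X x y'"
  by (simp add: mprod_def fun_eq_iff algebra_simps sum.distrib)

lemma mprod_scale_left: "mprod X (matrix_scale c x) y = matrix_scale c (mprod X x y)"
  by (simp add: mprod_def matrix_scale_def fun_eq_iff sum_distrib_left mult.assoc)

lemma mprod_scale_right: "mprod X x (matrix_scale c y) = matrix_scale c (mprod X x y)"
  by (simp add: mprod_def matrix_scale_def fun_eq_iff sum_distrib_left mult.left_commute)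

lemma mprod_assoc: "finite X \<Longrightarrow> mprod X (mprod X x y) z = mprod X x (mprod X y z)"
  by (simp add: mprod_def fun_eq_iff sum_distrib_left sum_distrib_right mult.assoc)
    (intro allI sum.swap)

lemma bracket_add_left: "bracket X (x + x') y = bracket X x y + bracket X x' y"
  by (simp add: bracket_def mprod_add_left mprod_add_right)

lemma bracket_add_right: "bracket X x (y + y') = bracket X x y + bracket X x y'"
  by (simp add: bracket_def mprod_add_left mprod_add_right)

lemma matrix_scale_diff: "matrix_scale c (x - y) = matrix_scale c x - matrix_scale (c::'k::comm_ring_1) y"
  by (simp add: matrix_scale_def fun_eq_iff algebra_simps)

lemma bracket_scale_left: "bracket X (matrix_scale c x) y = matrix_scale c (bracket X x y)"
  by (simp add: bracket_def mprod_scale_left mprod_scale_right matrix_scale_diff)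

lemma bracket_scale_right: "bracket X x (matrix_scale c y) = matrix_scale c (bracket X x y)"
  by (simp add: bracket_def mprod_scale_left mprod_scale_right matrix_scale_diff)

lemma bracket_commute: "bracket X y x = - bracket X x y"
  by (simp add: bracket_def)

lemma bilinear_form_bracket:
  assumes "trans R" "linear_form_on matrix_scale (incidence R) f"
  shows "bilinear_form_on matrix_scale (incidence R) (\<lambda>x y. f (bracket X x y))"
  using assms(2)
  by (auto simp: bilinear_form_on_def linear_form_on_def bracket_add_left bracket_add_right
      bracket_scale_left bracket_scale_right bracket_in_incidence[OF assms(1)])

lemma form_bracket_commute:
  assumes "trans R" "linear_form_on matrix_scale (incidence R) f" "x \<in> incidence R" "y \<in> incidence R"
  shows "f (bracket X x y) = - f (bracket X y x)"
proof -
  have "f (- bracket X y x) = f (matrix_scale (- 1) (bracket X y x))"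
    by (simp add: matrix_scale_def fun_eq_iff fun_Compl_def)
  also have "\<dots> = - f (bracket X y x)"
    using linear_form_on_scale[OF assms(2) bracket_in_incidence[OF assms(1,4,3)], of "- 1"] by simp
  finally show ?thesis using bracket_commute[of X x y] by simp
qed

lemma mprod_unit_right:
  assumes "finite X" "x \<in> incidence R" "Field R \<subseteq> X"
  shows "mprod X x (unit_matrix j i) = (\<Sum>a\<in>{a. (a, j) \<in> R}. matrix_scale (x a j) (unit_matrix a i))"
proof (intro ext)
  fix a b
  have f: "finite {a. (a, j) \<in> R}" using assms by (auto simp: Field_def intro: finite_subset)
  have "mprod X x (unit_matrix j i) a b = (\<Sum>l\<in>X. if l = j then x a l * of_bool (b = i) else 0)"
    unfolding mprod_def by (rule sum.cong) (auto simp: unit_matrix_def)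
  also have "\<dots> = x a j * of_bool (b = i)"
    using assms incidenceD[OF assms(2), of a j] by (auto simp: Field_def)
  also have "\<dots> = (\<Sum>a'\<in>{a. (a, j) \<in> R}. if a' = a then x a' j * of_bool (b = i) else 0)"
    using f incidenceD[OF assms(2), of a j] by auto
  also have "\<dots> = (\<Sum>a\<in>{a. (a, j) \<in> R}. matrix_scale (x a j) (unit_matrix a i)) a b"
    unfolding sum_matrix_apply by (rule sum.cong) (auto simp: matrix_scale_def unit_matrix_def)
  finally show "mprod X x (unit_matrix j i) a b = \<dots>" .
qed

lemma mprod_unit_left:
  assumes "finite X" "x \<in> incidence R" "Field R \<subseteq> X"
  shows "mprod X (unit_matrix j i) x = (\<Sum>b\<in>{b. (i, b) \<in> R}. matrix_scale (x i b) (unit_matrix j b))"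
proof (intro ext)
  fix a b
  have f: "finite {b. (i, b) \<in> R}" using assms by (auto simp: Field_def intro: finite_subset)
  have "mprod X (unit_matrix j i) x a b = (\<Sum>l\<in>X. if l = i then x l b * of_bool (a = j) else 0)"
    unfolding mprod_def by (rule sum.cong) (auto simp: unit_matrix_def)
  also have "\<dots> = x i b * of_bool (a = j)"
    using assms incidenceD[OF assms(2), of i b] by (auto simp: Field_def)
  also have "\<dots> = (\<Sum>b'\<in>{b. (i, b) \<in> R}. if b' = b then x i b' * of_bool (a = j) else 0)"
    using f incidenceD[OF assms(2), of i b] by auto
  also have "\<dots> = (\<Sum>b\<in>{b. (i, b) \<in> R}. matrix_scale (x i b) (unit_matrix j b)) a b"
    unfolding sum_matrix_apply by (rule sum.cong) (auto simp: matrix_scale_def unit_matrix_def)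
  finally show "mprod X (unit_matrix j i) x a b = \<dots>" .
qed

text \<open>
  Multiplication by a matrix unit moves column \<open>j\<close> of \<open>x\<close> to column \<open>i\<close>, or row \<open>i\<close> to row \<open>j\<close>.
\<close>
lemma form_bracket_unit:
  assumes X: "finite X" "Field R \<subseteq> X" and R: "trans R"
    and f: "linear_form_on matrix_scale (incidence R) f"
    and x: "x \<in> incidence R" and ji: "(j, i) \<in> R"
  shows "f (bracket X x (unit_matrix j i)) =
    (\<Sum>a\<in>{a. (a, j) \<in> R}. x a j * f (unit_matrix a i)) -
    (\<Sum>b\<in>{b. (i, b) \<in> R}. x i b * f (unit_matrix j b))"
proof -
  have u: "unit_matrix j i \<in> incidence R" using ji by (rule unit_matrix_in_incidence)
  have "f (mprod X x (unit_matrix j i)) = f (bracket X x (unit_matrix j i) + mprod X (unit_matrix j i) x)"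
    by (simp add: bracket_def)
  also have "\<dots> = f (bracket X x (unit_matrix j i)) + f (mprod X (unit_matrix j i) x)"
    by (rule linear_form_on_add[OF f]) (intro bracket_in_incidence mprod_in_incidence R x u)+
  finally have "f (bracket X x (unit_matrix j i)) =
    f (mprod X x (unit_matrix j i)) - f (mprod X (unit_matrix j i) x)" by simp
  also have "f (mprod X x (unit_matrix j i)) = (\<Sum>a\<in>{a. (a, j) \<in> R}. x a j * f (unit_matrix a i))"
    unfolding mprod_unit_right[OF X(1) x X(2)]
    by (rule mat.linear_form_on_sum_scale[OF f subspace_incidence])
      (use R ji in \<open>auto intro: unit_matrix_in_incidence dest: transD\<close>)
  also have "f (mprod X (unit_matrix j i) x) = (\<Sum>b\<in>{b. (i, b) \<in> R}. x i b * f (unit_matrix j b))"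
    unfolding mprod_unit_left[OF X(1) x X(2)]
    by (rule mat.linear_form_on_sum_scale[OF f subspace_incidence])
      (use R ji in \<open>auto intro: unit_matrix_in_incidence dest: transD\<close>)
  finally show ?thesis .
qed

section \<open>Conjugation by units\<close>

definition identity_on :: "nat set \<Rightarrow> 'k::zero_neq_one matrix" where
  "identity_on X = (\<lambda>i j. of_bool (i = j \<and> i \<in> X))"

lemma mprod_identity_right:
  fixes x :: "'k::field matrix"
  assumes "finite X" "Field R \<subseteq> X" "x \<in> incidence R"
  shows "mprod X x (identity_on X) = x"
proof (intro ext)
  fix i j
  have "mprod X x (identity_on X) i j = (\<Sum>l\<in>X. if l = j then x i l else 0)"
    unfolding mprod_def by (rule sum.cong) (auto simp: identity_on_def)
  also have "\<dots> = x i j" using assms incidenceD[OF assms(3), of i j] by (auto simp: Field_def)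
  finally show "mprod X x (identity_on X) i j = x i j" .
qed

lemma mprod_identity_left:
  fixes x :: "'k::field matrix"
  assumes "finite X" "Field R \<subseteq> X" "x \<in> incidence R"
  shows "mprod X (identity_on X) x = x"
proof (intro ext)
  fix i j
  have "mprod X (identity_on X) x i j = (\<Sum>l\<in>X. if l = i then x l j else 0)"
    unfolding mprod_def by (rule sum.cong) (auto simp: identity_on_def)
  also have "\<dots> = x i j" using assms incidenceD[OF assms(3), of i j] by (auto simp: Field_def)
  finally show "mprod X (identity_on X) x i j = x i j" .
qed

lemma mprod_diff_left:
  "mprod X (x - x') y = mprod X x y - mprod X x' (y :: 'k::field matrix)"
  by (simp add: mprod_def fun_eq_iff algebra_simps sum_subtractf)

lemma mprod_diff_right:
  "mprod X x (y - y') = mprod X x y - mprod X x (y' :: 'k::field matrix)"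
  by (simp add: mprod_def fun_eq_iff algebra_simps sum_subtractf)

text \<open>
  Conjugation by a unit of the incidence algebra is an automorphism, so it carries the
  stabilizer of one form to that of another. The second statement computes the new form; it is
  used to normalise a form on the matrix units of an abelian ideal.
\<close>
lemma
  fixes f :: "'k::field matrix \<Rightarrow> 'k"
  assumes X: "finite X" "Field R \<subseteq> X" and R: "trans R"
    and u: "u \<in> incidence R" "u' \<in> incidence R"
    and f: "linear_form_on matrix_scale (incidence R) f"
  shows linear_form_conjugate:
      "linear_form_on matrix_scale (incidence R) (\<lambda>x. f (mprod X u (mprod X x u')))"
    and conjugate_unit_matrix: "(j, i) \<in> R \<Longrightarrow> f (mprod X u (mprod X (unit_matrix j i) u')) =
      (\<Sum>b\<in>{b. (i, b) \<in> R}. u' i b * (\<Sum>a\<in>{a. (a, j) \<in> R}. u a j * f (unit_matrix a b)))"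
    and dim_stabilizer_conjugate: "mprod X u u' = identity_on X \<Longrightarrow> mprod X u' u = identity_on X \<Longrightarrow>
      mat.dim (form_stabilizer (bracket X) (incidence R) (\<lambda>x. f (mprod X u (mprod X x u')))) =
      mat.dim (form_stabilizer (bracket X) (incidence R) f)"
proof -
  note cl = mprod_in_incidence[OF R]
  define \<psi> :: "'k matrix \<Rightarrow> 'k matrix" where "\<psi> x = mprod X u (mprod X x u')" for x
  have \<psi>in: "\<psi> x \<in> incidence R" if "x \<in> incidence R" for x :: "'k matrix"
    unfolding \<psi>_def using that u by (intro cl)
  have \<psi>add: "\<psi> (x + y) = \<psi> x + \<psi> y" for x y :: "'k matrix"
    by (simp add: \<psi>_def mprod_add_left mprod_add_right)
  have \<psi>diff: "\<psi> (x - y) = \<psi> x - \<psi> y" for x y :: "'k matrix"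
    by (simp add: \<psi>_def mprod_diff_left mprod_diff_right)
  have \<psi>scl: "\<psi> (matrix_scale c x) = matrix_scale c (\<psi> x)" for c and x :: "'k matrix"
    by (simp add: \<psi>_def mprod_scale_left mprod_scale_right)
  show lin: "linear_form_on matrix_scale (incidence R) (\<lambda>x. f (mprod X u (mprod X x u')))"
    using f \<psi>in unfolding \<psi>_def[symmetric] by (auto simp: linear_form_on_def \<psi>add \<psi>scl)
  show "f (mprod X u (mprod X (unit_matrix j i) u')) =
      (\<Sum>b\<in>{b. (i, b) \<in> R}. u' i b * (\<Sum>a\<in>{a. (a, j) \<in> R}. u a j * f (unit_matrix a b)))"
    if ji: "(j, i) \<in> R"
  proof -
    have lf: "linear_form_on matrix_scale (incidence R) (\<lambda>x. f (mprod X u x))"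
      using f cl[OF u(1)] by (auto simp: linear_form_on_def mprod_add_right mprod_scale_right)
    have "f (mprod X u (mprod X (unit_matrix j i) u')) =
        (\<Sum>b\<in>{b. (i, b) \<in> R}. u' i b * f (mprod X u (unit_matrix j b)))"
      unfolding mprod_unit_left[OF X(1) u(2) X(2)]
      by (rule mat.linear_form_on_sum_scale[OF lf subspace_incidence])
        (use ji R in \<open>auto intro: unit_matrix_in_incidence dest: transD\<close>)
    also have "\<dots> = (\<Sum>b\<in>{b. (i, b) \<in> R}. u' i b * (\<Sum>a\<in>{a. (a, j) \<in> R}. u a j * f (unit_matrix a b)))"
    proof (intro sum.cong refl arg_cong2[where f="(*)"])
      fix b assume "b \<in> {b. (i, b) \<in> R}"
      then have jb: "(j, b) \<in> R" using ji R by (auto dest: transD)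
      show "f (mprod X u (unit_matrix j b)) = (\<Sum>a\<in>{a. (a, j) \<in> R}. u a j * f (unit_matrix a b))"
        unfolding mprod_unit_right[OF X(1) u(1) X(2)]
        by (rule mat.linear_form_on_sum_scale[OF f subspace_incidence])
          (use jb R in \<open>auto intro: unit_matrix_in_incidence dest: transD\<close>)
    qed
    finally show ?thesis .
  qed
  show "mat.dim (form_stabilizer (bracket X) (incidence R) (\<lambda>x. f (mprod X u (mprod X x u')))) =
      mat.dim (form_stabilizer (bracket X) (incidence R) f)"
    if uu: "mprod X u u' = identity_on X" "mprod X u' u = identity_on X"
  proof -
    have one: "mprod X (identity_on X) x = x" "mprod X x (identity_on X) = x" 
      if "x \<in> incidence R" for x :: "'k matrix"
      using that X by (simp_all add: mprod_identity_left mprod_identity_right)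
    have cancel: "mprod X u' (mprod X u x) = x" "mprod X u (mprod X u' x) = x" 
      if "x \<in> incidence R" for x :: "'k matrix"
      using that one uu by (simp_all flip: mprod_assoc[OF X(1)])
    have cancel': "mprod X (mprod X x u') u = x" "mprod X (mprod X x u) u' = x" 
      if "x \<in> incidence R" for x :: "'k matrix"
      using that one uu by (simp_all add: mprod_assoc[OF X(1)])
    have inv: "mprod X u' (mprod X (\<psi> x) u) = x" if x: "x \<in> incidence R" for x :: "'k matrix"
    proof -
      have "mprod X u' (mprod X (\<psi> x) u) = mprod X u' (mprod X u (mprod X (mprod X x u') u))"
        by (simp add: \<psi>_def mprod_assoc[OF X(1)])
      also have "\<dots> = x" by (simp add: cancel'[OF x] cancel[OF x])
      finally show ?thesis .
    qed
    have inv': "\<psi> (mprod X u' (mprod X x u)) = x" if x: "x \<in> incidence R" for x :: "'k matrix"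
    proof -
      have "\<psi> (mprod X u' (mprod X x u)) = mprod X u (mprod X u' (mprod X (mprod X x u) u'))"
        by (simp add: \<psi>_def mprod_assoc[OF X(1)])
      also have "\<dots> = x" by (simp add: cancel'[OF x] cancel[OF x])
      finally show ?thesis .
    qed
    have im: "\<psi> ` incidence R = incidence R"
    proof (intro equalityI subsetI)
      fix x :: "'k matrix" assume x: "x \<in> incidence R"
      then have "mprod X u' (mprod X x u) \<in> incidence R" using u by (intro cl)
      then show "x \<in> \<psi> ` incidence R" using inv'[OF x] by (metis imageI)
    qed (use \<psi>in in auto)
    have inj: "x = 0" if "x \<in> incidence R" "\<psi> x = 0" for x
      using inv[OF that(1)] that(2) by (simp add: mprod_def fun_eq_iff)
    have prod: "\<psi> (mprod X x y) = mprod X (\<psi> x) (\<psi> y)" if "x \<in> incidence R" "y \<in> incidence R" for x y :: "'k matrix"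
    proof -
      have "mprod X (\<psi> x) (\<psi> y) = mprod X u (mprod X x (mprod X u' (mprod X u (mprod X y u'))))"
        by (simp add: \<psi>_def mprod_assoc[OF X(1)])
      also have "mprod X u' (mprod X u (mprod X y u')) = mprod X y u'"
        by (rule cancel) (intro cl that u)
      finally show ?thesis by (simp add: \<psi>_def mprod_assoc[OF X(1)])
    qed
    have hom: "\<psi> (bracket X x y) = bracket X (\<psi> x) (\<psi> y)" if "x \<in> incidence R" "y \<in> incidence R" for x y :: "'k matrix"
      using that by (simp add: bracket_def prod \<psi>diff)
    have bil: "bilinear_form_on matrix_scale (incidence R) (\<lambda>x y. f (bracket X (\<psi> x) (\<psi> y)))"
      using bilinear_form_bracket[OF R f, of X] \<psi>in
      by (auto simp: bilinear_form_on_def linear_form_on_def \<psi>add \<psi>scl)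
    have "mat.dim (form_stabilizer (bracket X) (incidence R) f) =
        mat.dim (form_stabilizer (bracket X) (incidence R) (f \<circ> \<psi>))"
      by (rule mat.dim_form_stabilizer_image)
        (fact subspace_incidence im bil | rule \<psi>add \<psi>scl | erule (1) inj bracket_in_incidence[OF R] hom)+
    then show ?thesis by (simp add: \<psi>_def comp_def)
  qed
qed

section \<open>Removing a minimal clique from a preorder\<close>

text \<open>
  Say that \<open>i\<close> lies above \<open>j\<close> if \<open>(i, j) \<in> R\<close>. The set \<open>I\<close> is a clique with nothing else below
  it, and all other points above it belong to \<open>J\<close>. A linear form restricts to the matrices
  supported on \<open>J \<times> I\<close> as an \<open>I \<times> J\<close> matrix \<open>\<xi>\<close>, a linear map from the space with basis
  \<open>J\<close> to the one with basis \<open>I\<close>. The partial matching \<open>\<phi>\<close> of \<open>I1\<close> with \<open>J1\<close> prescribes a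
  normal form for \<open>\<xi>\<close> of full rank: it is surjective if \<open>I1 = I\<close> and injective if \<open>J1 = J\<close>. The
  last assumption provides the column operations that clear the unmatched columns of \<open>\<xi>\<close>.
\<close>
locale clique_reduction =
  fixes X I J I1 J1 :: "nat set" and R :: "nat rel" and \<phi> :: "nat \<Rightarrow> nat"
  assumes finite_X: "finite X" and R_X: "R \<subseteq> X \<times> X"
    and refl_R: "\<And>x. x \<in> X \<Longrightarrow> (x, x) \<in> R" and trans_R: "trans R"
    and I_X: "I \<subseteq> X" and J_X: "J \<subseteq> X" and I_J: "I \<inter> J = {}"
    and I_clique: "I \<times> I \<subseteq> R" and J_I: "J \<times> I \<subseteq> R"
    and I_bottom: "\<And>i x. i \<in> I \<Longrightarrow> (i, x) \<in> R \<Longrightarrow> x \<in> I"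
    and above_I: "\<And>i x. i \<in> I \<Longrightarrow> (x, i) \<in> R \<Longrightarrow> x \<in> I \<union> J"
    and I1_I: "I1 \<subseteq> I" and J1_J: "J1 \<subseteq> J" and bij: "bij_betw \<phi> I1 J1"
    and full: "I1 = I \<or> J1 = J" and J1_J2: "J1 \<times> (J - J1) \<subseteq> R"
begin

text \<open>
  A matrix that commutes with the normal form of \<open>\<xi>\<close> acts on \<open>I1\<close> as it acts on \<open>J1\<close>, so the
  points of \<open>I1\<close> can be dropped; and it preserves the kernel of \<open>\<xi>\<close>, which is spanned by
  \<open>J - J1\<close>, so there are no entries with row in \<open>J1\<close> and column in \<open>J - J1\<close>.
\<close>
definition R' :: "nat rel" where
  "R' = {(a, b) \<in> R. a \<notin> I1 \<and> b \<notin> I1 \<and> \<not> (a \<in> J1 \<and> b \<in> J - J1)}"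

definition \<phi>' :: "nat \<Rightarrow> nat" where "\<phi>' = inv_into I1 \<phi>"

definition \<pi> :: "nat \<Rightarrow> nat" where "\<pi> a = (if a \<in> I1 then \<phi> a else a)"

text \<open>
  The form restricts to the matrices supported on \<open>J \<times> I\<close> as the normal form of \<open>\<xi>\<close>.
\<close>
definition standard :: "('k::zero_neq_one matrix \<Rightarrow> 'k) \<Rightarrow> bool" where
  "standard f \<longleftrightarrow> (\<forall>j\<in>J. \<forall>i\<in>I. f (unit_matrix j i) = of_bool (i \<in> I1 \<and> \<phi> i = j))"

text \<open>
  The embedding of the reduced algebra into the matrices that commute with the normal form of
  \<open>\<xi>\<close>: the entries on \<open>J1\<close> are repeated on \<open>I1\<close>. Entries in the rows \<open>J1\<close> and the columns
  \<open>I - I1\<close> of the reduced algebra appear only in the rows \<open>I1\<close>, because an image of \<open>\<psi>\<close>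
  vanishes on \<open>J \<times> I\<close>.
\<close>
definition \<psi> :: "'k::zero matrix \<Rightarrow> 'k matrix" where
  "\<psi> z = (\<lambda>a b. if a \<in> I \<longleftrightarrow> b \<in> I then z (\<pi> a) (\<pi> b) else 0)"

text \<open>
  The left inverse of \<open>\<psi>\<close>; the entries that \<open>\<psi>\<close> deletes from the rows in \<open>J1\<close> are
  recovered from the matching rows in \<open>I1\<close>.
\<close>
definition \<rho> :: "'k::zero matrix \<Rightarrow> 'k matrix" where
  "\<rho> x = (\<lambda>a b. if (a, b) \<in> R' then x (if a \<in> J1 \<and> b \<in> I then \<phi>' a else a) b else 0)"

lemma phi: "i \<in> I1 \<Longrightarrow> \<phi> i \<in> J1" "i \<in> I1 \<Longrightarrow> \<phi>' (\<phi> i) = i"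
  "j \<in> J1 \<Longrightarrow> \<phi>' j \<in> I1" "j \<in> J1 \<Longrightarrow> \<phi> (\<phi>' j) = j"
  using bij unfolding \<phi>'_def bij_betw_def
  by (auto simp: inv_into_f_f f_inv_into_f intro: inv_into_into)

lemma phi_eq_iff: "i \<in> I1 \<Longrightarrow> i' \<in> I1 \<Longrightarrow> \<phi> i = \<phi> i' \<longleftrightarrow> i = i'"
  using phi(2) by metis

lemma phi_not_I: "i \<in> I1 \<Longrightarrow> \<phi> i \<notin> I" "i \<in> I1 \<Longrightarrow> \<phi> i \<notin> I1" "i \<in> I1 \<Longrightarrow> \<phi> i \<in> J"
  using phi(1) J1_J I1_I I_J by blast+

lemma J_not_I: "j \<in> J \<Longrightarrow> j \<notin> I" and I_not_J: "i \<in> I \<Longrightarrow> i \<notin> J"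
  using I_J by auto

lemma Field_R: "Field R = X" using R_X refl_R by (auto simp: Field_def)

lemma R'_R: "R' \<subseteq> R" by (auto simp: R'_def)

lemma Field_R': "Field R' \<subseteq> X" using R'_R R_X by (auto simp: Field_def)

lemma incidence_index_X:
  "incidence_index TYPE('k::field) R =
    lie_index matrix_scale (bracket X) (incidence R :: 'k matrix set)"
  "incidence_index TYPE('k::field) R' =
    lie_index matrix_scale (bracket X) (incidence R' :: 'k matrix set)"
  by (rule incidence_index_superset; simp add: Field_R Field_R' finite_X)+

lemma finite_R: "finite R" using R_X finite_X by (meson finite_SigmaI finite_subset)

lemma trans_R': "trans R'"
proof (rule transI)
  fix a b c assume ab: "(a, b) \<in> R'" and bc: "(b, c) \<in> R'"
  then have ac: "(a, c) \<in> R" using trans_R by (auto simp: R'_def dest: transD)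
  have False if "a \<in> J1" "c \<in> J - J1"
  proof -
    \<comment> \<open>a point between two points of \<open>J\<close> lies in \<open>J\<close>\<close>
    have "I \<noteq> {}" using that(1) phi(3) I1_I by auto
    then obtain i where i: "i \<in> I" by auto
    have "(b, i) \<in> R" using bc that i J_I trans_R by (auto simp: R'_def dest: transD)
    then have "b \<in> I \<union> J" using above_I[OF i] by auto
    moreover have "b \<notin> I" using I_bottom[of b c] bc that J_not_I by (auto simp: R'_def)
    ultimately show False using ab bc that by (auto simp: R'_def)
  qed
  then show "(a, c) \<in> R'" using ab bc ac by (auto simp: R'_def)
qed

lemma pairing:
  fixes f :: "'k::field matrix \<Rightarrow> 'k"
  assumes f: "linear_form_on matrix_scale (incidence R) f" and x: "x \<in> incidence R"
    and j: "j \<in> J" and i: "i \<in> I"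
  shows "f (bracket X x (unit_matrix j i)) =
    (\<Sum>a\<in>J. x a j * f (unit_matrix a i)) - (\<Sum>b\<in>I. x i b * f (unit_matrix j b))"
proof -
  have ji: "(j, i) \<in> R" using J_I i j by auto
  have sub: "{a. (a, j) \<in> R} \<subseteq> J"
    using above_I[OF i] I_bottom ji J_not_I[OF j] trans_R by (blast dest: transD)
  have "(\<Sum>a\<in>{a. (a, j) \<in> R}. x a j * f (unit_matrix a i)) = (\<Sum>a\<in>J. x a j * f (unit_matrix a i))"
    using sub J_X finite_X incidenceD[OF x] by (intro sum.mono_neutral_left) (auto intro: finite_subset)
  moreover have "{b. (i, b) \<in> R} = I" using I_bottom[OF i] I_clique i by auto
  ultimately show ?thesis
    using form_bracket_unit[OF finite_X _ trans_R f x ji] Field_R by simp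
qed

lemma finite_I: "finite I" and finite_J: "finite J"
  using I_X J_X finite_X finite_subset by blast+

lemma pairing_standard:
  fixes f :: "'k::field matrix \<Rightarrow> 'k"
  assumes f: "linear_form_on matrix_scale (incidence R) f" and st: "standard f" and x: "x \<in> incidence R"
    and j: "j \<in> J" and i: "i \<in> I"
  shows "f (bracket X x (unit_matrix j i)) =
    (if i \<in> I1 then x (\<phi> i) j else 0) - (if j \<in> J1 then x i (\<phi>' j) else 0)"
proof -
  have "(\<Sum>a\<in>J. x a j * f (unit_matrix a i)) = (\<Sum>a\<in>J. if a = \<phi> i then (if i \<in> I1 then x a j else 0) else 0)"
    using st i by (intro sum.cong) (auto simp: standard_def)
  also have "\<dots> = (if i \<in> I1 then x (\<phi> i) j else 0)"
    using finite_J phi(1) J1_J by auto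
  finally have 1: "(\<Sum>a\<in>J. x a j * f (unit_matrix a i)) = (if i \<in> I1 then x (\<phi> i) j else 0)" .
  have "(\<Sum>b\<in>I. x i b * f (unit_matrix j b)) = (\<Sum>b\<in>I. if b = \<phi>' j then (if j \<in> J1 then x i b else 0) else 0)"
  proof (intro sum.cong refl)
    fix b assume b: "b \<in> I"
    have "b \<in> I1 \<and> \<phi> b = j \<longleftrightarrow> j \<in> J1 \<and> b = \<phi>' j" using phi by metis
    then show "x i b * f (unit_matrix j b) = (if b = \<phi>' j then (if j \<in> J1 then x i b else 0) else 0)"
      using st j b by (simp add: standard_def)
  qed
  also have "\<dots> = (if j \<in> J1 then x i (\<phi>' j) else 0)"
    using finite_I phi(3) I1_I by auto
  finally show ?thesis using pairing[OF f x j i] 1 by simp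
qed

lemma psi_add: "\<psi> (x + y) = \<psi> x + \<psi> (y :: 'k::field matrix)"
  and psi_diff: "\<psi> (x - y) = \<psi> x - \<psi> (y :: 'k::field matrix)"
  and psi_scale: "\<psi> (matrix_scale c x) = matrix_scale c (\<psi> (x :: 'k::field matrix))"
  by (auto simp: \<psi>_def fun_eq_iff matrix_scale_def)

lemma psi_in:
  assumes "z \<in> incidence R'"
  shows "\<psi> z \<in> incidence (R - J \<times> I)"
  unfolding incidence_def
proof (intro CollectI allI impI, rule ccontr)
  fix a b assume ab: "(a, b) \<notin> R - J \<times> I" and nz: "\<psi> z a b \<noteq> 0"
  then have same: "a \<in> I \<longleftrightarrow> b \<in> I" and r: "(\<pi> a, \<pi> b) \<in> R'"
    using incidenceD[OF assms] by (auto simp: \<psi>_def split: if_splits)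
  show False
  proof (cases "a \<in> I")
    case True
    then show ?thesis using same ab I_clique I_not_J by auto
  next
    case False
    then have "\<pi> a = a" "\<pi> b = b" using same I1_I by (auto simp: \<pi>_def)
    then show ?thesis using r ab False same R'_R by auto
  qed
qed

lemma rho_psi:
  assumes z: "z \<in> incidence R'"
  shows "\<rho> (\<psi> z) = z"
proof (intro ext)
  fix a b
  show "\<rho> (\<psi> z) a b = z a b"
  proof (cases "(a, b) \<in> R'")
    case False
    then show ?thesis using incidenceD[OF z] by (simp add: \<rho>_def)
  next
    case True
    then have ab: "(a, b) \<in> R" "a \<notin> I1" "b \<notin> I1" "\<not> (a \<in> J1 \<and> b \<in> J - J1)" by (auto simp: R'_def)
    show ?thesis
    proof (cases "b \<in> I")
      case bI: True
      then have "J1 = J" using ab full by auto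
      show ?thesis
      proof (cases "a \<in> I")
        case True
        then show ?thesis using \<open>(a, b) \<in> R'\<close> bI ab J1_J I_not_J by (auto simp: \<rho>_def \<psi>_def \<pi>_def)
      next
        case False
        then have "a \<in> J1" using above_I[OF bI ab(1)] \<open>J1 = J\<close> by auto
        then have "\<phi>' a \<in> I" "\<phi>' a \<in> I1" "\<phi> (\<phi>' a) = a" using phi I1_I by auto
        then show ?thesis using \<open>(a, b) \<in> R'\<close> bI ab \<open>a \<in> J1\<close> by (auto simp: \<rho>_def \<psi>_def \<pi>_def)
      qed
    next
      case False
      then have "a \<notin> I" using I_bottom ab by blast
      then show ?thesis using True False ab by (auto simp: \<rho>_def \<psi>_def \<pi>_def)
    qed
  qed
qed

text \<open>
  For \<open>a\<close> and \<open>b\<close> in \<open>I\<close> the product of the images sums over \<open>I\<close>, that is, over the points of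
  \<open>J1\<close> and of \<open>I - I1\<close>. The only other points that could contribute to the product in the reduced
  algebra are those of \<open>J - J1\<close>. They exist only if \<open>I1 = I\<close>, and then the row of the first factor
  is in \<open>J1\<close>, so its entry is excluded by \<open>R'\<close>.
\<close>
lemma psi_mprod:
  fixes z w :: "'k::field matrix"
  assumes z: "z \<in> incidence R'" and w: "w \<in> incidence R'"
  shows "\<psi> (mprod X z w) = mprod X (\<psi> z) (\<psi> w)"
proof (intro ext)
  fix a b
  note zD = incidenceD[OF z] and wD = incidenceD[OF w]
  consider "a \<in> I" "b \<in> I" | "a \<notin> I" "b \<notin> I" | "(a \<in> I) \<noteq> (b \<in> I)" by blast
  then show "\<psi> (mprod X z w) a b = mprod X (\<psi> z) (\<psi> w) a b"
  proof cases
    case 1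
    have inj: "inj_on \<pi> I"
      using phi_eq_iff phi_not_I(1) unfolding inj_on_def \<pi>_def by metis
    have sub: "\<pi> ` I \<subseteq> X"
      using phi(1) J1_J J_X I_X by (auto simp: \<pi>_def)
    have out: "z (\<pi> a) m * w m (\<pi> b) = 0" if m: "m \<in> X - \<pi> ` I" for m
    proof (rule ccontr)
      assume "\<not> ?thesis"
      then have r: "(\<pi> a, m) \<in> R'" "(m, \<pi> b) \<in> R'" using zD wD by auto
      then have m1: "m \<notin> I1" "(m, \<pi> b) \<in> R" by (auto simp: R'_def)
      have "(\<pi> b, b) \<in> R" using 1 phi(1) J1_J J_I I_clique by (auto simp: \<pi>_def)
      then have "m \<in> I \<union> J" using above_I[OF 1(2)] m1 trans_R by (blast dest: transD)
      moreover have "m \<notin> I" using m m1 by (auto simp: \<pi>_def image_iff)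
      moreover have "m \<notin> J1" 
        using m phi(3)[of m] phi(4)[of m] I1_I by (metis DiffD2 \<pi>_def image_eqI subsetD)
      ultimately have mJ: "m \<in> J - J1" by auto
      then have "I1 = I" using full by auto
      then have "a \<in> I1" using 1 by simp
      then have "\<pi> a \<in> J1" using phi(1) by (simp add: \<pi>_def)
      then show False using r mJ by (auto simp: R'_def)
    qed
    have "mprod X (\<psi> z) (\<psi> w) a b = (\<Sum>l\<in>I. z (\<pi> a) (\<pi> l) * w (\<pi> l) (\<pi> b))"
      unfolding mprod_def using 1 I_X finite_X
      by (intro sum.mono_neutral_cong_right) (auto simp: \<psi>_def)
    also have "\<dots> = (\<Sum>m\<in>\<pi> ` I. z (\<pi> a) m * w m (\<pi> b))"
      by (simp add: sum.reindex[OF inj])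
    also have "\<dots> = (\<Sum>m\<in>X. z (\<pi> a) m * w m (\<pi> b))"
      using sub finite_X out by (intro sum.mono_neutral_left) auto
    also have "\<dots> = \<psi> (mprod X z w) a b"
      using 1 by (simp add: \<psi>_def mprod_def)
    finally show ?thesis by simp
  next
    case 2
    have pi: "\<pi> l = l" if "l \<notin> I" for l using that I1_I by (auto simp: \<pi>_def)
    have "z a l * w l b = \<psi> z a l * \<psi> w l b" for l
    proof (cases "l \<in> I")
      case True
      then have "(l, b) \<notin> R'" using I_bottom[OF True] 2 R'_R by auto
      then show ?thesis using 2 True wD by (simp add: \<psi>_def)
    qed (use 2 pi in \<open>simp add: \<psi>_def\<close>)
    moreover have "\<psi> (mprod X z w) a b = mprod X z w a b"
      using 2 by (simp add: \<psi>_def pi)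
    ultimately show ?thesis by (simp add: mprod_def)
  next
    case 3
    then have "mprod X (\<psi> z) (\<psi> w) a b = 0"
      unfolding mprod_def by (intro sum.neutral) (auto simp: \<psi>_def)
    moreover have "\<psi> (mprod X z w) a b = 0" using 3 by (auto simp: \<psi>_def)
    ultimately show ?thesis by simp
  qed
qed

lemma psi_bracket:
  fixes z w :: "'k::field matrix"
  assumes "z \<in> incidence R'" "w \<in> incidence R'"
  shows "\<psi> (bracket X z w) = bracket X (\<psi> z) (\<psi> w)"
  using assms by (simp add: bracket_def psi_diff psi_mprod)

text \<open>
  By \<open>pairing_standard\<close>, the right-hand side consists of the matrices vanishing on \<open>J \<times> I\<close>
  whose bracket with every matrix unit from \<open>J \<times> I\<close> is killed by a standard form.
\<close>
lemma psi_image: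
  "\<psi> ` incidence R' = {x \<in> incidence (R - J \<times> I). \<forall>j\<in>J. \<forall>i\<in>I.
     (if i \<in> I1 then x (\<phi> i) j else 0) = (if j \<in> J1 then x i (\<phi>' j) else (0 :: 'k::field))}"
    (is "_ = ?Q")
proof (intro equalityI subsetI)
  fix x :: "'k matrix" assume "x \<in> \<psi> ` incidence R'"
  then obtain z where z: "z \<in> incidence R'" and x: "x = \<psi> z" by auto
  note zD = incidenceD[OF z]
  have "(if i \<in> I1 then x (\<phi> i) j else 0) = (if j \<in> J1 then x i (\<phi>' j) else 0)"
    if j: "j \<in> J" and i: "i \<in> I" for i j
  proof -
    have jI: "j \<notin> I" "j \<notin> I1" using j J_not_I I1_I by auto
    have l: "x (\<phi> i) j = z (\<phi> i) j" if "i \<in> I1"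
    proof -
      have "\<phi> i \<notin> I" using phi(1)[OF that] J1_J J_not_I by auto
      then show ?thesis using jI I1_I by (auto simp: x \<psi>_def \<pi>_def)
    qed
    have r: "x i (\<phi>' j) = z (\<pi> i) j" if "j \<in> J1"
      using phi(3,4)[OF that] I1_I i by (auto simp: x \<psi>_def \<pi>_def)
    show ?thesis
    proof (cases "i \<in> I1")
      case True
      have "z (\<phi> i) j = 0" if "j \<notin> J1"
        using that j phi(1)[OF True] by (intro zD) (auto simp: R'_def)
      then show ?thesis using True l r by (auto simp: \<pi>_def)
    next
      case False
      have "(i, j) \<notin> R'" using I_bottom[OF i] jI R'_R by auto
      then show ?thesis using False l r zD by (auto simp: \<pi>_def)
    qed
  qed
  moreover have "x \<in> incidence (R - J \<times> I)" using psi_in[OF z] x by simp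
  ultimately show "x \<in> ?Q" by blast
next
  fix x :: "'k matrix" assume "x \<in> ?Q"
  then have xq: "x \<in> incidence (R - J \<times> I)"
    and cond: "\<And>i j. j \<in> J \<Longrightarrow> i \<in> I \<Longrightarrow>
      (if i \<in> I1 then x (\<phi> i) j else 0) = (if j \<in> J1 then x i (\<phi>' j) else 0)" by auto
  have xD: "x a b = 0" if "(a, b) \<notin> R" for a b using that incidenceD[OF xq] by auto
  have "\<rho> x \<in> incidence R'" by (auto simp: incidence_def \<rho>_def)
  moreover have "\<psi> (\<rho> x) = x"
  proof (intro ext)
    fix a b
    consider "a \<in> I" "b \<in> I" | "a \<notin> I" "b \<notin> I" | "a \<in> I" "b \<notin> I" | "a \<notin> I" "b \<in> I" by blast
    then show "\<psi> (\<rho> x) a b = x a b"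
    proof cases
      case 1
      have psi: "\<psi> (\<rho> x) a b = \<rho> x (\<pi> a) (\<pi> b)" using 1 by (simp add: \<psi>_def)
      show ?thesis
      proof (cases "b \<in> I1")
        case b: True
        have pb: "\<phi> b \<in> J1" "\<phi> b \<in> J" "\<phi>' (\<phi> b) = b" "\<pi> b = \<phi> b" "\<phi> b \<notin> I" "\<phi> b \<notin> I1"
          using phi phi_not_I b by (simp_all add: \<pi>_def)
        have c: "(if a \<in> I1 then x (\<phi> a) (\<phi> b) else 0) = x a b"
          using cond[of "\<phi> b" a] 1 pb by auto
        show ?thesis
        proof (cases "a \<in> I1")
          case True
          have pa: "\<phi> a \<in> J1" "\<pi> a = \<phi> a" "\<phi> a \<notin> I1"
            using phi phi_not_I True by (simp_all add: \<pi>_def)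
          have "\<rho> x (\<phi> a) (\<phi> b) = x (\<phi> a) (\<phi> b)"
            using pa pb xD[of "\<phi> a" "\<phi> b"] by (auto simp: \<rho>_def R'_def)
          then show ?thesis using psi pa pb c True by simp
        next
          case False
          have "(a, \<phi> b) \<notin> R" using I_bottom[OF 1(1)] pb by auto
          then have "\<rho> x a (\<phi> b) = 0" by (simp add: \<rho>_def R'_def)
          then show ?thesis using psi pb c False by (simp add: \<pi>_def)
        qed
      next
        case b: False
        have pb: "\<pi> b = b" "b \<notin> J" using b 1 I_not_J by (auto simp: \<pi>_def)
        show ?thesis
        proof (cases "a \<in> I1")
          case True
          have pa: "\<phi> a \<in> J1" "\<pi> a = \<phi> a" "\<phi> a \<notin> I1" "\<phi>' (\<phi> a) = a"
            using phi phi_not_I True by (simp_all add: \<pi>_def)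
          have "(\<phi> a, b) \<in> R'" using pa pb b 1 J_I J1_J by (auto simp: R'_def)
          then show ?thesis using psi pa pb 1 by (simp add: \<rho>_def)
        next
          case False
          have "(a, b) \<in> R'" "a \<notin> J1" using False b pb 1 I_clique I_not_J J1_J by (auto simp: R'_def)
          then show ?thesis using psi pb False by (simp add: \<rho>_def \<pi>_def)
        qed
      qed
    next
      case 2
      then have "a \<notin> I1" "b \<notin> I1" using I1_I by auto
      then have "\<psi> (\<rho> x) a b = (if (a, b) \<in> R' then x a b else 0)"
        using 2 by (simp add: \<psi>_def \<pi>_def \<rho>_def)
      moreover have "x a b = 0" if no: "(a, b) \<notin> R'"
      proof (cases "(a, b) \<in> R")
        case True
        then have ab: "a \<in> J1" "b \<in> J - J1" using no \<open>a \<notin> I1\<close> \<open>b \<notin> I1\<close> by (auto simp: R'_def)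
        then have "\<phi>' a \<in> I1" "\<phi>' a \<in> I" "\<phi> (\<phi>' a) = a" using phi I1_I by auto
        then show ?thesis using cond[of b "\<phi>' a"] ab by simp
      qed (simp add: xD)
      ultimately show ?thesis by simp
    next
      case 3
      then show ?thesis using I_bottom[of a b] xD[of a b] by (auto simp: \<psi>_def)
    next
      case 4
      then have "(a, b) \<notin> R - J \<times> I" using above_I[of b a] by auto
      then show ?thesis using 4 incidenceD[OF xq] by (simp add: \<psi>_def)
    qed
  qed
  ultimately show "x \<in> \<psi> ` incidence R'" by (metis imageI)
qed

text \<open>
  Symplectic reduction for the ideal of matrices supported on \<open>J \<times> I\<close>.
\<close>
lemma dim_stabilizer_standard:
  fixes f :: "'k::field matrix \<Rightarrow> 'k"
  assumes f: "linear_form_on matrix_scale (incidence R) f" and st: "standard f"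
  shows "mat.dim (form_stabilizer (bracket X) (incidence R) f) =
    mat.dim (form_stabilizer (bracket X) (incidence R') (f \<circ> \<psi>))"
proof -
  let ?B = "\<lambda>x y. f (bracket X x y)"
  let ?q = "incidence (R - J \<times> I) :: 'k matrix set"
  define E :: "nat \<times> nat \<Rightarrow> 'k matrix" where "E = (\<lambda>(j, i). unit_matrix j i)"
  \<comment> \<open>The dual elements: left multiplication by a unit matrix with row in \<open>J1\<close>, or right multiplication by one within \<open>I\<close>, moves a given entry to a matched position.\<close>
  define e :: "nat \<times> nat \<Rightarrow> 'k matrix"
    where "e = (\<lambda>(j, i). if j \<in> J1 then - unit_matrix i (\<phi>' j) else unit_matrix (\<phi> i) j)"
  have qR: "?q \<subseteq> incidence R" by (auto simp: incidence_def)
  have bil: "bilinear_form_on matrix_scale (incidence R) ?B"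
    by (rule bilinear_form_bracket[OF trans_R f])
  have BE: "?B x (E p) = (if snd p \<in> I1 then x (\<phi> (snd p)) (fst p) else 0) -
      (if fst p \<in> J1 then x (snd p) (\<phi>' (fst p)) else 0)"
    if "x \<in> incidence R" "p \<in> J \<times> I" for x p
    using that pairing_standard[OF f st, of x "fst p" "snd p"] by (auto simp: E_def case_prod_beta)
  have Ein: "E p \<in> incidence R" if "p \<in> J \<times> I" for p
    using that J_I by (auto simp: E_def intro!: unit_matrix_in_incidence)
  have ein: "e p \<in> ?q" if p: "p \<in> J \<times> I" for p
  proof (cases "fst p \<in> J1")
    case True
    then have "\<phi>' (fst p) \<in> I" using phi(3) I1_I by auto
    then have "unit_matrix (snd p) (\<phi>' (fst p)) \<in> ?q"
      using p I_clique I_not_J by (intro unit_matrix_in_incidence) auto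
    then show ?thesis
      using True mat.subspace_neg[OF subspace_incidence] by (simp add: e_def case_prod_beta)
  next
    case False
    then have "snd p \<in> I1" using p full by auto
    then have "(\<phi> (snd p), fst p) \<in> R - J \<times> I"
      using p False J1_J2 phi(1) J_not_I by auto
    then show ?thesis using False by (simp add: e_def case_prod_beta unit_matrix_in_incidence)
  qed
  have eE: "?B (e p) (E p') = of_bool (p = p')" if p: "p \<in> J \<times> I" and p': "p' \<in> J \<times> I" for p p'
  proof -
    obtain j i where ji: "p = (j, i)" "j \<in> J" "i \<in> I" using p by auto
    obtain j' i' where ji': "p' = (j', i')" "j' \<in> J" "i' \<in> I" using p' by auto
    have B: "?B (e p) (E p') = (if i' \<in> I1 then e p (\<phi> i') j' else 0) - (if j' \<in> J1 then e p i' (\<phi>' j') else 0)"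
      using BE[of "e p" p'] ein[OF p] qR p' ji' by auto
    show ?thesis
    proof (cases "j \<in> J1")
      case True
      have "e p (\<phi> i') j' = 0" if "i' \<in> I1"
        using True phi_not_I(1)[OF that] ji by (auto simp: e_def unit_matrix_def)
      moreover have "e p i' (\<phi>' j') = - of_bool (i' = i \<and> j' = j)" if "j' \<in> J1"
        using True phi(4)[OF True] phi(4)[OF that] ji by (auto simp: e_def unit_matrix_def)
      ultimately show ?thesis using B True ji ji' by auto
    next
      case False
      then have "I1 = I" using full ji by auto
      have "e p i' (\<phi>' j') = 0"
        using False phi_not_I(1)[of i] ji ji' \<open>I1 = I\<close> by (auto simp: e_def unit_matrix_def)
      moreover have "e p (\<phi> i') j' = of_bool (i' = i \<and> j' = j)"
        using False phi_eq_iff[of i' i] ji ji' \<open>I1 = I\<close> by (auto simp: e_def unit_matrix_def)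
      ultimately show ?thesis using B ji ji' \<open>I1 = I\<close> by auto
    qed
  qed
  have sumE: "(\<Sum>p\<in>J \<times> I. matrix_scale (c p) (E p)) = (\<lambda>a b. if (a, b) \<in> J \<times> I then c (a, b) else 0)" for c
  proof (intro ext)
    fix a b
    have "(\<Sum>p\<in>J \<times> I. matrix_scale (c p) (E p)) a b = (\<Sum>p\<in>J \<times> I. if p = (a, b) then c p else 0)"
      unfolding sum_matrix_apply
      by (intro sum.cong) (auto simp: matrix_scale_def E_def unit_matrix_def)
    also have "\<dots> = (if (a, b) \<in> J \<times> I then c (a, b) else 0)"
      using finite_I finite_J by (simp add: sum.delta)
    finally show "(\<Sum>p\<in>J \<times> I. matrix_scale (c p) (E p)) a b = \<dots>" .
  qed
  have alt: "?B x y = - ?B y x" if "x \<in> incidence R" "y \<in> incidence R" for x y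
    using form_bracket_commute[OF trans_R f that] .
  have EE: "?B (E p) (E p') = 0" if p: "p \<in> J \<times> I" and p': "p' \<in> J \<times> I" for p p'
    using BE[OF Ein[OF p] p'] p p' phi(3) I1_I I_not_J J_not_I phi_not_I(1)
    by (auto simp: E_def unit_matrix_def)
  have dec: "\<exists>u\<in>?q. \<exists>c. x = u + (\<Sum>p\<in>J \<times> I. matrix_scale (c p) (E p))" if "x \<in> incidence R" for x
  proof (intro bexI exI)
    let ?u = "\<lambda>a b. if (a, b) \<in> J \<times> I then 0 else x a b"
    show "x = ?u + (\<Sum>p\<in>J \<times> I. matrix_scale (x (fst p) (snd p)) (E p))"
      unfolding sumE by (auto simp: fun_eq_iff)
    show "?u \<in> ?q" using incidenceD[OF that] by (auto simp: incidence_def)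
  qed
  have direct: "(\<Sum>p\<in>J \<times> I. matrix_scale (c p) (E p)) = 0"
    if "(\<Sum>p\<in>J \<times> I. matrix_scale (c p) (E p)) \<in> ?q" for c
  proof (intro ext)
    fix a b
    show "(\<Sum>p\<in>J \<times> I. matrix_scale (c p) (E p)) a b = 0 a b"
    proof (cases "(a, b) \<in> J \<times> I")
      case True
      then show ?thesis using incidenceD[OF that, of a b] by simp
    next
      case False
      then show ?thesis unfolding sumE by auto
    qed
  qed
  have "mat.dim (radical (incidence R) ?B) = mat.dim (radical {x \<in> ?q. \<forall>p\<in>J \<times> I. ?B x (E p) = 0} ?B)"
    by (rule mat.dim_radical_reduction[where e = e])
      (rule subspace_incidence qR finite_cartesian_product finite_I finite_J bil
        | erule (1) alt EE eE | erule Ein ein dec direct)+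
  also have "{x \<in> ?q. \<forall>p\<in>J \<times> I. ?B x (E p) = 0} = \<psi> ` incidence R'"
    unfolding psi_image using BE qR by fastforce
  also have "mat.dim (radical (\<psi> ` incidence R') ?B) =
      mat.dim (radical (incidence R') (\<lambda>x y. ?B (\<psi> x) (\<psi> y)))"
  proof (rule mat.dim_radical_image[OF subspace_incidence])
    show "bilinear_form_on matrix_scale (incidence R') (\<lambda>x y. f (bracket X (\<psi> x) (\<psi> y)))"
    proof -
      have "\<psi> z \<in> incidence R" if "z \<in> incidence R'" for z :: "'k matrix"
        using psi_in[OF that] qR by blast
      then show ?thesis
        using bil unfolding bilinear_form_on_def linear_form_on_def by (auto simp: psi_add psi_scale)
    qed
    show "z = 0" if "z \<in> incidence R'" "\<psi> z = 0" for z :: "'k matrix"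
    proof -
      have "\<rho> 0 = (0 :: 'k matrix)" by (simp add: \<rho>_def fun_eq_iff)
      then show ?thesis using rho_psi[OF that(1)] that(2) by simp
    qed
  qed (auto simp: psi_add psi_scale)
  also have "radical (incidence R') (\<lambda>x y. ?B (\<psi> x) (\<psi> y)) = form_stabilizer (bracket X) (incidence R') (f \<circ> \<psi>)"
    by (auto simp: form_stabilizer_def radical_def psi_bracket)
  finally show ?thesis by (simp add: form_stabilizer_eq_radical)
qed

lemma linear_form_comp_psi:
  fixes f :: "'k::field matrix \<Rightarrow> 'k"
  assumes f: "linear_form_on matrix_scale (incidence R) f"
  shows "linear_form_on matrix_scale (incidence R') (f \<circ> \<psi>)"
proof -
  have "\<psi> z \<in> incidence R" if "z \<in> incidence R'" for z :: "'k matrix"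
    using psi_in[OF that] by (auto simp: incidence_def)
  then show ?thesis using f by (auto simp: linear_form_on_def psi_add psi_scale)
qed

text \<open>
  This form is standard, and it vanishes on the image of \<open>\<psi>\<close>.
\<close>
definition diagonal :: "'k::comm_monoid_add matrix \<Rightarrow> 'k" where
  "diagonal x = (\<Sum>i\<in>I1. x (\<phi> i) i)"

lemma diagonal_add: "diagonal (x + y) = diagonal x + diagonal (y :: 'k::field matrix)"
  and diagonal_scale: "diagonal (matrix_scale c x) = c * diagonal (x :: 'k::field matrix)"
  by (simp_all add: diagonal_def sum.distrib matrix_scale_def sum_distrib_left)

lemma diagonal_unit:
  "diagonal (unit_matrix j i :: 'k::field matrix) = of_bool (i \<in> I1 \<and> \<phi> i = j)"
proof -
  have "diagonal (unit_matrix j i :: 'k matrix) = (\<Sum>b\<in>I1. if b = i then of_bool (\<phi> i = j) else 0)"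
    unfolding diagonal_def by (rule sum.cong) (auto simp: unit_matrix_def)
  also have "\<dots> = of_bool (i \<in> I1 \<and> \<phi> i = j)"
    using finite_subset[OF I1_I finite_I] by (auto simp: of_bool_def)
  finally show ?thesis .
qed

text \<open>
  A form on the reduced algebra extends to a standard form on the full one.
\<close>
lemma incidence_index_le_reduced:
  "incidence_index TYPE('k::field) R \<le> incidence_index TYPE('k) R'"
proof -
  obtain f' :: "'k matrix \<Rightarrow> 'k" where f': "linear_form_on matrix_scale (incidence R') f'"
    and min: "lie_index matrix_scale (bracket X) (incidence R' :: 'k matrix set) =
      mat.dim (form_stabilizer (bracket X) (incidence R') f')"
    by (rule mat.lie_index_attained)
  define f where "f x = f' (\<rho> x) + diagonal x" for x :: "'k matrix"
  have rho_in: "\<rho> x \<in> incidence R'" for x :: "'k matrix" by (auto simp: incidence_def \<rho>_def)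
  have rho_add: "\<rho> (x + y) = \<rho> x + \<rho> y" for x y :: "'k matrix"
    by (auto simp: \<rho>_def fun_eq_iff)
  have rho_scale: "\<rho> (matrix_scale c x) = matrix_scale c (\<rho> x)" for c and x :: "'k matrix"
    by (auto simp: \<rho>_def fun_eq_iff matrix_scale_def)
  have f: "linear_form_on matrix_scale (incidence R) f"
    using f' rho_in unfolding linear_form_on_def f_def
    by (auto simp: rho_add rho_scale diagonal_add diagonal_scale algebra_simps)
  have rho_unit: "\<rho> (unit_matrix j i :: 'k matrix) = 0" if "j \<in> J" "i \<in> I" for j i
  proof (intro ext)
    fix a b
    have "\<phi>' a \<noteq> j" if "a \<in> J1" using phi(3)[OF that] I1_I \<open>j \<in> J\<close> J_not_I by blast
    moreover have "a \<in> J1" if "(a, b) \<in> R'" "a = j" "b = i"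
      using that \<open>j \<in> J\<close> \<open>i \<in> I\<close> full by (auto simp: R'_def)
    ultimately show "\<rho> (unit_matrix j i) a b = (0 :: 'k matrix) a b"
      using \<open>i \<in> I\<close> by (auto simp: \<rho>_def unit_matrix_def)
  qed
  have "f' 0 = 0" by (rule mat.linear_form_on_0[OF f' subspace_incidence])
  then have st: "standard f"
    unfolding standard_def f_def by (simp add: rho_unit diagonal_unit)
  have "diagonal (\<psi> z) = 0" for z :: "'k matrix"
    unfolding diagonal_def using I1_I phi_not_I(1) by (intro sum.neutral) (auto simp: \<psi>_def)
  then have "(f \<circ> \<psi>) z = f' z" if "z \<in> incidence R'" for z
    using rho_psi[OF that] by (simp add: f_def)
  then have "form_stabilizer (bracket X) (incidence R') (f \<circ> \<psi>) = form_stabilizer (bracket X) (incidence R') f'"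
    unfolding form_stabilizer_def by (auto simp: bracket_in_incidence[OF trans_R'])
  then have "lie_index matrix_scale (bracket X) (incidence R :: 'k matrix set) \<le>
      lie_index matrix_scale (bracket X) (incidence R' :: 'k matrix set)"
    using mat.lie_index_le[OF f, of "bracket X"] dim_stabilizer_standard[OF f st] min by simp
  then show ?thesis by (simp add: incidence_index_X)
qed

text \<open>
  A form with the smallest stabilizer is moved by a suitable multiple of \<open>diagonal\<close>, so that the
  block of \<open>\<xi>\<close> on \<open>I1 \<times> J1\<close> becomes invertible while the stabilizer does not grow. Two
  conjugations then make the form standard.
\<close>
lemma reduced_index_le_incidence_index:
  "incidence_index TYPE('k::field_char_0) R' \<le> incidence_index TYPE('k) R"
proof -
  obtain f :: "'k matrix \<Rightarrow> 'k" where f: "linear_form_on matrix_scale (incidence R) f"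
    and min: "lie_index matrix_scale (bracket X) (incidence R :: 'k matrix set) =
      mat.dim (form_stabilizer (bracket X) (incidence R) f)"
    by (rule mat.lie_index_attained)
  \<comment> \<open>The columns of \<open>\<xi>\<close> that belong to \<open>J1\<close>, extended by zero to a square matrix on \<open>I\<close>. A shift by \<open>t\<close> amounts to adding \<open>t\<close> times \<open>diagonal\<close> to \<open>f\<close>, and it makes the unmatched columns independent as well.\<close>
  define Y where "Y a b = (if b \<in> I1 then f (unit_matrix (\<phi> b) a) else 0)" for a b
  have diag: "linear_form_on matrix_scale (incidence R) (diagonal :: 'k matrix \<Rightarrow> 'k)"
    by (simp add: linear_form_on_def diagonal_add diagonal_scale)
  define bad1 where "bad1 = {t. mat.dim (radical (incidence R) (\<lambda>x y. f (bracket X x y))) <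
      mat.dim (radical (incidence R) (\<lambda>x y. f (bracket X x y) + t * diagonal (bracket X x y)))}"
  define bad2 where "bad2 = {t. \<nexists>Z. \<forall>i\<in>I. \<forall>j\<in>I.
      (\<Sum>k\<in>I. Z i k * (Y k j + t * of_bool (k = j))) = of_bool (i = j) \<and>
      (\<Sum>k\<in>I. (Y i k + t * of_bool (i = k)) * Z k j) = of_bool (i = j)}"
  have "finite bad1" unfolding bad1_def
    by (rule mat.finite_radical_jumps[OF subspace_incidence incidence_subset_span[OF finite_R] _
          bilinear_form_bracket[OF trans_R f] _ bilinear_form_bracket[OF trans_R diag]])
      (rule finite_imageI finite_R | erule (1) form_bracket_commute[OF trans_R f])+
  moreover have "finite bad2"
    unfolding bad2_def by (rule finite_singular_shifts[OF finite_I])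
  ultimately have "finite (bad1 \<union> bad2)" by simp
  then obtain t where t: "t \<notin> bad1 \<union> bad2"
    using ex_new_if_finite[OF infinite_UNIV_char_0] by blast
  define ft where "ft x = f x + t * diagonal x" for x
  have ft: "linear_form_on matrix_scale (incidence R) ft"
    using f diag by (auto simp: linear_form_on_def ft_def algebra_simps)
  have ft_le: "mat.dim (form_stabilizer (bracket X) (incidence R) ft) \<le>
      mat.dim (form_stabilizer (bracket X) (incidence R) f)"
    using t by (simp add: bad1_def form_stabilizer_eq_radical ft_def)
  define U where "U a b = Y a b + t * of_bool (a = b)" for a b
  obtain Z where ZU: "\<And>i j. i \<in> I \<Longrightarrow> j \<in> I \<Longrightarrow> (\<Sum>k\<in>I. Z i k * U k j) = of_bool (i = j)"
    and UZ: "\<And>i j. i \<in> I \<Longrightarrow> j \<in> I \<Longrightarrow> (\<Sum>k\<in>I. U i k * Z k j) = of_bool (i = j)"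
    using t unfolding U_def bad2_def by blast
  have ft_unit: "ft (unit_matrix (\<phi> b) a) = U a b" if "a \<in> I" "b \<in> I1" for a b
    using that phi_eq_iff by (auto simp: ft_def U_def Y_def diagonal_unit)
  \<comment> \<open>The first conjugation, by \<open>U\<close> on the block \<open>I\<close>, turns the columns of \<open>\<xi>\<close> in \<open>J1\<close> into unit vectors.\<close>
  define blk :: "(nat \<Rightarrow> nat \<Rightarrow> 'k) \<Rightarrow> 'k matrix"
    where "blk M = (\<lambda>a b. if a \<in> I \<and> b \<in> I then M a b else of_bool (a = b \<and> a \<in> X))" for M
  have blk_in: "blk M \<in> incidence R" for M
    using I_clique refl_R by (auto simp: incidence_def blk_def)
  have blk_prod: "mprod X (blk M) (blk N) = identity_on X"
    if MN: "\<And>i j. i \<in> I \<Longrightarrow> j \<in> I \<Longrightarrow> (\<Sum>k\<in>I. M i k * N k j) = of_bool (i = j)" for M N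
  proof (intro ext)
    fix a b
    show "mprod X (blk M) (blk N) a b = identity_on X a b"
    proof (cases "a \<in> I")
      case True
      have "mprod X (blk M) (blk N) a b = (\<Sum>k\<in>I. M a k * blk N k b)"
        unfolding mprod_def using True I_X finite_X
        by (intro sum.mono_neutral_cong_right) (auto simp: blk_def)
      also have "\<dots> = identity_on X a b"
      proof (cases "b \<in> I")
        case b: True
        then have "(\<Sum>k\<in>I. M a k * blk N k b) = (\<Sum>k\<in>I. M a k * N k b)"
          by (intro sum.cong) (auto simp: blk_def)
        then show ?thesis using MN[OF True b] True I_X by (auto simp: identity_on_def)
      next
        case False
        then have "(\<Sum>k\<in>I. M a k * blk N k b) = 0"
          by (intro sum.neutral) (auto simp: blk_def)
        then show ?thesis using True False by (auto simp: identity_on_def)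
      qed
      finally show ?thesis .
    next
      case False
      have "mprod X (blk M) (blk N) a b = (\<Sum>k\<in>X. if k = a then blk N a b else 0)"
        unfolding mprod_def using False by (intro sum.cong) (auto simp: blk_def)
      also have "\<dots> = identity_on X a b"
        using False finite_X by (auto simp: blk_def identity_on_def)
      finally show ?thesis .
    qed
  qed
  define f1 where "f1 x = ft (mprod X (blk U) (mprod X x (blk Z)))" for x
  have Fs: "Field R \<subseteq> X" using Field_R by simp
  have f1: "linear_form_on matrix_scale (incidence R) f1"
    unfolding f1_def by (rule linear_form_conjugate[OF finite_X Fs trans_R blk_in blk_in ft])
  have f1_dim: "mat.dim (form_stabilizer (bracket X) (incidence R) f1) =
      mat.dim (form_stabilizer (bracket X) (incidence R) ft)"
    unfolding f1_def
    by (rule dim_stabilizer_conjugate[OF finite_X Fs trans_R blk_in blk_in ft])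
      (intro blk_prod UZ ZU; assumption)+
  have above_J: "{a. (a, j) \<in> R} \<subseteq> J" if "j \<in> J" "i \<in> I" for i j
    using above_I[OF that(2)] I_bottom J_I that J_not_I trans_R by (blast dest: transD)
  have below_I: "{b. (i, b) \<in> R} = I" if "i \<in> I" for i
    using I_bottom[OF that] I_clique that by auto
  have f1_unit: "f1 (unit_matrix (\<phi> k) i) = of_bool (i = k)" if k: "k \<in> I1" and i: "i \<in> I" for i k
  proof -
    have kJ: "\<phi> k \<in> J" "\<phi> k \<notin> I" using phi_not_I k by auto
    have ki: "(\<phi> k, i) \<in> R" using kJ i J_I by auto
    have inner: "(\<Sum>a\<in>{a. (a, \<phi> k) \<in> R}. blk U a (\<phi> k) * ft (unit_matrix a b)) = U b k" if b: "b \<in> I" for b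
    proof -
      have "(\<Sum>a\<in>{a. (a, \<phi> k) \<in> R}. blk U a (\<phi> k) * ft (unit_matrix a b)) =
          (\<Sum>a\<in>{a. (a, \<phi> k) \<in> R}. if a = \<phi> k then ft (unit_matrix a b) else 0)"
        using kJ J_X by (intro sum.cong) (auto simp: blk_def)
      also have "\<dots> = ft (unit_matrix (\<phi> k) b)"
        using finite_subset[OF above_J[OF kJ(1) i] finite_J] refl_R kJ J_X by auto
      finally show ?thesis using ft_unit[OF b k] by simp
    qed
    have "f1 (unit_matrix (\<phi> k) i) = (\<Sum>b\<in>I. blk Z i b * U b k)"
      unfolding f1_def conjugate_unit_matrix[OF finite_X Fs trans_R blk_in blk_in ft ki] below_I[OF i]
      by (intro sum.cong) (simp_all add: inner)
    also have "\<dots> = (\<Sum>b\<in>I. Z i b * U b k)" using i by (intro sum.cong) (auto simp: blk_def)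
    also have "\<dots> = of_bool (i = k)" using ZU[OF i] k I1_I by auto
    finally show ?thesis .
  qed
  \<comment> \<open>The second conjugation clears the columns of \<open>\<xi>\<close> in \<open>J - J1\<close>; it is unipotent because \<open>w\<close> squares to zero.\<close>
  define w :: "'k matrix" where
    "w = (\<lambda>a b. if a \<in> J1 \<and> b \<in> J - J1 then f1 (unit_matrix b (\<phi>' a)) else 0)"
  have w_in: "w \<in> incidence R" using J1_J2 by (auto simp: incidence_def w_def)
  have one_in: "identity_on X \<in> incidence R" using refl_R by (auto simp: incidence_def identity_on_def)
  have ww: "mprod X w w = 0" by (auto simp: mprod_def w_def fun_eq_iff intro!: sum.neutral)
  note ones = mprod_identity_left[OF finite_X Fs] mprod_identity_right[OF finite_X Fs]
  have u: "identity_on X - w \<in> incidence R" "identity_on X + w \<in> incidence R"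
    using one_in w_in mat.subspace_diff[OF subspace_incidence] mat.subspace_add[OF subspace_incidence] by auto
  have uu: "mprod X (identity_on X - w) (identity_on X + w) = identity_on X"
    "mprod X (identity_on X + w) (identity_on X - w) = identity_on X"
    by (simp_all add: mprod_add_left mprod_diff_left mprod_add_right mprod_diff_right ones one_in w_in ww)
  define f2 where "f2 x = f1 (mprod X (identity_on X - w) (mprod X x (identity_on X + w)))" for x
  have f2: "linear_form_on matrix_scale (incidence R) f2"
    unfolding f2_def by (rule linear_form_conjugate[OF finite_X Fs trans_R u f1])
  have f2_dim: "mat.dim (form_stabilizer (bracket X) (incidence R) f2) =
      mat.dim (form_stabilizer (bracket X) (incidence R) f1)"
    unfolding f2_def by (rule dim_stabilizer_conjugate[OF finite_X Fs trans_R u f1 uu])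
  have st: "standard f2"
    unfolding standard_def
  proof (intro ballI)
    fix j i assume j: "j \<in> J" and i: "i \<in> I"
    have ji: "(j, i) \<in> R" using j i J_I by auto
    have fin: "finite {a. (a, j) \<in> R}" using finite_subset[OF above_J[OF j i] finite_J] .
    have "f2 (unit_matrix j i) = (\<Sum>b\<in>I. (identity_on X + w) i b *
        (\<Sum>a\<in>{a. (a, j) \<in> R}. (identity_on X - w) a j * f1 (unit_matrix a b)))"
      unfolding f2_def conjugate_unit_matrix[OF finite_X Fs trans_R u f1 ji] below_I[OF i] ..
    also have "\<dots> = (\<Sum>b\<in>I. if b = i then
        (\<Sum>a\<in>{a. (a, j) \<in> R}. (identity_on X - w) a j * f1 (unit_matrix a b)) else 0)"
      using i I_X J_not_I by (intro sum.cong) (auto simp: identity_on_def w_def)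
    also have "\<dots> = (\<Sum>a\<in>{a. (a, j) \<in> R}. (identity_on X - w) a j * f1 (unit_matrix a i))"
      using finite_I i by simp
    also have "\<dots> = (\<Sum>a\<in>{a. (a, j) \<in> R}. (if a = j then f1 (unit_matrix j i) else 0) - w a j * f1 (unit_matrix a i))"
      using j J_X by (intro sum.cong) (auto simp: identity_on_def algebra_simps)
    also have "\<dots> = f1 (unit_matrix j i) - (\<Sum>a\<in>{a. (a, j) \<in> R}. w a j * f1 (unit_matrix a i))"
      using fin refl_R j J_X by (auto simp: sum_subtractf)
    also have "\<dots> = of_bool (i \<in> I1 \<and> \<phi> i = j)"
    proof (cases "j \<in> J1")
      case True
      then have "(\<Sum>a\<in>{a. (a, j) \<in> R}. w a j * f1 (unit_matrix a i)) = 0"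
        by (intro sum.neutral) (auto simp: w_def)
      moreover have "f1 (unit_matrix j i) = of_bool (i = \<phi>' j)"
        using f1_unit[OF phi(3)[OF True] i] phi(4)[OF True] by simp
      moreover have "i = \<phi>' j \<longleftrightarrow> i \<in> I1 \<and> \<phi> i = j" using phi True by metis
      ultimately show ?thesis by simp
    next
      case False
      then have iI1: "i \<in> I1" using full j i by auto
      then have ij: "(\<phi> i, j) \<in> R" using phi(1) J1_J2 j False by auto
      have "(\<Sum>a\<in>{a. (a, j) \<in> R}. w a j * f1 (unit_matrix a i)) =
          (\<Sum>a\<in>{a. (a, j) \<in> R}. if a = \<phi> i then f1 (unit_matrix j i) else 0)"
      proof (intro sum.cong refl)
        fix a assume "a \<in> {a. (a, j) \<in> R}"
        show "w a j * f1 (unit_matrix a i) = (if a = \<phi> i then f1 (unit_matrix j i) else 0)"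
        proof (cases "a \<in> J1")
          case True
          then have "f1 (unit_matrix a i) = of_bool (i = \<phi>' a)"
            using f1_unit[OF phi(3)[OF True] i] phi(4)[OF True] by simp
          moreover have "i = \<phi>' a \<longleftrightarrow> a = \<phi> i" using phi True iI1 by metis
          ultimately show ?thesis using True False j by (auto simp: w_def)
        next
          case False
          then show ?thesis using phi(1)[OF iI1] by (auto simp: w_def)
        qed
      qed
      also have "\<dots> = f1 (unit_matrix j i)" using fin ij by simp
      finally show ?thesis using False phi(1) by auto
    qed
    finally show "f2 (unit_matrix j i) = of_bool (i \<in> I1 \<and> \<phi> i = j)" .
  qed
  have "lie_index matrix_scale (bracket X) (incidence R' :: 'k matrix set) \<le>
      mat.dim (form_stabilizer (bracket X) (incidence R') (f2 \<circ> \<psi>))"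
    by (rule mat.lie_index_le[OF linear_form_comp_psi[OF f2]])
  also have "\<dots> = mat.dim (form_stabilizer (bracket X) (incidence R) f2)"
    using dim_stabilizer_standard[OF f2 st] by simp
  also have "\<dots> \<le> lie_index matrix_scale (bracket X) (incidence R :: 'k matrix set)"
    using f2_dim f1_dim ft_le min by simp
  finally show ?thesis by (simp add: incidence_index_X)
qed

theorem incidence_index_reduction:
  "incidence_index TYPE('k::field_char_0) R = incidence_index TYPE('k) R'"
  using incidence_index_le_reduced reduced_index_le_incidence_index by (rule antisym)

end

section \<open>Preorders given by a labelling\<close>

lemma incidence_index_le_image:
  fixes \<psi> :: "'k::field matrix \<Rightarrow> 'k matrix"
  assumes X: "finite X" "Field R \<subseteq> X" and R: "trans R"
    and X': "finite X'" "Field R' \<subseteq> X'" and R': "trans R'"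
    and add: "\<And>x y. \<psi> (x + y) = \<psi> x + \<psi> y"
    and scl: "\<And>c x. \<psi> (matrix_scale c x) = matrix_scale c (\<psi> x)"
    and inj: "\<And>x. x \<in> incidence R' \<Longrightarrow> \<psi> x = 0 \<Longrightarrow> x = 0"
    and im: "\<psi> ` incidence R' = incidence R"
    and hom: "\<And>x y. x \<in> incidence R' \<Longrightarrow> y \<in> incidence R' \<Longrightarrow> \<psi> (bracket X' x y) = bracket X (\<psi> x) (\<psi> y)"
  shows "incidence_index TYPE('k) R' \<le> incidence_index TYPE('k) R"
  unfolding incidence_index_superset[OF X(2,1)] incidence_index_superset[OF X'(2,1)]
  by (rule mat.lie_index_le_image[where \<psi> = \<psi>])
    (rule subspace_incidence add scl im | erule (1) inj hom bracket_in_incidence[OF R'] |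
      erule bilinear_form_bracket[OF R])+

lemma incidence_index_relabel_le:
  assumes h: "bij_betw h X X'" and X: "finite X" "R \<subseteq> X \<times> X" "trans R"
  shows "incidence_index TYPE('k::field) (map_prod h h ` R) \<le> incidence_index TYPE('k) R"
proof -
  define R' where "R' = map_prod h h ` R"
  define \<psi> where "\<psi> x = (\<lambda>a b. if a \<in> X \<and> b \<in> X then x (h a) (h b) else 0)" for x :: "'k matrix"
  have inj: "h a = h b \<longleftrightarrow> a = b" if "a \<in> X" "b \<in> X" for a b
    using h that by (auto simp: bij_betw_def inj_on_def)
  have R'_iff: "(h a, h b) \<in> R' \<longleftrightarrow> (a, b) \<in> R" if "a \<in> X" "b \<in> X" for a b
  proof
    assume "(h a, h b) \<in> R'"
    then obtain c d where cd: "(c, d) \<in> R" "h a = h c" "h b = h d" by (auto simp: R'_def)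
    then have "c \<in> X" "d \<in> X" using X(2) by auto
    then show "(a, b) \<in> R" using cd inj that by simp
  next
    assume "(a, b) \<in> R"
    then show "(h a, h b) \<in> R'"
      unfolding R'_def by (intro image_eqI[where x = "(a, b)"]) simp_all
  qed
  have R'_X': "R' \<subseteq> X' \<times> X'" using h X(2) by (auto simp: R'_def bij_betw_def)
  have ex: "\<exists>a\<in>X. a' = h a" if "a' \<in> X'" for a' using that h by (auto simp: bij_betw_def)
  have tr: "trans R'"
  proof (rule transI)
    fix a b c assume abc: "(a, b) \<in> R'" "(b, c) \<in> R'"
    then have "a \<in> X'" "b \<in> X'" "c \<in> X'" using R'_X' by auto
    then obtain a' b' c' where h: "a = h a'" "b = h b'" "c = h c'" "a' \<in> X" "b' \<in> X" "c' \<in> X"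
      using ex by meson
    then have "(a', b') \<in> R" "(b', c') \<in> R" using abc R'_iff by auto
    then show "(a, c) \<in> R'" using h R'_iff transD[OF X(3)] by blast
  qed
  have "incidence_index TYPE('k) R' \<le> incidence_index TYPE('k) R"
  proof (rule incidence_index_le_image[where \<psi> = \<psi> and X = X and X' = X'])
    show "finite X" "Field R \<subseteq> X" "trans R" using X by (auto simp: Field_def)
    show "finite X'" using X h bij_betw_finite by blast
    show "Field R' \<subseteq> X'" using R'_X' by (auto simp: Field_def)
    show "trans R'" by (rule tr)
    show "\<psi> (x + y) = \<psi> x + \<psi> y" for x y by (auto simp: \<psi>_def fun_eq_iff)
    show "\<psi> (matrix_scale c x) = matrix_scale c (\<psi> x)" for c x
      by (auto simp: \<psi>_def fun_eq_iff matrix_scale_def)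
    show "x = 0" if x: "x \<in> incidence R'" "\<psi> x = 0" for x
    proof (intro ext)
      fix a b
      show "x a b = 0 a b"
      proof (cases "a \<in> X' \<and> b \<in> X'")
        case True
        then obtain a' b' where ab: "a = h a'" "b = h b'" "a' \<in> X" "b' \<in> X" using ex by blast
        have "\<psi> x a' b' = 0" using x(2) by simp
        then show ?thesis using ab by (simp add: \<psi>_def)
      next
        case False
        then show ?thesis using incidenceD[OF x(1), of a b] R'_X' by auto
      qed
    qed
    show "\<psi> ` incidence R' = incidence R"
    proof (intro equalityI subsetI)
      fix y assume "y \<in> \<psi> ` incidence R'"
      then obtain x where x: "x \<in> incidence R'" "y = \<psi> x" by auto
      show "y \<in> incidence R"
        unfolding incidence_def using x incidenceD[OF x(1)] R'_iff by (auto simp: \<psi>_def)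
    next
      fix y :: "'k matrix" assume y: "y \<in> incidence R"
      define x where "x = (\<lambda>a b. if (a, b) \<in> R' then y (inv_into X h a) (inv_into X h b) else 0)"
      have i: "inv_into X h (h a) = a" if "a \<in> X" for a
        using h that by (simp add: bij_betw_def inv_into_f_f)
      have "\<psi> x = y"
      proof (intro ext)
        fix a b show "\<psi> x a b = y a b"
          using incidenceD[OF y, of a b] R'_iff[of a b] X(2) i by (auto simp: \<psi>_def x_def)
      qed
      moreover have "x \<in> incidence R'" by (simp add: x_def incidence_def)
      ultimately show "y \<in> \<psi> ` incidence R'" by blast
    qed
    have prod: "\<psi> (mprod X' x y) = mprod X (\<psi> x) (\<psi> y)" for x y
    proof (intro ext)
      fix a b
      have "(\<Sum>l\<in>X'. x (h a) l * y l (h b)) = (\<Sum>l\<in>X. x (h a) (h l) * y (h l) (h b))"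
        using sum.reindex_bij_betw[OF h, of "\<lambda>l. x (h a) l * y l (h b)"] by simp
      then show "\<psi> (mprod X' x y) a b = mprod X (\<psi> x) (\<psi> y) a b"
        by (auto simp: \<psi>_def mprod_def intro!: sum.cong)
    qed
    have "\<psi> (x - y) = \<psi> x - \<psi> y" for x y by (auto simp: \<psi>_def fun_eq_iff)
    then show "\<psi> (bracket X' x y) = bracket X (\<psi> x) (\<psi> y)" for x y
      by (simp add: bracket_def prod)
  qed
  then show ?thesis by (simp add: R'_def)
qed

lemma incidence_index_relabel:
  assumes h: "bij_betw h X X'" and X: "finite X" "R \<subseteq> X \<times> X" "trans R"
  shows "incidence_index TYPE('k::field) (map_prod h h ` R) = incidence_index TYPE('k) R"
proof (rule antisym)
  show "incidence_index TYPE('k) (map_prod h h ` R) \<le> incidence_index TYPE('k) R"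
    by (rule incidence_index_relabel_le[OF assms])
  let ?g = "inv_into X h"
  have g: "?g (h a) = a" if "a \<in> X" for a using h that by (simp add: bij_betw_def inv_into_f_f)
  have "map_prod ?g ?g (map_prod h h p) = p" if "p \<in> R" for p
    using that X(2) g by (cases p) auto
  then have inv: "map_prod ?g ?g ` map_prod h h ` R = R"
    by (simp add: image_image)
  have "map_prod h h ` R \<subseteq> X' \<times> X'"
    using h X(2) by (auto simp: bij_betw_def)
  moreover have "trans (map_prod h h ` R)"
  proof (rule transI)
    fix a b c assume "(a, b) \<in> map_prod h h ` R" "(b, c) \<in> map_prod h h ` R"
    then obtain a' b' b'' c' where *: "(a', b') \<in> R" "(b'', c') \<in> R" "a = h a'" "b = h b'" "b = h b''" "c = h c'"
      by auto
    then have "b' = b''" using g X(2) by (metis mem_Sigma_iff subsetD)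
    then show "(a, c) \<in> map_prod h h ` R" using * X(3) by (auto dest: transD)
  qed
  ultimately have "incidence_index TYPE('k) (map_prod ?g ?g ` map_prod h h ` R) \<le>
      incidence_index TYPE('k) (map_prod h h ` R)"
    using bij_betw_finite[OF h] X(1)
    by (intro incidence_index_relabel_le[OF bij_betw_inv_into[OF h]]) auto
  then show "incidence_index TYPE('k) R \<le> incidence_index TYPE('k) (map_prod h h ` R)"
    by (simp add: inv)
qed

text \<open>
  The negative transpose is an isomorphism of Lie algebras.
\<close>
lemma incidence_index_converse_le:
  assumes "finite R" "trans R"
  shows "incidence_index TYPE('k::field) (R\<inverse>) \<le> incidence_index TYPE('k) R"
proof (rule incidence_index_le_image[where \<psi> = "\<lambda>x a b. - x b a" and X = "Field R" and X' = "Field R"])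
  show "(\<lambda>x a b. - x b a :: 'k) ` incidence (R\<inverse>) = incidence R"
  proof (intro equalityI subsetI)
    fix y :: "'k matrix" assume "y \<in> incidence R"
    then show "y \<in> (\<lambda>x a b. - x b a) ` incidence (R\<inverse>)"
      by (intro image_eqI[where x = "\<lambda>a b. - y b a"]) (auto simp: incidence_def)
  qed (auto simp: incidence_def)
  show "(\<lambda>a b. - bracket (Field R) x y b a) =
      bracket (Field R) (\<lambda>a b. - x b a) (\<lambda>a b. - y b a)" for x y :: "'k matrix"
    by (auto simp: bracket_def mprod_def fun_eq_iff mult.commute)
qed (use assms in \<open>auto simp: fun_eq_iff matrix_scale_def finite_Field\<close>)

lemma incidence_index_converse:
  assumes "finite R" "trans R"
  shows "incidence_index TYPE('k::field) (R\<inverse>) = incidence_index TYPE('k) R"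
  using incidence_index_converse_le[OF assms] incidence_index_converse_le[of "R\<inverse>"] assms
  by (metis antisym converse_converse finite_converse trans_on_converse)

text \<open>
  The points with label \<open>q\<close> form a clique that replaces the point \<open>q\<close> of the preorder \<open>Q\<close>.
\<close>
definition blow_up :: "(nat \<Rightarrow> nat) \<Rightarrow> nat rel \<Rightarrow> nat set \<Rightarrow> nat rel" where
  "blow_up \<beta> Q X = {(a, b). a \<in> X \<and> b \<in> X \<and> (\<beta> a, \<beta> b) \<in> Q}"

lemma trans_blow_up: "trans Q \<Longrightarrow> trans (blow_up \<beta> Q X)"
  by (auto simp: blow_up_def trans_def)

lemma ex_bij_betw_fibres:
  assumes "finite X" "finite X'" and card: "\<And>q. card {x \<in> X. \<beta> x = q} = card {x \<in> X'. \<beta>' x = q}"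
  shows "\<exists>h. bij_betw h X X' \<and> (\<forall>x\<in>X. \<beta>' (h x) = \<beta> x)"
proof -
  have "\<exists>h. bij_betw h {x \<in> X. \<beta> x = q} {x \<in> X'. \<beta>' x = q}" for q
    using assms by (intro finite_same_card_bij) auto
  then obtain h where h: "\<And>q. bij_betw (h q) {x \<in> X. \<beta> x = q} {x \<in> X'. \<beta>' x = q}" by metis
  let ?h = "\<lambda>x. h (\<beta> x) x"
  have im: "?h x \<in> X'" "\<beta>' (?h x) = \<beta> x" if "x \<in> X" for x
    using bij_betwE[OF h[of "\<beta> x"]] that by auto
  have "inj_on ?h X"
  proof (rule inj_onI)
    fix x y assume xy: "x \<in> X" "y \<in> X" "?h x = ?h y"
    then have "\<beta> x = \<beta> y" using im by metis
    then show "x = y" using h[of "\<beta> x"] xy unfolding bij_betw_def inj_on_def by auto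
  qed
  moreover have "?h ` X = X'"
  proof (intro equalityI subsetI)
    fix y assume "y \<in> X'"
    then have "y \<in> h (\<beta>' y) ` {x \<in> X. \<beta> x = \<beta>' y}" using h[of "\<beta>' y"] by (auto simp: bij_betw_def)
    then show "y \<in> ?h ` X" by force
  qed (use im in auto)
  ultimately show ?thesis using im by (auto simp: bij_betw_def)
qed

lemma incidence_index_blow_up_cong:
  assumes "finite X" "finite X'" and card: "\<And>q. card {x \<in> X. \<beta> x = q} = card {x \<in> X'. \<beta>' x = q}"
    and "trans Q"
  shows "incidence_index TYPE('k::field) (blow_up \<beta> Q X) = incidence_index TYPE('k) (blow_up \<beta>' Q X')"
proof -
  obtain h where h: "bij_betw h X X'" "\<And>x. x \<in> X \<Longrightarrow> \<beta>' (h x) = \<beta> x"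
    using ex_bij_betw_fibres[OF assms(1-3)] by blast
  have "blow_up \<beta>' Q X' = map_prod h h ` blow_up \<beta> Q X"
  proof (intro equalityI subsetI)
    fix p assume "p \<in> blow_up \<beta>' Q X'"
    then obtain a b where p: "p = (h a, h b)" "a \<in> X" "b \<in> X" "(\<beta>' (h a), \<beta>' (h b)) \<in> Q"
      using h(1) by (auto simp: blow_up_def bij_betw_def)
    then show "p \<in> map_prod h h ` blow_up \<beta> Q X"
      using h(2) by (auto simp: blow_up_def image_iff intro!: bexI[of _ "(a, b)"])
  qed (use h in \<open>auto simp: blow_up_def bij_betw_def\<close>)
  moreover have "blow_up \<beta> Q X \<subseteq> X \<times> X" by (auto simp: blow_up_def)
  ultimately show ?thesis
    using incidence_index_relabel[OF h(1) assms(1) _ trans_blow_up[OF assms(4)]] by metis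
qed

text \<open>
  A set with \<open>s q\<close> points of label \<open>q\<close>, for every \<open>q\<close>; the points are encoded pairs.
\<close>
definition sized_set :: "(nat \<Rightarrow> nat) \<Rightarrow> nat set" where
  "sized_set s = {x. snd (prod_decode x) < s (fst (prod_decode x))}"

definition label :: "nat \<Rightarrow> nat" where "label x = fst (prod_decode x)"

definition labelled_index :: "'k::field itself \<Rightarrow> nat rel \<Rightarrow> (nat \<Rightarrow> nat) \<Rightarrow> nat" where
  "labelled_index k Q s = incidence_index k (blow_up label Q (sized_set s))"

lemma sized_fibre: "{x \<in> sized_set s. label x = q} = (\<lambda>i. prod_encode (q, i)) ` {..<s q}"
proof (intro equalityI subsetI)
  fix x assume "x \<in> {x \<in> sized_set s. label x = q}"
  then have "snd (prod_decode x) < s q" "x = prod_encode (q, snd (prod_decode x))"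
    by (auto simp: sized_set_def label_def)
  then show "x \<in> (\<lambda>i. prod_encode (q, i)) ` {..<s q}" by blast
qed (auto simp: sized_set_def label_def)

lemma card_sized_fibre: "card {x \<in> sized_set s. label x = q} = s q"
  unfolding sized_fibre by (subst card_image) (auto simp: inj_on_def)

lemma finite_sized_set:
  assumes "\<And>q. q > N \<Longrightarrow> s q = 0"
  shows "finite (sized_set s)"
proof -
  have "sized_set s \<subseteq> (\<Union>q\<in>{..N}. {x \<in> sized_set s. label x = q})"
  proof
    fix x assume x: "x \<in> sized_set s"
    then have "s (label x) \<noteq> 0" by (auto simp: sized_set_def label_def)
    then have "label x \<le> N" using assms not_less by blast
    then show "x \<in> (\<Union>q\<in>{..N}. {x \<in> sized_set s. label x = q})" using x by auto
  qed
  moreover have "finite (\<Union>q\<in>{..N}. {x \<in> sized_set s. label x = q})"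
    unfolding sized_fibre by blast
  ultimately show ?thesis by (rule finite_subset)
qed

lemma labelled_index_eq:
  assumes "finite X" "\<And>q. card {x \<in> X. \<beta> x = q} = s q" "trans Q"
  shows "incidence_index TYPE('k::field) (blow_up \<beta> Q X) = labelled_index TYPE('k) Q s"
proof -
  have "s q = 0" if "q > Max (insert 0 (\<beta> ` X))" for q
  proof -
    have "{x \<in> X. \<beta> x = q} = {}" using that assms(1) by auto
    then show ?thesis using assms(2)[of q] by (metis card.empty)
  qed
  then have "finite (sized_set s)" by (rule finite_sized_set)
  then show ?thesis
    unfolding labelled_index_def using assms
    by (intro incidence_index_blow_up_cong) (auto simp: card_sized_fibre)
qed

section \<open>Chains and chains with a branch\<close>

definition chain_rel :: "nat rel" where "chain_rel = {(p, q). p \<le> q}"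

text \<open>
  A chain with labels \<open>0\<close>, \<dots>, \<open>r\<close> and top \<open>0\<close>, together with a label \<open>Suc r\<close> that lies
  below \<open>0\<close> only.
\<close>
definition branch_rel :: "nat \<Rightarrow> nat rel" where
  "branch_rel r = {(p, q). p \<le> q \<and> q \<le> r} \<union> {(0, Suc r), (Suc r, Suc r)}"

definition sizes :: "nat list \<Rightarrow> nat \<Rightarrow> nat" where
  "sizes c q = (if q < length c then c ! q else 0)"

lemma trans_chain_rel: "trans chain_rel"
  by (auto simp: chain_rel_def trans_def)

lemma trans_branch_rel: "trans (branch_rel r)"
  by (auto simp: branch_rel_def trans_def)

lemma finite_sized_set_sizes: "finite (sized_set (sizes c))"
  by (rule finite_sized_set[of "length c"]) (simp add: sizes_def)

lemma label_less: "x \<in> sized_set (sizes c) \<Longrightarrow> label x < length c"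
  by (auto simp: sized_set_def label_def sizes_def split: if_splits)

text \<open>
  The last class is removed and matched with \<open>p\<close> points of the first class; here \<open>J\<close> consists
  of all other points. The matched points are no longer above anything but themselves, so they
  form a branch below the remaining \<open>d\<close> points of the first class.
\<close>
lemma chain_index_split_ends:
  "labelled_index TYPE('k::field_char_0) chain_rel (sizes ((p + d) # mid @ [p])) =
   labelled_index TYPE('k) (branch_rel (length mid)) (sizes (d # mid @ [p]))"
proof -
  let ?r = "length mid"
  let ?s = "sizes ((p + d) # mid @ [p])"
  define X where "X = sized_set ?s"
  define R where "R = blow_up label chain_rel X"
  have fin: "finite X" unfolding X_def by (rule finite_sized_set_sizes)
  have lab: "label x \<le> Suc ?r" if "x \<in> X" for x using label_less[of x] that by (force simp: X_def)
  have card: "card {x \<in> X. label x = q} = ?s q" for q unfolding X_def by (rule card_sized_fibre)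
  define I where "I = {x \<in> X. label x = Suc ?r}"
  have cI: "card I = p" unfolding I_def card by (simp add: sizes_def nth_append)
  have c0: "card {x \<in> X. label x = 0} = p + d" unfolding card by (simp add: sizes_def)
  then obtain J1 where J1: "J1 \<subseteq> {x \<in> X. label x = 0}" "card J1 = p" "finite J1"
    using obtain_subset_with_card_n[of p "{x \<in> X. label x = 0}"] by auto
  obtain \<phi> where \<phi>: "bij_betw \<phi> I J1"
    using finite_same_card_bij[of I J1] fin J1 cI by (auto simp: I_def)
  interpret clique_reduction X I "X - I" I J1 R \<phi>
  proof
    show "bij_betw \<phi> I J1" by (rule \<phi>)
  qed (use fin J1 lab trans_blow_up[OF trans_chain_rel] in
      \<open>auto simp: R_def blow_up_def chain_rel_def I_def le_antisym\<close>)
  define \<beta> where "\<beta> x = (if x \<in> J1 then Suc ?r else label x)" for x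
  have "R' = blow_up \<beta> (branch_rel ?r) (X - I)"
  proof (rule Set.set_eqI)
    fix z :: "nat \<times> nat"
    obtain x y where z: "z = (x, y)" by (cases z)
    show "z \<in> R' \<longleftrightarrow> z \<in> blow_up \<beta> (branch_rel ?r) (X - I)"
    proof (cases "x \<in> X - I \<and> y \<in> X - I")
      case True
      then have "label x \<le> ?r" "label y \<le> ?r" using lab[of x] lab[of y] by (auto simp: I_def)
      moreover have "label x = 0" if "x \<in> J1" using that J1 by auto
      moreover have "label y = 0" if "y \<in> J1" using that J1 by auto
      ultimately show ?thesis using True
        unfolding R'_def by (auto simp: z R_def blow_up_def chain_rel_def branch_rel_def \<beta>_def)
    next
      case False
      then show ?thesis unfolding R'_def by (auto simp: z R_def blow_up_def)
    qed
  qed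
  moreover have "card {x \<in> X - I. \<beta> x = q} = sizes (d # mid @ [p]) q" for q
  proof -
    consider "q = 0" | "q = Suc ?r" | "q > Suc ?r" | "0 < q" "q \<le> ?r" by linarith
    then show ?thesis
    proof cases
      case 1
      then have "{x \<in> X - I. \<beta> x = q} = {x \<in> X. label x = 0} - J1"
        by (auto simp: I_def \<beta>_def)
      then have "card {x \<in> X - I. \<beta> x = q} = (p + d) - p"
        using card_Diff_subset[OF J1(3,1)] c0 J1(2) by simp
      then show ?thesis using 1 by (simp add: sizes_def)
    next
      case 2
      then have "{x \<in> X - I. \<beta> x = q} = J1"
        using J1 by (auto simp: I_def \<beta>_def)
      then show ?thesis using 2 J1 by (simp add: sizes_def nth_append)
    next
      case 3
      then have "{x \<in> X - I. \<beta> x = q} = {}"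
        using lab by (force simp: \<beta>_def)
      then show ?thesis using 3 by (simp only: card.empty) (simp add: sizes_def)
    next
      case 4
      then have "{x \<in> X - I. \<beta> x = q} = {x \<in> X. label x = q}"
        using J1 by (auto simp: I_def \<beta>_def)
      then have "card {x \<in> X - I. \<beta> x = q} = ?s q" using card by simp
      then show ?thesis using 4 by (cases q) (auto simp: sizes_def nth_append)
    qed
  qed
  ultimately have "incidence_index TYPE('k) R' =
      labelled_index TYPE('k) (branch_rel ?r) (sizes (d # mid @ [p]))"
    using labelled_index_eq[of "X - I" \<beta> _ "branch_rel ?r"] fin trans_branch_rel by auto
  then show ?thesis
    using incidence_index_reduction[where ?'k = 'k] by (simp add: labelled_index_def R_def X_def)
qed

text \<open>
  The \<open>d\<close> points on top are matched with points of the branch, which are removed.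
\<close>
lemma branch_index_shrink:
  "labelled_index TYPE('k::field_char_0) (branch_rel (length mid)) (sizes (d # mid @ [p + d])) =
   labelled_index TYPE('k) (branch_rel (length mid)) (sizes (d # mid @ [p]))"
proof -
  let ?r = "length mid"
  let ?s = "sizes (d # mid @ [p + d])"
  define X where "X = sized_set ?s"
  define R where "R = blow_up label (branch_rel ?r) X"
  have fin: "finite X" unfolding X_def by (rule finite_sized_set_sizes)
  have lab: "label x \<le> Suc ?r" if "x \<in> X" for x using label_less[of x] that by (force simp: X_def)
  have card: "card {x \<in> X. label x = q} = ?s q" for q unfolding X_def by (rule card_sized_fibre)
  define I where "I = {x \<in> X. label x = Suc ?r}"
  define J where "J = {x \<in> X. label x = 0}"
  have cI: "card I = p + d" unfolding I_def card by (simp add: sizes_def nth_append)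
  have cJ: "card J = d" unfolding J_def card by (simp add: sizes_def)
  obtain I1 where I1: "I1 \<subseteq> I" "card I1 = d" "finite I1"
    using cI obtain_subset_with_card_n[of d I] by auto
  obtain \<phi> where \<phi>: "bij_betw \<phi> I1 J"
    using finite_same_card_bij[of I1 J] fin I1 cJ by (auto simp: J_def)
  interpret clique_reduction X I J I1 J R \<phi>
  proof
    show "bij_betw \<phi> I1 J" by (rule \<phi>)
    show "I1 \<subseteq> I" by (rule I1)
  qed (use fin lab trans_blow_up[OF trans_branch_rel] in
      \<open>auto simp: R_def blow_up_def branch_rel_def I_def J_def le_Suc_eq\<close>)
  have "R' = blow_up label (branch_rel ?r) (X - I1)"
    unfolding R'_def using I1 by (auto simp: R_def blow_up_def)
  moreover have "card {x \<in> X - I1. label x = q} = sizes (d # mid @ [p]) q" for q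
  proof (cases "q = Suc ?r")
    case True
    then have "{x \<in> X - I1. label x = q} = I - I1" by (auto simp: I_def)
    then have "card {x \<in> X - I1. label x = q} = p"
      using card_Diff_subset[OF I1(3,1)] cI I1(2) by simp
    then show ?thesis using True by (simp add: sizes_def nth_append)
  next
    case False
    then have "{x \<in> X - I1. label x = q} = {x \<in> X. label x = q}" using I1 by (auto simp: I_def)
    then show ?thesis using False card[of q] by (cases q) (auto simp: sizes_def nth_append)
  qed
  ultimately have "incidence_index TYPE('k) R' =
      labelled_index TYPE('k) (branch_rel ?r) (sizes (d # mid @ [p]))"
    using labelled_index_eq[of "X - I1" label _ "branch_rel ?r"] fin trans_branch_rel by auto
  then show ?thesis
    using incidence_index_reduction[where ?'k = 'k] by (simp add: labelled_index_def R_def X_def)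
qed

text \<open>
  The whole branch is removed and matched with \<open>p\<close> of the points on top; the \<open>x\<close> unmatched ones
  end up strictly above the matched ones.
\<close>
lemma branch_index_merge:
  "labelled_index TYPE('k::field_char_0) (branch_rel (length mid)) (sizes ((x + p) # mid @ [p])) =
   labelled_index TYPE('k) chain_rel (sizes (x # p # mid))"
proof -
  let ?r = "length mid"
  let ?s = "sizes ((x + p) # mid @ [p])"
  define X where "X = sized_set ?s"
  define R where "R = blow_up label (branch_rel ?r) X"
  have fin: "finite X" unfolding X_def by (rule finite_sized_set_sizes)
  have lab: "label x \<le> Suc ?r" if "x \<in> X" for x using label_less[of x] that by (force simp: X_def)
  have card: "card {x \<in> X. label x = q} = ?s q" for q unfolding X_def by (rule card_sized_fibre)
  define I where "I = {x \<in> X. label x = Suc ?r}"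
  define J where "J = {x \<in> X. label x = 0}"
  have cI: "card I = p" unfolding I_def card by (simp add: sizes_def nth_append)
  have cJ: "card J = x + p" unfolding J_def card by (simp add: sizes_def)
  obtain J1 where J1: "J1 \<subseteq> J" "card J1 = p" "finite J1"
    using cJ obtain_subset_with_card_n[of p J] by auto
  obtain \<phi> where \<phi>: "bij_betw \<phi> I J1"
    using finite_same_card_bij[of I J1] fin J1 cI by (auto simp: I_def)
  interpret clique_reduction X I J I J1 R \<phi>
  proof
    show "bij_betw \<phi> I J1" by (rule \<phi>)
    show "J1 \<subseteq> J" by (rule J1)
    show "J1 \<times> (J - J1) \<subseteq> R"
      using J1 by (auto simp: R_def blow_up_def branch_rel_def J_def)
  qed (use fin lab trans_blow_up[OF trans_branch_rel] in
      \<open>auto simp: R_def blow_up_def branch_rel_def I_def J_def le_Suc_eq\<close>)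
  define \<beta> where "\<beta> y = (if y \<in> J - J1 then 0 else Suc (label y))" for y
  have "R' = blow_up \<beta> chain_rel (X - I)"
  proof (rule Set.set_eqI)
    fix z :: "nat \<times> nat"
    obtain y y' where z: "z = (y, y')" by (cases z)
    show "z \<in> R' \<longleftrightarrow> z \<in> blow_up \<beta> chain_rel (X - I)"
    proof (cases "y \<in> X - I \<and> y' \<in> X - I")
      case True
      then have "label y \<le> ?r" "label y' \<le> ?r" using lab[of y] lab[of y'] by (auto simp: I_def)
      moreover have "label y = 0 \<longleftrightarrow> y \<in> J" "label y' = 0 \<longleftrightarrow> y' \<in> J" using True by (auto simp: J_def)
      ultimately show ?thesis using True J1(1)
        unfolding R'_def by (auto simp: z R_def blow_up_def chain_rel_def branch_rel_def \<beta>_def)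
    next
      case False
      then show ?thesis unfolding R'_def by (auto simp: z R_def blow_up_def)
    qed
  qed
  moreover have "card {y \<in> X - I. \<beta> y = q} = sizes (x # p # mid) q" for q
  proof -
    consider "q = 0" | "q = Suc 0" | l where "q = Suc (Suc l)" "l < ?r" | l where "q = Suc (Suc l)" "\<not> l < ?r"
      by (metis not0_implies_Suc)
    then show ?thesis
    proof cases
      case 1
      then have "{y \<in> X - I. \<beta> y = q} = J - J1" by (auto simp: I_def J_def \<beta>_def)
      then have "card {y \<in> X - I. \<beta> y = q} = (x + p) - p"
        using card_Diff_subset[OF J1(3,1)] cJ J1(2) by simp
      then show ?thesis using 1 by (simp add: sizes_def)
    next
      case 2
      then have "{y \<in> X - I. \<beta> y = q} = J1" using J1(1) by (auto simp: I_def J_def \<beta>_def)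
      then show ?thesis using 2 J1 by (simp add: sizes_def)
    next
      case 3
      then have "{y \<in> X - I. \<beta> y = q} = {y \<in> X. label y = Suc l}" by (auto simp: I_def J_def \<beta>_def)
      then have "card {y \<in> X - I. \<beta> y = q} = ?s (Suc l)" using card by simp
      then show ?thesis using 3 by (simp add: sizes_def nth_append)
    next
      case 4
      then have "{y \<in> X - I. \<beta> y = q} = {}" using lab by (force simp: \<beta>_def I_def)
      then show ?thesis using 4 by (simp only: card.empty) (simp add: sizes_def)
    qed
  qed
  ultimately have "incidence_index TYPE('k) R' =
      labelled_index TYPE('k) chain_rel (sizes (x # p # mid))"
    using labelled_index_eq[of "X - I" \<beta> _ chain_rel] fin trans_chain_rel by auto
  then show ?thesis
    using incidence_index_reduction[where ?'k = 'k] by (simp add: labelled_index_def R_def X_def)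
qed

lemma branch_index_trivial:
  "labelled_index TYPE('k::field) (branch_rel (length mid)) (sizes (d # mid @ [0])) =
   labelled_index TYPE('k) chain_rel (sizes (d # mid))"
proof -
  have "sizes (d # mid @ [0]) = sizes (d # mid)"
    by (auto simp: sizes_def nth_append nth_Cons fun_eq_iff split: nat.splits)
  moreover have "blow_up label (branch_rel (length mid)) (sized_set (sizes (d # mid))) =
      blow_up label chain_rel (sized_set (sizes (d # mid)))"
    using label_less[of _ "d # mid"] by (force simp: blow_up_def branch_rel_def chain_rel_def)
  ultimately show ?thesis by (simp add: labelled_index_def)
qed

lemma branch_index_shrink_iterate:
  "labelled_index TYPE('k::field_char_0) (branch_rel (length mid)) (sizes (d # mid @ [p + m * d])) =
   labelled_index TYPE('k) (branch_rel (length mid)) (sizes (d # mid @ [p]))"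
proof (induction m)
  case (Suc m)
  show ?case
    using branch_index_shrink[of mid d "p + m * d", where ?'k = 'k] Suc by (simp add: algebra_simps)
qed simp

text \<open>
  The branch has \<open>(m + 1) a\<close> points and is exhausted by \<open>m + 1\<close> steps of size \<open>a\<close>.
\<close>
lemma chain_index_sigma:
  "labelled_index TYPE('k::field_char_0) chain_rel (sizes (((m + 2) * a # as) @ [(m + 1) * a])) =
   labelled_index TYPE('k) chain_rel (sizes (a # as))"
proof -
  have "labelled_index TYPE('k) chain_rel (sizes (((m + 2) * a # as) @ [(m + 1) * a])) =
      labelled_index TYPE('k) chain_rel (sizes (((m + 1) * a + a) # as @ [(m + 1) * a]))"
    by (simp add: algebra_simps)
  also have "\<dots> = labelled_index TYPE('k) (branch_rel (length as)) (sizes (a # as @ [0 + (m + 1) * a]))"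
    unfolding chain_index_split_ends by simp
  also have "\<dots> = labelled_index TYPE('k) chain_rel (sizes (a # as))"
    unfolding branch_index_shrink_iterate branch_index_trivial ..
  finally show ?thesis .
qed

text \<open>
  The branch has \<open>b + m (a + b)\<close> points; after \<open>m\<close> steps of size \<open>a + b\<close> the remaining \<open>b\<close> points
  are merged with the \<open>a + b\<close> points on top.
\<close>
lemma chain_index_tau:
  "labelled_index TYPE('k::field_char_0) chain_rel
     (sizes (((m + 1) * a + (m + 2) * b) # as @ [m * a + (m + 1) * b])) =
   labelled_index TYPE('k) chain_rel (sizes (a # b # as))"
proof -
  have "labelled_index TYPE('k) chain_rel
      (sizes (((m + 1) * a + (m + 2) * b) # as @ [m * a + (m + 1) * b])) =
    labelled_index TYPE('k) chain_rel
      (sizes (((b + m * (a + b)) + (a + b)) # as @ [b + m * (a + b)]))"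
    by (simp add: algebra_simps)
  also have "\<dots> = labelled_index TYPE('k) chain_rel (sizes (a # b # as))"
    unfolding chain_index_split_ends branch_index_shrink_iterate branch_index_merge ..
  finally show ?thesis .
qed

lemma chain_index_rev:
  "labelled_index TYPE('k::field) chain_rel (sizes (rev c)) = labelled_index TYPE('k) chain_rel (sizes c)"
proof -
  let ?X = "sized_set (sizes c)"
  let ?R = "blow_up label chain_rel ?X"
  let ?\<beta> = "\<lambda>x. length c - Suc (label x)"
  have fin: "finite ?X" by (rule finite_sized_set_sizes)
  have "?R\<inverse> = blow_up ?\<beta> chain_rel ?X"
    using label_less[of _ c] by (force simp: blow_up_def chain_rel_def)
  moreover have "card {x \<in> ?X. ?\<beta> x = q} = sizes (rev c) q" for q
  proof (cases "q < length c")
    case True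
    then have "{x \<in> ?X. ?\<beta> x = q} = {x \<in> ?X. label x = length c - Suc q}"
      using label_less[of _ c] by force
    then show ?thesis using True by (simp add: card_sized_fibre sizes_def rev_nth)
  next
    case False
    then have "{x \<in> ?X. ?\<beta> x = q} = {}" using label_less[of _ c] by force
    then show ?thesis using False by (simp only: card.empty) (simp add: sizes_def)
  qed
  ultimately have "incidence_index TYPE('k) (?R\<inverse>) = labelled_index TYPE('k) chain_rel (sizes (rev c))"
    using labelled_index_eq[OF fin _ trans_chain_rel, of ?\<beta>] by auto
  moreover have "finite ?R"
    by (rule finite_subset[of _ "?X \<times> ?X"]) (use fin in \<open>auto simp: blow_up_def\<close>)
  ultimately show ?thesis
    using incidence_index_converse[OF _ trans_blow_up[OF trans_chain_rel], of label ?X, where ?'k = 'k]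
    by (simp add: labelled_index_def)
qed

section \<open>Parabolic subalgebras\<close>

lemma commutator_eq_bracket: "commutator n = bracket {..<n}"
  by (simp add: fun_eq_iff commutator_def bracket_def matrix_mult_def mprod_def)

definition parabolic_rel :: "composition \<Rightarrow> nat rel" where
  "parabolic_rel a = blow_up (block_of a) chain_rel {..<comp_size a}"

lemma trans_parabolic_rel: "trans (parabolic_rel a)"
  unfolding parabolic_rel_def by (rule trans_blow_up[OF trans_chain_rel])

lemma finite_parabolic_rel: "finite (parabolic_rel a)"
  by (rule finite_subset[of _ "{..<comp_size a} \<times> {..<comp_size a}"])
    (auto simp: parabolic_rel_def blow_up_def)

lemma parabolic_eq:
  "parabolic a = {x \<in> incidence (parabolic_rel a). matrix_trace (comp_size a) x = 0}"
  unfolding parabolic_def incidence_def square_matrices_def parabolic_rel_def blow_up_def chain_rel_def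
  by (auto simp: not_le)

lemma parts_neq_Nil: "parts a \<noteq> []"
  using parts[of a] by simp

lemma parts_pos: "x \<in> set (parts a) \<Longrightarrow> 0 < x"
  using parts[of a] by simp

lemma comp_size_pos: "0 < comp_size a"
  using parts_neq_Nil[of a] parts_pos[of _ a] unfolding comp_size_def by (cases "parts a") auto

lemma matrix_trace_add: "matrix_trace n (x + y) = matrix_trace n x + matrix_trace n y"
  by (simp add: matrix_trace_def sum.distrib)

lemma matrix_trace_scale: "matrix_trace n (matrix_scale c x) = c * matrix_trace n x"
  by (simp add: matrix_trace_def matrix_scale_def sum_distrib_left)

lemma matrix_trace_identity: "matrix_trace n (identity_on {..<n} :: 'k::comm_ring_1 matrix) = of_nat n"
  by (simp add: matrix_trace_def identity_on_def)

text \<open>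
  In characteristic zero the full block triangular algebra is the direct sum of its trace zero
  part and the scalar matrices. The latter are central, so they belong to every stabilizer.
\<close>
lemma dim_stabilizer_parabolic:
  fixes F :: "'k::field_char_0 matrix \<Rightarrow> 'k" and a :: composition
  defines "G \<equiv> incidence (parabolic_rel a)" and "n \<equiv> comp_size a"
  assumes F: "linear_form_on matrix_scale G F"
  shows "mat.dim (form_stabilizer (bracket {..<n}) G F) =
    Suc (mat.dim (form_stabilizer (bracket {..<n}) (parabolic a) F))"
proof -
  let ?br = "bracket {..<n}"
  let ?one = "identity_on {..<n} :: 'k matrix"
  let ?S = "form_stabilizer ?br (parabolic a) F"
  note tr = trans_parabolic_rel[of a]
  have Fs: "Field (parabolic_rel a) \<subseteq> {..<n}"
    by (auto simp: parabolic_rel_def blow_up_def Field_def n_def)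
  have n: "(of_nat n :: 'k) \<noteq> 0" using comp_size_pos[of a] by (simp add: n_def)
  have one: "?one \<in> G"
    by (auto simp: G_def incidence_def identity_on_def parabolic_rel_def blow_up_def chain_rel_def n_def)
  have PG: "parabolic a \<subseteq> G" by (auto simp: parabolic_eq G_def)
  have subP: "mat.subspace (parabolic a :: 'k matrix set)" by (rule subspace_parabolic)
  have subG: "mat.subspace G" unfolding G_def by (rule subspace_incidence)
  have bil: "bilinear_form_on matrix_scale G (\<lambda>x y. F (?br x y))"
    using bilinear_form_bracket[OF tr] F unfolding G_def by auto
  have bilP: "bilinear_form_on matrix_scale (parabolic a) (\<lambda>x y. F (?br x y))"
    using bil PG by (auto simp: bilinear_form_on_def linear_form_on_def subset_iff)
  have subS: "mat.subspace ?S"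
    unfolding form_stabilizer_eq_radical by (rule mat.subspace_radical[OF bilP subP])
  have br_one: "?br x ?one = 0" "?br ?one x = 0" if "x \<in> G" for x
    using that Fs unfolding G_def
    by (auto simp: bracket_def mprod_identity_left mprod_identity_right)
  have F0: "F 0 = 0" by (rule mat.linear_form_on_0[OF F subG])
  have split: "\<exists>c. x - matrix_scale c ?one \<in> parabolic a" if x: "x \<in> G" for x
  proof -
    let ?c = "matrix_trace n x / of_nat n"
    have "matrix_trace n (x - matrix_scale ?c ?one) = 0"
      using matrix_trace_add[of n "x - matrix_scale ?c ?one" "matrix_scale ?c ?one"] n
      by (simp add: matrix_trace_scale matrix_trace_identity)
    moreover have "x - matrix_scale ?c ?one \<in> G"
      by (intro mat.subspace_diff[OF subG] mat.subspace_scale[OF subG] x one)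
    ultimately show ?thesis by (auto simp: parabolic_eq G_def n_def)
  qed
  have shift: "?br (x + matrix_scale c ?one) y = ?br x y" "?br x (y + matrix_scale c ?one) = ?br x y"
    if "x \<in> G" "y \<in> G" for x y c
    using br_one that by (simp_all add: bracket_add_left bracket_add_right bracket_scale_left bracket_scale_right)
  obtain B where B: "B \<subseteq> ?S" "mat.independent B" "?S \<subseteq> mat.span B" "card B = mat.dim ?S"
    using mat.basis_exists by blast
  have span: "mat.span B = ?S" using B(1,3) subS mat.span_minimal by blast
  have SP: "?S \<subseteq> parabolic a" by (auto simp: form_stabilizer_def)
  have "?one \<notin> mat.span B"
  proof
    assume "?one \<in> mat.span B"
    then have "?one \<in> parabolic a" using span SP by auto
    then show False using n matrix_trace_identity[of n, where ?'k = 'k] by (simp add: parabolic_eq n_def)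
  qed
  then have ind: "mat.independent (insert ?one B)" using B(2) by (rule mat.independent_insertI)
  have "mat.span (insert ?one B) = form_stabilizer ?br G F"
    unfolding mat.span_insert span
  proof (intro equalityI subsetI)
    fix x assume "x \<in> {x. \<exists>c. x - matrix_scale c ?one \<in> ?S}"
    then obtain c where c: "x - matrix_scale c ?one \<in> ?S" by auto
    define x0 where "x0 = x - matrix_scale c ?one"
    have x: "x = x0 + matrix_scale c ?one" by (simp add: x0_def)
    have x0: "x0 \<in> G" "\<And>y. y \<in> parabolic a \<Longrightarrow> F (?br x0 y) = 0"
      using c SP PG by (auto simp: x0_def form_stabilizer_def)
    have "x \<in> G" unfolding x by (intro mat.subspace_add[OF subG] mat.subspace_scale[OF subG] x0 one)
    moreover have "F (?br x y) = 0" if y: "y \<in> G" for y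
    proof -
      obtain d where d: "y - matrix_scale d ?one \<in> parabolic a" using split[OF y] by auto
      then have "y - matrix_scale d ?one \<in> G" using PG by auto
      then have "?br x0 y = ?br x0 (y - matrix_scale d ?one)"
        using shift(2)[OF x0(1), of "y - matrix_scale d ?one" d] by simp
      then show ?thesis using x0(2)[OF d] shift(1)[OF x0(1) y] by (simp add: x)
    qed
    ultimately show "x \<in> form_stabilizer ?br G F" by (simp add: form_stabilizer_def)
  next
    fix x assume x: "x \<in> form_stabilizer ?br G F"
    then have xG: "x \<in> G" by (simp add: form_stabilizer_def)
    obtain c where c: "x - matrix_scale c ?one \<in> parabolic a" using split[OF xG] by auto
    have "F (?br (x - matrix_scale c ?one) y) = 0" if y: "y \<in> parabolic a" for y
    proof -
      have "?br (x - matrix_scale c ?one) y = ?br x y"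
        using shift(1)[of "x - matrix_scale c ?one" y c, OF subsetD[OF PG c] subsetD[OF PG y]] by simp
      then show ?thesis using x y PG by (auto simp: form_stabilizer_def)
    qed
    then show "x \<in> {x. \<exists>c. x - matrix_scale c ?one \<in> ?S}" using c by (auto simp: form_stabilizer_def)
  qed
  then have "mat.dim (form_stabilizer ?br G F) = card (insert ?one B)"
    using mat.dim_span_eq_card_independent[OF ind] by simp
  also have "\<dots> = Suc (card B)"
  proof (rule card_insert_disjoint)
    have "B \<subseteq> mat.span ((\<lambda>(a, b). unit_matrix a b) ` parabolic_rel a)"
      using B(1) SP PG incidence_subset_span[OF finite_parabolic_rel[of a]]
      unfolding G_def by blast
    then show "finite B"
      using mat.independent_span_bound[OF finite_imageI[OF finite_parabolic_rel] B(2)] by blast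
    show "?one \<notin> B" using \<open>?one \<notin> mat.span B\<close> mat.span_base by blast
  qed
  finally show ?thesis using B(4) by simp
qed

lemma Suc_parabolic_index:
  "Suc (parabolic_index TYPE('k::field_char_0) a) = incidence_index TYPE('k) (parabolic_rel a)"
proof -
  let ?n = "comp_size a"
  let ?br = "bracket {..<?n} :: 'k matrix \<Rightarrow> _"
  let ?G = "incidence (parabolic_rel a) :: 'k matrix set"
  let ?P = "parabolic a :: 'k matrix set"
  let ?one = "identity_on {..<?n} :: 'k matrix"
  have PG: "?P \<subseteq> ?G" by (auto simp: parabolic_eq)
  have Fs: "Field (parabolic_rel a) \<subseteq> {..<?n}"
    by (auto simp: parabolic_rel_def blow_up_def Field_def)
  have idxG: "incidence_index TYPE('k) (parabolic_rel a) = lie_index matrix_scale ?br ?G"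
    by (rule incidence_index_superset[OF Fs]) simp
  have idxP: "parabolic_index TYPE('k) a = lie_index matrix_scale ?br ?P"
    by (simp add: parabolic_index_def commutator_eq_bracket)
  have n: "(of_nat ?n :: 'k) \<noteq> 0" using comp_size_pos[of a] by simp
  show ?thesis
  proof (rule antisym)
    obtain F where F: "linear_form_on matrix_scale ?G F"
      "lie_index matrix_scale ?br ?G = mat.dim (form_stabilizer ?br ?G F)"
      by (rule mat.lie_index_attained)
    have "linear_form_on matrix_scale ?P F"
      using F(1) PG unfolding linear_form_on_def by blast
    then have "lie_index matrix_scale ?br ?P \<le> mat.dim (form_stabilizer ?br ?P F)"
      by (rule mat.lie_index_le)
    then show "Suc (parabolic_index TYPE('k) a) \<le> incidence_index TYPE('k) (parabolic_rel a)"
      using dim_stabilizer_parabolic[OF F(1)] F(2) idxG idxP by simp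
  next
    obtain f where f: "linear_form_on matrix_scale ?P f"
      "lie_index matrix_scale ?br ?P = mat.dim (form_stabilizer ?br ?P f)"
      by (rule mat.lie_index_attained)
    \<comment> \<open>the projection to the trace zero part along the scalar matrices\<close>
    define p where "p x = x - matrix_scale (matrix_trace ?n x / of_nat ?n) ?one" for x
    have one: "?one \<in> ?G"
      by (auto simp: incidence_def identity_on_def parabolic_rel_def blow_up_def chain_rel_def)
    have pP: "p x \<in> ?P" if "x \<in> ?G" for x
    proof -
      have "matrix_trace ?n (p x) = 0"
        using matrix_trace_add[of ?n "p x" "matrix_scale (matrix_trace ?n x / of_nat ?n) ?one"] n
        by (simp add: p_def matrix_trace_scale matrix_trace_identity)
      moreover have "p x \<in> ?G" unfolding p_def
        by (intro mat.subspace_diff mat.subspace_scale subspace_incidence that one)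
      ultimately show ?thesis by (simp add: parabolic_eq)
    qed
    have p_add: "p (x + y) = p x + p y" for x y
      by (simp add: p_def matrix_trace_add add_divide_distrib mat.scale_left_distrib)
    have p_scale: "p (matrix_scale c x) = matrix_scale c (p x)" for c x
      by (simp add: p_def matrix_trace_scale mat.scale_right_diff_distrib)
    have F: "linear_form_on matrix_scale ?G (f \<circ> p)"
      using f(1) pP by (simp add: linear_form_on_def p_add p_scale)
    have "p x = x" if "x \<in> ?P" for x using that by (simp add: p_def parabolic_eq)
    then have "form_stabilizer ?br ?P (f \<circ> p) = form_stabilizer ?br ?P f"
      using commutator_in_parabolic[of _ a, where ?'k = 'k, unfolded commutator_eq_bracket]
      unfolding form_stabilizer_def by (metis (no_types, lifting) comp_apply)
    then have "mat.dim (form_stabilizer ?br ?G (f \<circ> p)) = Suc (lie_index matrix_scale ?br ?P)"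
      using dim_stabilizer_parabolic[OF F] f(2) by simp
    then show "incidence_index TYPE('k) (parabolic_rel a) \<le> Suc (parabolic_index TYPE('k) a)"
      using mat.lie_index_le[OF F, of ?br] idxG idxP by simp
  qed
qed

lemma card_block:
  "card {i \<in> {..<comp_size a}. block_of a i = q} = sizes (parts a) q"
proof -
  let ?l = "parts a"
  define S where "S k = sum_list (take k ?l)" for k
  have len: "?l \<noteq> []" by (rule parts_neq_Nil)
  have S_mono: "S j \<le> S k" if "j \<le> k" for j k
  proof -
    have "take k ?l = take j ?l @ take (k - j) (drop j ?l)"
      using that by (metis le_add_diff_inverse take_add)
    then show ?thesis by (simp add: S_def)
  qed
  have S_len: "S (Suc (length ?l - 1)) = comp_size a" using len by (simp add: S_def comp_size_def)
  have S_le: "S k \<le> comp_size a" for k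
    using sum_list_append[of "take k ?l" "drop k ?l"] by (simp add: S_def comp_size_def)
  have iff: "block_of a i = q \<longleftrightarrow> q < length ?l \<and> S q \<le> i \<and> i < S (Suc q)" if i: "i < comp_size a" for i
  proof
    assume q: "block_of a i = q"
    have ex: "i < S (Suc (length ?l - 1))" using i S_len by simp
    have "i < S (Suc q)"
      using LeastI[of "\<lambda>k. i < S (Suc k)", OF ex] q by (simp add: block_of_def S_def)
    moreover have "q \<le> length ?l - 1"
      using Least_le[of "\<lambda>k. i < S (Suc k)", OF ex] q by (simp add: block_of_def S_def)
    moreover have "S q \<le> i"
    proof (cases q)
      case (Suc p)
      then have "\<not> i < S (Suc p)"
        using not_less_Least[of p "\<lambda>k. i < S (Suc k)"] q by (simp add: block_of_def S_def)
      then show ?thesis using Suc by simp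
    qed (simp add: S_def)
    ultimately show "q < length ?l \<and> S q \<le> i \<and> i < S (Suc q)" using len
      by (metis Suc_pred' le_imp_less_Suc length_greater_0_conv)
  next
    assume q: "q < length ?l \<and> S q \<le> i \<and> i < S (Suc q)"
    show "block_of a i = q" unfolding block_of_def S_def[symmetric]
    proof (rule Least_equality)
      fix k assume "i < S (Suc k)"
      then show "q \<le> k" using q S_mono[of "Suc k" q] by (meson leD le_less_trans not_less_eq_eq order_trans)
    qed (use q in simp)
  qed
  show ?thesis
  proof (cases "q < length ?l")
    case True
    have "{i \<in> {..<comp_size a}. block_of a i = q} = {S q..<S (Suc q)}"
      using iff True S_le[of "Suc q"] by force
    moreover have "S (Suc q) = S q + ?l ! q" using True by (simp add: S_def take_Suc_conv_app_nth)
    ultimately show ?thesis using True by (simp add: sizes_def)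
  next
    case False
    then have "{i \<in> {..<comp_size a}. block_of a i = q} = {}" using iff by auto
    then show ?thesis using False by (simp only: card.empty) (simp add: sizes_def)
  qed
qed

lemma Suc_parabolic_index_eq_chain_index:
  "Suc (parabolic_index TYPE('k::field_char_0) a) = labelled_index TYPE('k) chain_rel (sizes (parts a))"
  unfolding Suc_parabolic_index parabolic_rel_def
  by (rule labelled_index_eq[OF _ card_block trans_chain_rel]) simp

lemma parabolic_index_cong:
  assumes "labelled_index TYPE('k::field_char_0) chain_rel (sizes (parts a)) =
    labelled_index TYPE('k) chain_rel (sizes (parts b))"
  shows "parabolic_index TYPE('k) a = parabolic_index TYPE('k) b"
  using assms unfolding Suc_parabolic_index_eq_chain_index[symmetric] by simp

lemma parabolic_index_theta:
  "parabolic_index TYPE('k::field_char_0) (theta a) = parabolic_index TYPE('k) a"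
  by (rule parabolic_index_cong) (simp add: theta.rep_eq chain_index_rev)

lemma parabolic_index_sigma:
  "parabolic_index TYPE('k::field_char_0) (sigma m a) = parabolic_index TYPE('k) a"
proof (rule parabolic_index_cong)
  obtain x as where "parts a = x # as" using parts_neq_Nil[of a] by (cases "parts a") auto
  then show "labelled_index TYPE('k) chain_rel (sizes (parts (sigma m a))) =
      labelled_index TYPE('k) chain_rel (sizes (parts a))"
    using chain_index_sigma[of m x as, where ?'k = 'k] by (simp add: sigma.rep_eq)
qed

lemma parabolic_index_tau:
  "parabolic_index TYPE('k::field_char_0) (tau m a) = parabolic_index TYPE('k) a"
proof (rule parabolic_index_cong)
  show "labelled_index TYPE('k) chain_rel (sizes (parts (tau m a))) =
      labelled_index TYPE('k) chain_rel (sizes (parts a))"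
    using chain_index_tau[of m, where ?'k = 'k]
    by (cases "(m, parts a)" rule: tau_list.cases) (simp_all add: tau.rep_eq)
qed

lemma parabolic_index_letter:
  assumes "g \<in> alphabet"
  shows "parabolic_index TYPE('k::field_char_0) (g a) = parabolic_index TYPE('k) a"
  using assms
  by (auto simp: alphabet_def sigma_rev_def tau_rev_def parabolic_index_theta
      parabolic_index_sigma parabolic_index_tau)

lemma parabolic_index_submonoid:
  assumes "w \<in> generated_submonoid alphabet"
  shows "parabolic_index TYPE('k::field_char_0) (w a) = parabolic_index TYPE('k) a"
  using assms by (induction arbitrary: a) (simp_all add: parabolic_index_letter)

section \<open>Freeness\<close>

lemma theta_theta: "theta (theta a) = a"
  by (simp add: theta.rep_eq flip: parts_inject)

lemma parts_sigma:
  obtains x as where "parts a = x # as" "0 < x" "parts (sigma m a) = (m + 2) * x # as @ [(m + 1) * x]"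
proof -
  obtain x as where "parts a = x # as" using parts_neq_Nil[of a] by (cases "parts a") auto
  moreover have "0 < x" using parts_pos[of x a] calculation by auto
  ultimately show ?thesis using that by (simp add: sigma.rep_eq)
qed

lemma parts_tau:
  assumes "2 \<le> length (parts a)"
  obtains x y as where "parts a = x # y # as" "0 < x" "0 < y"
    "parts (tau m a) = ((m + 1) * x + (m + 2) * y) # as @ [m * x + (m + 1) * y]"
proof -
  obtain x y as where a: "parts a = x # y # as"
    using assms by (cases "parts a"; cases "tl (parts a)") auto
  then have "0 < x" "0 < y" using parts_pos[of _ a] by auto
  then show ?thesis using that a by (simp add: tau.rep_eq)
qed

text \<open>
  This separates the letters without reversal from those with it.
\<close>
lemma last_less_hd:
  assumes "2 \<le> length (parts a)"
  shows "last (parts (sigma m a)) < hd (parts (sigma m a))"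
    and "last (parts (tau m a)) < hd (parts (tau m a))"
proof -
  obtain x as where "0 < x" "parts (sigma m a) = (m + 2) * x # as @ [(m + 1) * x]" by (rule parts_sigma)
  then show "last (parts (sigma m a)) < hd (parts (sigma m a))" by simp
  obtain x y as where "0 < x" "0 < y"
    "parts (tau m a) = ((m + 1) * x + (m + 2) * y) # as @ [m * x + (m + 1) * y]"
    by (rule parts_tau[OF assms])
  then show "last (parts (tau m a)) < hd (parts (tau m a))" by simp
qed

text \<open>
  The difference of the first and the last part of \<open>sigma m a\<close> is the first part of \<open>a\<close>.
\<close>
lemma sigma_inject:
  assumes "sigma m a = sigma m' a'"
  shows "m = m' \<and> a = a'"
proof -
  obtain x as where a: "parts a = x # as" "0 < x" "parts (sigma m a) = (m + 2) * x # as @ [(m + 1) * x]"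
    by (rule parts_sigma)
  obtain x' as' where a': "parts a' = x' # as'" "0 < x'" "parts (sigma m' a') = (m' + 2) * x' # as' @ [(m' + 1) * x']"
    by (rule parts_sigma)
  have e: "(m + 2) * x = (m' + 2) * x'" "(m + 1) * x = (m' + 1) * x'" "as = as'"
    using a a' assms by auto
  then have "x = x'" by simp
  then show ?thesis using e a a' by (simp flip: parts_inject)
qed

lemma quotient_remainder_unique:
  fixes k k' d r r' :: nat
  assumes "k * d + r = k' * d + r'" "r < d" "r' < d"
  shows "k = k' \<and> r = r'"
proof -
  have "(k * d + r) div d = k" "(k' * d + r') div d = k'" using assms(2,3) by simp_all
  then have "k = k'" using assms(1) by simp
  then show ?thesis using assms(1) by simp
qed

text \<open>
  For \<open>a = (x, y, \<dots>)\<close> the difference \<open>d\<close> of the first and the last part of \<open>tau m a\<close> is \<open>x + y\<close>,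
  and the last part is \<open>m d + y\<close> with \<open>y < d\<close>.
\<close>
lemma tau_inject:
  assumes "2 \<le> length (parts a)" "2 \<le> length (parts a')" and eq: "tau m a = tau m' a'"
  shows "m = m' \<and> a = a'"
proof -
  obtain x y as where a: "parts a = x # y # as" "0 < x" "0 < y"
    "parts (tau m a) = ((m + 1) * x + (m + 2) * y) # as @ [m * x + (m + 1) * y]"
    by (rule parts_tau[OF assms(1)])
  obtain x' y' as' where a': "parts a' = x' # y' # as'" "0 < x'" "0 < y'"
    "parts (tau m' a') = ((m' + 1) * x' + (m' + 2) * y') # as' @ [m' * x' + (m' + 1) * y']"
    by (rule parts_tau[OF assms(2)])
  have e: "(m + 1) * x + (m + 2) * y = (m' + 1) * x' + (m' + 2) * y'"
    "m * x + (m + 1) * y = m' * x' + (m' + 1) * y'" "as = as'"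
    using a(4) a'(4) eq by auto
  then have s: "x + y = x' + y'" by (simp add: algebra_simps)
  have "m * (x + y) + y = m' * (x + y) + y'" using e(2) unfolding s by (simp add: algebra_simps) (metis s add.assoc distrib_left)
  then have "m = m' \<and> y = y'" by (rule quotient_remainder_unique) (use a a' s in auto)
  then show ?thesis using s e a a' by (simp flip: parts_inject)
qed

text \<open>
  The last part is a multiple of the difference of the first and the last part for \<open>sigma\<close>, but
  not for \<open>tau\<close>.
\<close>
lemma sigma_neq_tau:
  assumes "2 \<le> length (parts a')"
  shows "sigma m a \<noteq> tau m' a'"
proof
  assume eq: "sigma m a = tau m' a'"
  obtain x as where a: "parts a = x # as" "0 < x" "parts (sigma m a) = (m + 2) * x # as @ [(m + 1) * x]"
    by (rule parts_sigma)
  obtain x' y' as' where a': "0 < x'" "0 < y'"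
    "parts (tau m' a') = ((m' + 1) * x' + (m' + 2) * y') # as' @ [m' * x' + (m' + 1) * y']"
    by (rule parts_tau[OF assms])
  have e: "(m + 2) * x = (m' + 1) * x' + (m' + 2) * y'" "(m + 1) * x = m' * x' + (m' + 1) * y'"
    using a(3) a'(3) eq by auto
  then have s: "x = x' + y'" by (simp add: algebra_simps)
  have "(m + 1) * x + 0 = m' * x + y'" using e(2) by (simp add: s algebra_simps)
  then have "m + 1 = m' \<and> 0 = y'" by (rule quotient_remainder_unique) (use a a' s in auto)
  then show False using a' by simp
qed

lemma letter_cases:
  assumes "g \<in> alphabet"
  obtains (sigma) m where "g = sigma m" | (sigma_rev) m where "g = theta \<circ> sigma m"
    | (tau) m where "g = tau m" | (tau_rev) m where "g = theta \<circ> tau m"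
  using assms by (auto simp: alphabet_def sigma_rev_def[abs_def] tau_rev_def[abs_def])

lemma hd_last_theta: "hd (parts (theta a)) = last (parts a)" "last (parts (theta a)) = hd (parts a)"
  by (simp_all add: theta.rep_eq hd_rev last_rev)

lemma letter_inject:
  assumes g: "g \<in> alphabet" and g': "g' \<in> alphabet"
    and len: "2 \<le> length (parts a)" "2 \<le> length (parts a')" and eq: "g a = g' a'"
  shows "g = g' \<and> a = a'"
proof -
  have neq: "theta b \<noteq> b'" if "last (parts b) < hd (parts b)" "last (parts b') < hd (parts b')" for b b'
    using that hd_last_theta[of b] by auto
  have inj: "theta b = theta b' \<longleftrightarrow> b = b'" for b b' by (metis theta_theta)
  note basic = last_less_hd[OF len(1)] last_less_hd[OF len(2)]
  show ?thesis
    using g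
  proof (cases rule: letter_cases)
    case (sigma m)
    show ?thesis using g' 
      by (cases rule: letter_cases)
        (use eq sigma basic sigma_inject[of m a _ a'] sigma_neq_tau[OF len(2), of m a] neq in \<open>metis comp_apply\<close>)+
  next
    case (sigma_rev m)
    show ?thesis using g' 
      by (cases rule: letter_cases)
        (use eq sigma_rev basic sigma_inject[of m a _ a'] sigma_neq_tau[OF len(2), of m a] neq inj in \<open>metis comp_apply\<close>)+
  next
    case (tau m)
    show ?thesis using g' 
      by (cases rule: letter_cases)
        (use eq tau basic tau_inject[OF len, of m] sigma_neq_tau[OF len(1), of _ a' m] neq in \<open>metis comp_apply\<close>)+
  next
    case (tau_rev m)
    show ?thesis using g' 
      by (cases rule: letter_cases)
        (use eq tau_rev basic tau_inject[OF len, of m] sigma_neq_tau[OF len(1), of _ a' m] neq inj in \<open>metis comp_apply\<close>)+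
  qed
qed

lemma letter_grows:
  assumes "g \<in> alphabet" "2 \<le> length (parts a)"
  shows "2 \<le> length (parts (g a)) \<and> comp_size a < comp_size (g a)"
proof -
  have th: "length (parts (theta b)) = length (parts b)" "comp_size (theta b) = comp_size b" for b
    by (simp_all add: theta.rep_eq comp_size_def)
  have s: "2 \<le> length (parts (sigma m a)) \<and> comp_size a < comp_size (sigma m a)" for m
  proof -
    obtain x as where "parts a = x # as" "0 < x" "parts (sigma m a) = (m + 2) * x # as @ [(m + 1) * x]"
      by (rule parts_sigma)
    then show ?thesis by (simp add: comp_size_def)
  qed
  have t: "2 \<le> length (parts (tau m a)) \<and> comp_size a < comp_size (tau m a)" for m
  proof -
    obtain x y as where "parts a = x # y # as" "0 < x" "0 < y"
      "parts (tau m a) = ((m + 1) * x + (m + 2) * y) # as @ [m * x + (m + 1) * y]"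
      by (rule parts_tau[OF assms(2)])
    then show ?thesis by (simp add: comp_size_def)
  qed
  show ?thesis using assms(1) by (cases rule: letter_cases) (simp_all add: s t th)
qed

lemma word_product_simps [simp]:
  "word_product [] = id" "word_product (g # gs) = g \<circ> word_product gs"
  by (simp_all add: word_product_def)

lemma word_product_append: "word_product (gs @ hs) = word_product gs \<circ> word_product hs"
  by (induction gs) (simp_all add: comp_assoc)

lemma word_grows:
  assumes "gs \<in> lists alphabet" "2 \<le> length (parts a)"
  shows "2 \<le> length (parts (word_product gs a)) \<and> comp_size a \<le> comp_size (word_product gs a)"
  using assms
proof (induction gs)
  case (Cons g gs)
  then show ?case using letter_grows[of g "word_product gs a"] by auto
qed simp

text \<open>
  Letters are stripped off one by one with \<open>letter_inject\<close>; a word cannot be used up before the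
  other one, because letters strictly increase the number that is composed.
\<close>
lemma word_inject:
  assumes "gs \<in> lists alphabet" "hs \<in> lists alphabet" "2 \<le> length (parts a)"
    and "word_product gs a = word_product hs a"
  shows "gs = hs"
  using assms
proof (induction gs arbitrary: hs rule: list.induct)
  case Nil
  show ?case
  proof (cases hs)
    case (Cons h hs')
    then show ?thesis
      using Nil letter_grows[of h "word_product hs' a"] word_grows[of hs' a] by auto
  qed simp
next
  case (Cons g gs)
  show ?case
  proof (cases hs)
    case Nil
    then show ?thesis
      using Cons letter_grows[of g "word_product gs a"] word_grows[of gs a] by auto
  next
    case hs: (Cons h hs')
    have gh: "g \<in> alphabet" "gs \<in> lists alphabet" "h \<in> alphabet" "hs' \<in> lists alphabet"
      using Cons.prems(1,2) unfolding hs by (auto dest: listsE)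
    have "g = h \<and> word_product gs a = word_product hs' a"
      using Cons.prems(4) word_grows[OF gh(2) Cons.prems(3)] word_grows[OF gh(4) Cons.prems(3)]
      by (intro letter_inject gh) (simp_all add: hs)
    then show ?thesis using Cons.IH[OF gh(2,4) Cons.prems(3)] hs by simp
  qed
qed

lemma generated_submonoid_word:
  assumes "w \<in> generated_submonoid S"
  shows "\<exists>gs\<in>lists S. word_product gs = w"
  using assms
proof induction
  case one
  show ?case by (intro bexI[of _ "[]"]) simp_all
next
  case (incl g)
  then show ?case by (intro bexI[of _ "[g]"]) simp_all
next
  case (mult v w)
  then obtain gs hs where "gs \<in> lists S" "hs \<in> lists S" "word_product gs = v" "word_product hs = w" by blast
  then show ?case by (intro bexI[of _ "gs @ hs"]) (simp_all add: word_product_append)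
qed

lemma alphabet_free: "free_in_alphabet alphabet (generated_submonoid alphabet)"
  unfolding free_in_alphabet_def
proof
  fix w assume "w \<in> generated_submonoid alphabet"
  then obtain gs where gs: "gs \<in> lists alphabet" "word_product gs = w"
    using generated_submonoid_word by blast
  \<comment> \<open>Two parts are needed, because every \<open>tau m\<close> fixes the compositions with one part.\<close>
  let ?a = "Composition [1, 1]"
  have "2 \<le> length (parts ?a)" by (simp add: Composition_inverse)
  then show "\<exists>!gs. gs \<in> lists alphabet \<and> word_product gs = w"
    using gs word_inject[of _ _ ?a] by metis
qed

theorem proposition5p3:
  shows "(\<forall>w \<in> generated_submonoid alphabet. \<forall>a.
            parabolic_index TYPE('k::{alg_closed_field, field_char_0}) (w a) =
            parabolic_index TYPE('k) a)
       \<and> free_in_alphabet alphabet (generated_submonoid alphabet)"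
  using parabolic_index_submonoid alphabet_free by blast

end
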